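(* Let $[a,b]$ be a compact interval with $a<b$, let $\alpha\in\mathbb{R}$, let $r\ge 1$ be an integer, and let $k\in\mathcal{C}^{r}([a,b]\times[a,b])$. Let $X=\mathcal{L}^{\infty}[a,b]$ (over $\mathbb{C}$), and let $\mathcal{A}\in BL(X)$ be defined by $$\mathcal{A}f(x)=\alpha\int_a^b k(x,u)f(u)\,du-x^2f(x).$$ For each integer $n>1$ let $a=x_0<x_1<\dots<x_n=b$ be a partition of $[a,b]$ (depending on $n$) with norm $h=h(n)=\max_{1\le j\le n}(x_j-x_{j-1})$, where $h(n)\to 0$ as $n\to\infty$. Put $N_h=nr$, and let $\mathcal{A}_{N_h}=\mathcal{K}_{N_h}-\mathcal{M}_{N_h}\in BL(X)$ be the degenerate kernel approximation of $\mathcal{A}$ associated with this partition and with the $r$ Gauss points, as defined in the context. Let $\lambda$ be an eigenvalue of $\mathcal{A}$ that is an isolated point of $\sigma(\mathcal{A})$, let $0<\epsilon<\operatorname{dist}(\lambda,\sigma(\mathcal{A})\setminus\{\lambda\})$, and set $$\Lambda_n=\{\mu\in\sigma(\mathcal{A}_{N_h}) : |\mu-\lambda|<\epsilon\}.$$ Then: (i) (Convergence) $\Lambda_n\neq\emptyset$ for all sufficiently large $n$, and whenever $\lambda_{N_h}\in\Lambda_n$ for all sufficiently large $n$, one has $\lambda_{N_h}\to\lambda$ as $n\to\infty$. (ii) (Rate) If moreover $\lambda$ is a simple eigenvalue of $\mathcal{A}$, then $|\lambda_{N_h}-\lambda|=O(h)$; that is, there are a constant $C$ and an integer $n_0$ such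 that for all $n\ge n_0$ and all $\lambda_{N_h}\in\Lambda_n$, $$|\lambda_{N_h}-\lambda|\le C\,h(n).$$
   Context: For a complex Banach space $Y$, $BL(Y)$ denotes the bounded linear operators from $Y$ to $Y$. For $T\in BL(Y)$, the resolvent set is $\rho(T)=\{z\in\mathbb{C}:(T-zI)^{-1}\in BL(Y)\}$ and the spectrum is $\sigma(T)=\mathbb{C}\setminus\rho(T)$. A number $\lambda\in\sigma(T)$ is an eigenvalue if $T-\lambda I$ is not one-to-one. The ascent of an eigenvalue $\lambda$ is the smallest positive integer $l$ with $\ker(T-\lambda I)^l=\ker(T-\lambda I)^{l+1}$, and its algebraic multiplicity is $\dim\ker(T-\lambda I)^l$. An eigenvalue is simple if its algebraic multiplicity equals one. Definition of $\mathcal{A}_{N_h}$ for a partition $a=x_0<\dots<x_n=b$. Let $I_j=[x_{j-1},x_j]$ for $j=1,\dots,n$. Let $\tau_1,\dots,\tau_r\in[-1,1]$ be the $r$ Gauss points, i.e. the zeros of the Legendre polynomial $\frac{d^r}{dt^r}(t^2-1)^r$. Let $f_j:[-1,1]\to I_j$ be given by $f_j(t)=\frac{1-t}{2}x_{j-1}+\frac{1+t}{2}x_j$, and put $\xi_{ij}=f_j(\tau_i)$ for $i=1,\dots,r$, $j=1,\dots,n$. Let $\ell_i$ be the Lagrange polynomial of degree $r-1$ with $\ell_i(\tau_j)=\delta_{ij}$ (so $\ell_1\equiv 1$ if $r=1$). Define $\phi_{pq}(x)=\ell_p(f_q^{-1}(x))$ for $x\in I_q$ and $\phi_{pq}(x)=0$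 otherwise. Relabel $t_{(j-1)r+i}=\xi_{ij}$ and $\psi_{(j-1)r+i}=\phi_{ij}$ for $i=1,\dots,r$, $j=1,\dots,n$, and let $N_h=nr$. The degenerate kernel is $$k_{N_h}(x,u)=\sum_{i=1}^{N_h}\sum_{j=1}^{N_h}k(t_i,t_j)\psi_i(x)\psi_j(u),$$ and $$\mathcal{K}_{N_h}f(x)=\alpha\int_a^b k_{N_h}(x,u)f(u)\,du.$$ Let $s_{N_h}$ be the piecewise constant function on $[a,b]$ with $s_{N_h}(x)=\left(\frac{x_{i-1}+x_i}{2}\right)^2$ for $x\in I_i$, $i=1,\dots,n$, and let $\mathcal{M}_{N_h}f(x)=s_{N_h}(x)f(x)$. Values at the finitely many partition points are immaterial, since functions in $X$ are considered up to null sets. *)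

theory Defs
  imports "HOL-Analysis.Analysis" "HOL-Probability.Essential_Supremum"
    "HOL-Computational_Algebra.Polynomial"
begin

section \<open>Complex normed spaces\<close>

class complex_normed_space = real_normed_vector +
  fixes scaleC :: "complex \<Rightarrow> 'a \<Rightarrow> 'a"  (infixr \<open>*\<^sub>C\<close> 75)
  assumes scaleC_add_right: "c *\<^sub>C (f + g) = c *\<^sub>C f + c *\<^sub>C g"
    and scaleC_add_left: "(c + d) *\<^sub>C f = c *\<^sub>C f + d *\<^sub>C f"
    and scaleC_scaleC: "c *\<^sub>C d *\<^sub>C f = (c * d) *\<^sub>C f"
    and scaleC_one: "1 *\<^sub>C f = f"
    and scaleR_scaleC: "t *\<^sub>R f = complex_of_real t *\<^sub>C f"
    and norm_scaleC: "norm (c *\<^sub>C f) = cmod c * norm f"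

lemma vector_space_scaleC:
  "vector_space (scaleC :: complex \<Rightarrow> 'a \<Rightarrow> 'a::complex_normed_space)"
  by unfold_locales (simp_all add: scaleC_add_right scaleC_add_left scaleC_scaleC scaleC_one)

section \<open>Spectral notions\<close>

text \<open>The Banach space \<open>Y\<close> is a closed complex subspace of the type \<open>'a\<close>; the
  behaviour of an operator \<open>T\<close> outside \<open>Y\<close> is irrelevant to every notion below.\<close>

definition BL :: "'a::complex_normed_space set \<Rightarrow> ('a \<Rightarrow> 'a) set" where
  "BL Y = {T. (\<forall>f\<in>Y. T f \<in> Y)
            \<and> (\<forall>f\<in>Y. \<forall>g\<in>Y. T (f + g) = T f + T g)
            \<and> (\<forall>c. \<forall>f\<in>Y. T (c *\<^sub>C f) = c *\<^sub>C T f)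
            \<and> (\<exists>C. \<forall>f\<in>Y. norm (T f) \<le> C * norm f)}"

definition resolvent_set :: "'a::complex_normed_space set \<Rightarrow> ('a \<Rightarrow> 'a) \<Rightarrow> complex set" where
  "resolvent_set Y T =
     {z. \<exists>S\<in>BL Y. \<forall>f\<in>Y. S (T f - z *\<^sub>C f) = f \<and> T (S f) - z *\<^sub>C S f = f}"

definition spectrum :: "'a::complex_normed_space set \<Rightarrow> ('a \<Rightarrow> 'a) \<Rightarrow> complex set" where
  "spectrum Y T = - resolvent_set Y T"

definition eigenvalue :: "'a::complex_normed_space set \<Rightarrow> ('a \<Rightarrow> 'a) \<Rightarrow> complex \<Rightarrow> bool" where
  "eigenvalue Y T z \<longleftrightarrow> z \<in> spectrum Y T \<and> \<not> inj_on (\<lambda>f. T f - z *\<^sub>C f) Y"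

definition ker_pow ::
    "'a::complex_normed_space set \<Rightarrow> ('a \<Rightarrow> 'a) \<Rightarrow> complex \<Rightarrow> nat \<Rightarrow> 'a set" where
  "ker_pow Y T z l = {f\<in>Y. ((\<lambda>g. T g - z *\<^sub>C g) ^^ l) f = 0}"

definition finite_ascent ::
    "'a::complex_normed_space set \<Rightarrow> ('a \<Rightarrow> 'a) \<Rightarrow> complex \<Rightarrow> bool" where
  "finite_ascent Y T z \<longleftrightarrow> (\<exists>l>0. ker_pow Y T z l = ker_pow Y T z (l + 1))"

definition ascent :: "'a::complex_normed_space set \<Rightarrow> ('a \<Rightarrow> 'a) \<Rightarrow> complex \<Rightarrow> nat" where
  "ascent Y T z = (LEAST l. l > 0 \<and> ker_pow Y T z l = ker_pow Y T z (l + 1))"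

text \<open>The library dimension of an infinite-dimensional space is \<open>0\<close>, so value \<open>1\<close> below
  does mean one-dimensional over the complex numbers.\<close>

definition algebraic_multiplicity ::
    "'a::complex_normed_space set \<Rightarrow> ('a \<Rightarrow> 'a) \<Rightarrow> complex \<Rightarrow> nat" where
  "algebraic_multiplicity Y T z = vector_space.dim scaleC (ker_pow Y T z (ascent Y T z))"

definition simple_eigenvalue ::
    "'a::complex_normed_space set \<Rightarrow> ('a \<Rightarrow> 'a) \<Rightarrow> complex \<Rightarrow> bool" where
  "simple_eigenvalue Y T z \<longleftrightarrow>
     eigenvalue Y T z \<and> finite_ascent Y T z \<and> algebraic_multiplicity Y T z = 1"

section \<open>The space of essentially bounded functions\<close>

definition ess_bounded :: "(real \<Rightarrow> complex) \<Rightarrow> bool" where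
  "ess_bounded f \<longleftrightarrow> f \<in> borel_measurable lebesgue \<and> (\<exists>C. AE x in lebesgue. cmod (f x) \<le> C)"

definition ess_norm :: "(real \<Rightarrow> complex) \<Rightarrow> real" where
  "ess_norm f = real_of_ereal (esssup lebesgue (\<lambda>x. ereal (cmod (f x))))"

definition linf_rel :: "(real \<Rightarrow> complex) \<Rightarrow> (real \<Rightarrow> complex) \<Rightarrow> bool" where
  "linf_rel f g \<longleftrightarrow> ess_bounded f \<and> ess_bounded g \<and> (AE x in lebesgue. f x = g x)"

lemma ess_bounded_zero: "ess_bounded (\<lambda>x. 0)"
  unfolding ess_bounded_def by (auto intro!: exI[of _ 0])

lemma ess_bounded_add:
  assumes "ess_bounded f" "ess_bounded g" shows "ess_bounded (\<lambda>x. f x + g x)"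
proof -
  obtain C D where CD: "AE x in lebesgue. cmod (f x) \<le> C" "AE x in lebesgue. cmod (g x) \<le> D"
    using assms unfolding ess_bounded_def by blast
  have "AE x in lebesgue. cmod (f x + g x) \<le> C + D"
    using CD by eventually_elim (meson add_mono norm_triangle_ineq order_trans)
  then show ?thesis using assms unfolding ess_bounded_def by (auto intro!: borel_measurable_add)
qed

lemma ess_bounded_cmult:
  assumes "ess_bounded f" shows "ess_bounded (\<lambda>x. c * f x)"
proof -
  obtain C where C: "AE x in lebesgue. cmod (f x) \<le> C"
    using assms unfolding ess_bounded_def by blast
  have "AE x in lebesgue. cmod (c * f x) \<le> cmod c * C"
    using C by eventually_elim (simp add: norm_mult mult_left_mono)
  then show ?thesis using assms unfolding ess_bounded_def by (auto intro!: borel_measurable_times)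
qed

lemma esssup_cmod_nonneg:
  assumes "f \<in> borel_measurable lebesgue"
  shows "0 \<le> esssup lebesgue (\<lambda>x::real. ereal (cmod (f x)))"
proof -
  have "emeasure lebesgue (space lebesgue :: real set) \<noteq> 0" by simp
  then have "esssup lebesgue (\<lambda>x::real. 0::ereal) = 0" by (rule esssup_const)
  moreover have "esssup lebesgue (\<lambda>x::real. 0::ereal) \<le> esssup lebesgue (\<lambda>x. ereal (cmod (f x)))"
    by (rule esssup_mono) auto
  ultimately show ?thesis by simp
qed

lemma ess_norm_le_iff:
  assumes "ess_bounded f" "0 \<le> C"
  shows "ess_norm f \<le> C \<longleftrightarrow> (AE x in lebesgue. cmod (f x) \<le> C)"
proof -
  let ?s = "esssup lebesgue (\<lambda>x. ereal (cmod (f x)))"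
  have m: "(\<lambda>x. ereal (cmod (f x))) \<in> borel_measurable lebesgue" and mf: "f \<in> borel_measurable lebesgue"
    using assms(1) unfolding ess_bounded_def by auto
  obtain D where "AE x in lebesgue. cmod (f x) \<le> D"
    using assms(1) unfolding ess_bounded_def by blast
  then have "?s \<le> ereal D" by (intro esssup_I m) simp
  with esssup_cmod_nonneg[OF mf] obtain s where s: "?s = ereal s"
    by (cases "?s") auto
  have "(AE x in lebesgue. cmod (f x) \<le> C) \<longleftrightarrow> ?s \<le> ereal C"
  proof
    assume "AE x in lebesgue. cmod (f x) \<le> C"
    then show "?s \<le> ereal C" by (intro esssup_I m) simp
  next
    assume le: "?s \<le> ereal C"
    show "AE x in lebesgue. cmod (f x) \<le> C"
      using esssup_AE[of "\<lambda>x. ereal (cmod (f x))" lebesgue]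
      by eventually_elim (use le s in \<open>simp add: order_trans\<close>)
  qed
  then show ?thesis using s by (simp add: ess_norm_def)
qed

lemma ess_norm_nonneg: "ess_bounded f \<Longrightarrow> 0 \<le> ess_norm f"
  unfolding ess_norm_def ess_bounded_def by (simp add: esssup_cmod_nonneg real_of_ereal_pos)

lemma ess_norm_AE: "ess_bounded f \<Longrightarrow> AE x in lebesgue. cmod (f x) \<le> ess_norm f"
  using ess_norm_le_iff[of f "ess_norm f"] ess_norm_nonneg by blast

quotient_type linf = "real \<Rightarrow> complex" / partial: linf_rel
proof (rule part_equivpI)
  show "\<exists>f. linf_rel f f"
    using ess_bounded_zero unfolding linf_rel_def by auto
  show "symp linf_rel"
    unfolding linf_rel_def by (rule sympI) (auto elim: eventually_mono)
  show "transp linf_rel"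
  proof (rule transpI)
    fix f g h assume "linf_rel f g" "linf_rel g h"
    then have e: "AE x in lebesgue. f x = g x" "AE x in lebesgue. g x = h x"
      and b: "ess_bounded f" "ess_bounded h" by (auto simp: linf_rel_def)
    have "AE x in lebesgue. f x = h x" using e by eventually_elim simp
    then show "linf_rel f h" using b by (simp add: linf_rel_def)
  qed
qed

instantiation linf :: ab_group_add
begin

lift_definition zero_linf :: linf is "\<lambda>x. 0"
  by (simp add: linf_rel_def ess_bounded_zero)

lift_definition plus_linf :: "linf \<Rightarrow> linf \<Rightarrow> linf" is "\<lambda>f g x. f x + g x"
proof -
  fix f f' g g' assume "linf_rel f f'" "linf_rel g g'"
  then have e: "AE x in lebesgue. f x = f' x" "AE x in lebesgue. g x = g' x"
    and b: "ess_bounded f" "ess_bounded f'" "ess_bounded g" "ess_bounded g'"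
    by (auto simp: linf_rel_def)
  have "AE x in lebesgue. f x + g x = f' x + g' x" using e by eventually_elim simp
  then show "linf_rel (\<lambda>x. f x + g x) (\<lambda>x. f' x + g' x)"
    using b by (simp add: linf_rel_def ess_bounded_add)
qed

lift_definition uminus_linf :: "linf \<Rightarrow> linf" is "\<lambda>f x. - f x"
  using ess_bounded_cmult[where c = "-1"] by (auto simp: linf_rel_def)

definition minus_linf :: "linf \<Rightarrow> linf \<Rightarrow> linf" where
  "minus_linf f g = f + (- g)"

instance
  apply standard
      apply (transfer, simp add: linf_rel_def ess_bounded_add add.assoc)
     apply (transfer, simp add: linf_rel_def ess_bounded_add add.commute)
    apply (transfer, simp add: linf_rel_def)
   apply (transfer, simp add: linf_rel_def ess_bounded_zero)
  apply (simp add: minus_linf_def)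
  done

end

instantiation linf :: complex_normed_space
begin

lift_definition scaleC_linf :: "complex \<Rightarrow> linf \<Rightarrow> linf" is "\<lambda>c f x. c * f x"
  by (auto simp: linf_rel_def ess_bounded_cmult elim: eventually_mono)

definition scaleR_linf :: "real \<Rightarrow> linf \<Rightarrow> linf" where
  "scaleR_linf t f = complex_of_real t *\<^sub>C f"

lift_definition norm_linf :: "linf \<Rightarrow> real" is ess_norm
proof -
  fix f g assume *: "linf_rel f g"
  then have "AE x in lebesgue. ereal (cmod (f x)) = ereal (cmod (g x))"
    by (auto simp: linf_rel_def elim: eventually_mono)
  then have "esssup lebesgue (\<lambda>x. ereal (cmod (f x))) = esssup lebesgue (\<lambda>x. ereal (cmod (g x)))"
    by (intro esssup_AE_cong) (use * in \<open>auto simp: linf_rel_def ess_bounded_def\<close>)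
  then show "ess_norm f = ess_norm g" by (simp add: ess_norm_def)
qed

definition dist_linf :: "linf \<Rightarrow> linf \<Rightarrow> real" where
  "dist_linf f g = norm (f - g)"

definition sgn_linf :: "linf \<Rightarrow> linf" where
  "sgn_linf f = inverse (norm f) *\<^sub>R f"

definition uniformity_linf :: "(linf \<times> linf) filter" where
  "uniformity_linf = (INF e\<in>{0<..}. principal {(f, g). dist f g < e})"

definition open_linf :: "linf set \<Rightarrow> bool" where
  "open_linf U \<longleftrightarrow> (\<forall>f\<in>U. \<forall>\<^sub>F (f', g) in uniformity. f' = f \<longrightarrow> g \<in> U)"

instance
proof
  fix f g :: linf and c d :: complex and s t :: real and U :: "linf set"
  show add_right: "c *\<^sub>C (f + g) = c *\<^sub>C f + c *\<^sub>C g" for c and f g :: linf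
    by transfer (simp add: linf_rel_def ess_bounded_add ess_bounded_cmult algebra_simps)
  show add_left: "(c + d) *\<^sub>C f = c *\<^sub>C f + d *\<^sub>C f" for c d and f :: linf
    by transfer (simp add: linf_rel_def ess_bounded_add ess_bounded_cmult algebra_simps)
  show assoc: "c *\<^sub>C d *\<^sub>C f = (c * d) *\<^sub>C f" for c d and f :: linf
    by transfer (simp add: linf_rel_def ess_bounded_cmult algebra_simps)
  show one: "1 *\<^sub>C f = f" for f :: linf
    by transfer (simp add: linf_rel_def)
  show "t *\<^sub>R f = complex_of_real t *\<^sub>C f" by (rule scaleR_linf_def)
  show "s *\<^sub>R (f + g) = s *\<^sub>R f + s *\<^sub>R g" by (simp add: scaleR_linf_def add_right)
  show "(s + t) *\<^sub>R f = s *\<^sub>R f + t *\<^sub>R f" by (simp add: scaleR_linf_def add_left)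
  show "s *\<^sub>R t *\<^sub>R f = (s * t) *\<^sub>R f" by (simp add: scaleR_linf_def assoc)
  show "1 *\<^sub>R f = f" by (simp add: scaleR_linf_def one)
  show "dist f g = norm (f - g)" by (rule dist_linf_def)
  show "sgn f = inverse (norm f) *\<^sub>R f" by (rule sgn_linf_def)
  show "uniformity = (INF e\<in>{0<..}. principal {(f::linf, g). dist f g < e})"
    by (rule uniformity_linf_def)
  show "open U \<longleftrightarrow> (\<forall>f\<in>U. \<forall>\<^sub>F (f', g) in uniformity. f' = f \<longrightarrow> g \<in> U)"
    by (rule open_linf_def)
  show norm_eq: "norm f = 0 \<longleftrightarrow> f = 0" for f :: linf
  proof transfer
    fix f assume "linf_rel f f"
    then have b: "ess_bounded f" by (simp add: linf_rel_def)
    have "ess_norm f = 0 \<longleftrightarrow> ess_norm f \<le> 0" using ess_norm_nonneg[OF b] by auto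
    also have "\<dots> \<longleftrightarrow> (AE x in lebesgue. f x = 0)" using ess_norm_le_iff[OF b, of 0] by simp
    finally show "ess_norm f = 0 \<longleftrightarrow> linf_rel f (\<lambda>x. 0)"
      using b by (simp add: linf_rel_def ess_bounded_zero)
  qed
  show "norm (f + g) \<le> norm f + norm g"
  proof transfer
    fix f g assume "linf_rel f f" "linf_rel g g"
    then have b: "ess_bounded f" "ess_bounded g" by (simp_all add: linf_rel_def)
    have "AE x in lebesgue. cmod (f x + g x) \<le> ess_norm f + ess_norm g"
      using ess_norm_AE[OF b(1)] ess_norm_AE[OF b(2)]
      by eventually_elim (meson add_mono norm_triangle_ineq order_trans)
    then show "ess_norm (\<lambda>x. f x + g x) \<le> ess_norm f + ess_norm g"
      using ess_norm_le_iff[OF ess_bounded_add[OF b]] ess_norm_nonneg b by simp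
  qed
  have le: "norm (c *\<^sub>C f) \<le> cmod c * norm f" for c and f :: linf
  proof transfer
    fix c f assume "linf_rel f f"
    then have b: "ess_bounded f" by (simp add: linf_rel_def)
    have "AE x in lebesgue. cmod (c * f x) \<le> cmod c * ess_norm f"
      using ess_norm_AE[OF b] by eventually_elim (simp add: norm_mult mult_left_mono)
    then show "ess_norm (\<lambda>x. c * f x) \<le> cmod c * ess_norm f"
      using ess_norm_le_iff[OF ess_bounded_cmult[OF b]] ess_norm_nonneg[OF b] by simp
  qed
  show eq: "norm (c *\<^sub>C f) = cmod c * norm f" for c and f :: linf
  proof (cases "c = 0")
    case True
    have "(0::complex) *\<^sub>C f + (0::complex) *\<^sub>C f = 0 *\<^sub>C f" by (metis add_left add.right_neutral)
    then have "(0::complex) *\<^sub>C f = 0" by simp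
    moreover have "norm (0::linf) = 0"
      by (simp add: norm_eq)
    ultimately show ?thesis using True by simp
  next
    case False
    have "norm f = norm (inverse c *\<^sub>C c *\<^sub>C f)" using False by (simp add: assoc one)
    also have "\<dots> \<le> cmod (inverse c) * norm (c *\<^sub>C f)" by (rule le)
    finally have "cmod c * norm f \<le> norm (c *\<^sub>C f)"
      using False by (simp add: norm_inverse inverse_eq_divide norm_divide pos_divide_le_eq pos_le_divide_eq mult.commute)
    with le[of c f] show ?thesis by simp
  qed
  show "norm (t *\<^sub>R f) = \<bar>t\<bar> * norm f" by (simp add: scaleR_linf_def eq)
qed

end

text \<open>\<open>L\<^sup>\<infinity>[a,b]\<close> is identified with the classes of functions on the line that vanish almost
  everywhere outside \<open>[a,b]\<close> (extension by zero is an isometric isomorphism).\<close>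

definition Linf :: "real \<Rightarrow> real \<Rightarrow> linf set" where
  "Linf a b = {f. AE x in lebesgue. x \<notin> {a..b} \<longrightarrow> rep_linf f x = 0}"

definition linf_class :: "real \<Rightarrow> real \<Rightarrow> (real \<Rightarrow> complex) \<Rightarrow> linf" where
  "linf_class a b f = abs_linf (\<lambda>x. if x \<in> {a..b} then f x else 0)"

section \<open>The operator and its kernel\<close>

text \<open>\<open>m\<close> times continuous differentiability on the closed square, by iterated partial
  derivatives, which are one-sided at the boundary.\<close>

primrec C_on_square :: "nat \<Rightarrow> real \<Rightarrow> real \<Rightarrow> (real \<Rightarrow> real \<Rightarrow> complex) \<Rightarrow> bool" where
  "C_on_square 0 a b g \<longleftrightarrow> continuous_on ({a..b} \<times> {a..b}) (\<lambda>(x, u). g x u)"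
| "C_on_square (Suc m) a b g \<longleftrightarrow>
     continuous_on ({a..b} \<times> {a..b}) (\<lambda>(x, u). g x u) \<and>
     (\<exists>g1 g2. C_on_square m a b g1 \<and> C_on_square m a b g2 \<and>
        (\<forall>x\<in>{a..b}. \<forall>u\<in>{a..b}.
           ((\<lambda>s. g s u) has_vector_derivative g1 x u) (at x within {a..b}) \<and>
           ((\<lambda>s. g x s) has_vector_derivative g2 x u) (at u within {a..b})))"

definition integral_op ::
    "real \<Rightarrow> real \<Rightarrow> real \<Rightarrow> (real \<Rightarrow> real \<Rightarrow> complex) \<Rightarrow> linf \<Rightarrow> linf" where
  "integral_op a b \<alpha> k f =
     linf_class a b (\<lambda>x. of_real \<alpha> * (LINT u:{a..b}|lebesgue. k x u * rep_linf f u))"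

definition mult_op :: "real \<Rightarrow> real \<Rightarrow> (real \<Rightarrow> real) \<Rightarrow> linf \<Rightarrow> linf" where
  "mult_op a b s f = linf_class a b (\<lambda>x. of_real (s x) * rep_linf f x)"

definition A_op :: "real \<Rightarrow> real \<Rightarrow> real \<Rightarrow> (real \<Rightarrow> real \<Rightarrow> complex) \<Rightarrow> linf \<Rightarrow> linf" where
  "A_op a b \<alpha> k f = integral_op a b \<alpha> k f - mult_op a b (\<lambda>x. x\<^sup>2) f"

section \<open>The degenerate kernel approximation\<close>

definition is_partition :: "real \<Rightarrow> real \<Rightarrow> nat \<Rightarrow> (nat \<Rightarrow> real) \<Rightarrow> bool" where
  "is_partition a b n p \<longleftrightarrow> p 0 = a \<and> p n = b \<and> (\<forall>j\<in>{1..n}. p (j - 1) < p j)"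

definition mesh :: "nat \<Rightarrow> (nat \<Rightarrow> real) \<Rightarrow> real" where
  "mesh n p = Max ((\<lambda>j. p j - p (j - 1)) ` {1..n})"

definition legendre_poly :: "nat \<Rightarrow> real poly" where
  "legendre_poly r = (pderiv ^^ r) ([:-1, 0, 1:] ^ r)"

text \<open>\<open>\<tau> 1, \<dots>, \<tau> r\<close> enumerates the Gauss points, in any order.\<close>

definition gauss_points :: "nat \<Rightarrow> (nat \<Rightarrow> real) \<Rightarrow> bool" where
  "gauss_points r \<tau> \<longleftrightarrow> bij_betw \<tau> {1..r} {t\<in>{-1..1}. poly (legendre_poly r) t = 0}"

definition lagrange :: "nat \<Rightarrow> (nat \<Rightarrow> real) \<Rightarrow> nat \<Rightarrow> real \<Rightarrow> real" where
  "lagrange r \<tau> i t = (\<Prod>j\<in>{1..r} - {i}. (t - \<tau> j) / (\<tau> i - \<tau> j))"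

definition cell_map :: "(nat \<Rightarrow> real) \<Rightarrow> nat \<Rightarrow> real \<Rightarrow> real" where
  "cell_map p j t = (1 - t) / 2 * p (j - 1) + (1 + t) / 2 * p j"

definition phi :: "nat \<Rightarrow> (nat \<Rightarrow> real) \<Rightarrow> (nat \<Rightarrow> real) \<Rightarrow> nat \<Rightarrow> nat \<Rightarrow> real \<Rightarrow> real" where
  "phi r \<tau> p i j x =
     (if x \<in> {p (j - 1)..p j} then lagrange r \<tau> i (the_inv_into {-1..1} (cell_map p j) x) else 0)"

text \<open>The index \<open>m = (j - 1) * r + i\<close> with \<open>1 \<le> i \<le> r\<close> decodes to
  \<open>j = (m - 1) div r + 1\<close> and \<open>i = (m - 1) mod r + 1\<close>.\<close>

definition node :: "nat \<Rightarrow> (nat \<Rightarrow> real) \<Rightarrow> (nat \<Rightarrow> real) \<Rightarrow> nat \<Rightarrow> real" where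
  "node r \<tau> p m = cell_map p ((m - 1) div r + 1) (\<tau> ((m - 1) mod r + 1))"

definition psi :: "nat \<Rightarrow> (nat \<Rightarrow> real) \<Rightarrow> (nat \<Rightarrow> real) \<Rightarrow> nat \<Rightarrow> real \<Rightarrow> real" where
  "psi r \<tau> p m = phi r \<tau> p ((m - 1) mod r + 1) ((m - 1) div r + 1)"

definition degenerate_kernel ::
    "nat \<Rightarrow> (nat \<Rightarrow> real) \<Rightarrow> nat \<Rightarrow> (nat \<Rightarrow> real) \<Rightarrow> (real \<Rightarrow> real \<Rightarrow> complex)
      \<Rightarrow> real \<Rightarrow> real \<Rightarrow> complex" where
  "degenerate_kernel r \<tau> n p k x u =
     (\<Sum>i=1..n * r. \<Sum>j=1..n * r.
        k (node r \<tau> p i) (node r \<tau> p j) * of_real (psi r \<tau> p i x) * of_real (psi r \<tau> p j u))"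

text \<open>Half-open cells settle the value at the partition points, which is immaterial.\<close>

definition step_fun :: "nat \<Rightarrow> (nat \<Rightarrow> real) \<Rightarrow> real \<Rightarrow> real" where
  "step_fun n p x = (\<Sum>i=1..n. ((p (i - 1) + p i) / 2)\<^sup>2 * indicator {p (i - 1)<..p i} x)"

definition A_approx ::
    "real \<Rightarrow> real \<Rightarrow> real \<Rightarrow> nat \<Rightarrow> (nat \<Rightarrow> real) \<Rightarrow> nat \<Rightarrow> (nat \<Rightarrow> real)
      \<Rightarrow> (real \<Rightarrow> real \<Rightarrow> complex) \<Rightarrow> linf \<Rightarrow> linf" where
  "A_approx a b \<alpha> r \<tau> n p k f =
     integral_op a b \<alpha> (degenerate_kernel r \<tau> n p k) f - mult_op a b (step_fun n p) f"

definition near_spectrum ::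
    "'a::complex_normed_space set \<Rightarrow> ('a \<Rightarrow> 'a) \<Rightarrow> complex \<Rightarrow> real \<Rightarrow> complex set" where
  "near_spectrum Y T z \<epsilon> = {\<mu>\<in>spectrum Y T. cmod (\<mu> - z) < \<epsilon>}"

end

theory Submission
  imports Defs "HOL-Complex_Analysis.Great_Picard"
begin

text \<open>
  The degenerate kernel approximation converges in operator norm at rate \<open>O(h)\<close>, so only norm
  perturbation theory is needed, and it can be done without contour integrals. If the
  approximation had no spectrum near the isolated point \<open>\<lambda>\<close>, its resolvent would satisfy a maximum
  principle on a small disc; the uniform bound on the circle would carry over to the centre and
  make \<open>\<A> - \<lambda>\<close> invertible. For the rate it suffices that the resolvent of \<open>\<A>\<close> has a simple pole at
  a simple eigenvalue. This uses compactness of the integral operator: every \<open>-x\<^sup>2\<close> lies in the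
  spectrum, so \<open>\<lambda> + x\<^sup>2\<close> stays away from zero, and \<open>\<A> - \<lambda>\<close> is an invertible multiplication plus a
  compact operator, in particular has closed range.
\<close>

section \<open>Perturbation theory in a Banach space\<close>

text \<open>All estimates run through one number: a lower bound c for an operator that is also onto,
  i.e. the reciprocal of a resolvent bound. A perturbation of size \<delta> lowers c by at most
  \<delta>. The rate is then a comparison of two numbers: at a simple pole, A - \<mu> has a constant
  c |\<mu> - \<lambda>|, while the approximation differs from A by at most C h, so spectrum of the
  approximation is possible only where c |\<mu> - \<lambda>| \<le> C h. The order one comes from
  replacing x^2 by one value per cell, and a Lipschitz estimate for the kernel matches it. The
  maximum principle expresses that the norm of an analytic vector function is subharmonic. Here it
  is a discrete mean value inequality over four points, made strict by a quadratic penalty. The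
  obstacle behind the simple pole: a simple eigenvalue excludes Jordan chains, but a slower growth
  than c |\<mu>| could still come from a sequence of approximate Jordan chains. Closed range turns
  such a sequence into a true chain.\<close>

lemma scaleC_zero_left [simp]: "0 *\<^sub>C (f::'a::complex_normed_space) = 0"
  using scaleC_add_left[of 0 0 f] by simp

lemma scaleC_zero_right [simp]: "c *\<^sub>C (0::'a::complex_normed_space) = 0"
  using scaleC_add_right[of c 0 "0::'a"] by simp

lemma scaleC_minus_right: "c *\<^sub>C (- f) = - (c *\<^sub>C (f::'a::complex_normed_space))"
  using scaleC_add_right[of c f "- f"] by (simp add: add_eq_0_iff minus_equation_iff)

lemma scaleC_minus_left: "(- c) *\<^sub>C f = - (c *\<^sub>C (f::'a::complex_normed_space))"
  using scaleC_add_left[of c "- c" f] by (simp add: add_eq_0_iff minus_equation_iff)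

lemma scaleC_diff_right: "c *\<^sub>C (f - g) = c *\<^sub>C f - c *\<^sub>C (g::'a::complex_normed_space)"
  using scaleC_add_right[of c f "- g"] by (simp add: scaleC_minus_right)

lemma scaleC_diff_left: "(c - d) *\<^sub>C f = c *\<^sub>C f - d *\<^sub>C (f::'a::complex_normed_space)"
  using scaleC_add_left[of c "- d" f] by (simp add: scaleC_minus_left)

declare scaleC_one [simp]

lemma scaleC_minus_one: "(-1) *\<^sub>C (f::'a::complex_normed_space) = - f"
  by (simp add: scaleC_minus_left)

lemmas scaleC_algebra =
  scaleC_add_right scaleC_add_left scaleC_diff_right scaleC_diff_left scaleC_scaleC
  scaleC_minus_right scaleC_minus_left

lemma tendsto_scaleC:
  fixes f :: "'b \<Rightarrow> 'a::complex_normed_space"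
  assumes "(c \<longlongrightarrow> c0) F" "(f \<longlongrightarrow> f0) F"
  shows "((\<lambda>n. c n *\<^sub>C f n) \<longlongrightarrow> c0 *\<^sub>C f0) F"
proof -
  have "((\<lambda>n. norm (c n) * norm (f n - f0) + norm (c n - c0) * norm f0) \<longlongrightarrow>
      norm c0 * norm (f0 - f0) + norm (c0 - c0) * norm f0) F"
    by (intro tendsto_intros assms)
  then have lim: "((\<lambda>n. norm (c n) * norm (f n - f0) + norm (c n - c0) * norm f0) \<longlongrightarrow> 0) F"
    by simp
  have "norm (c n *\<^sub>C f n - c0 *\<^sub>C f0)
      \<le> norm (c n) * norm (f n - f0) + norm (c n - c0) * norm f0" for n
  proof -
    have "c n *\<^sub>C f n - c0 *\<^sub>C f0 = c n *\<^sub>C (f n - f0) + (c n - c0) *\<^sub>C f0"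
      by (simp add: scaleC_algebra)
    then show ?thesis
      by (metis norm_scaleC norm_triangle_ineq)
  qed
  then have "((\<lambda>n. c n *\<^sub>C f n - c0 *\<^sub>C f0) \<longlongrightarrow> 0) F"
    by (intro Lim_null_comparison[OF _ lim] always_eventually allI) simp
  then show ?thesis
    by (simp add: LIM_zero_iff)
qed

text \<open>The ambient type need not be complete. Completeness is asked of \<open>Y\<close> because
  the fixed point iteration that inverts a perturbed operator runs inside \<open>Y\<close>.\<close>

locale banach_subspace =
  fixes Y :: "'a::complex_normed_space set"
  assumes zero_mem: "0 \<in> Y"
    and add_mem: "f \<in> Y \<Longrightarrow> g \<in> Y \<Longrightarrow> f + g \<in> Y"
    and scaleC_mem: "f \<in> Y \<Longrightarrow> c *\<^sub>C f \<in> Y"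
    and complete_Y: "complete Y"
begin

lemma diff_mem: "f \<in> Y \<Longrightarrow> g \<in> Y \<Longrightarrow> f - g \<in> Y"
  using add_mem[of f "(-1) *\<^sub>C g"] scaleC_mem[of g "-1"] by (simp add: scaleC_minus_one)

section \<open>Bounded operators on a complete subspace\<close>

lemma BL_D:
  assumes "T \<in> BL Y"
  shows BL_mem: "f \<in> Y \<Longrightarrow> T f \<in> Y"
    and BL_add: "f \<in> Y \<Longrightarrow> g \<in> Y \<Longrightarrow> T (f + g) = T f + T g"
    and BL_scaleC: "f \<in> Y \<Longrightarrow> T (c *\<^sub>C f) = c *\<^sub>C T f"
    and BL_diff: "f \<in> Y \<Longrightarrow> g \<in> Y \<Longrightarrow> T (f - g) = T f - T g"
    and BL_zero: "T 0 = 0"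
proof -
  show "f \<in> Y \<Longrightarrow> T f \<in> Y" for f
    using assms by (auto simp: BL_def)
  show add: "f \<in> Y \<Longrightarrow> g \<in> Y \<Longrightarrow> T (f + g) = T f + T g" for f g
    using assms by (auto simp: BL_def)
  show scale: "f \<in> Y \<Longrightarrow> T (c *\<^sub>C f) = c *\<^sub>C T f" for f c
    using assms by (auto simp: BL_def)
  show "f \<in> Y \<Longrightarrow> g \<in> Y \<Longrightarrow> T (f - g) = T f - T g" for f g
    using add[of f "(-1) *\<^sub>C g"] scale[of g "-1"] scaleC_mem[of g "-1"]
    by (simp add: scaleC_minus_one)
  show "T 0 = 0"
    using scale[OF zero_mem, of 0] by simp
qed

lemma BL_bounded:
  assumes "T \<in> BL Y"
  shows "\<exists>C>0. \<forall>f\<in>Y. norm (T f) \<le> C * norm f"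
proof -
  obtain C where C: "\<forall>f\<in>Y. norm (T f) \<le> C * norm f"
    using assms by (auto simp: BL_def)
  have "norm (T f) \<le> max C 1 * norm f" if "f \<in> Y" for f
    using C that by (meson dual_order.trans max.cobounded1 mult_right_mono norm_ge_zero)
  then show ?thesis
    by (intro exI[of _ "max C 1"]) auto
qed

lemma BL_tendsto:
  assumes "T \<in> BL Y" "\<And>n. f n \<in> Y" "l \<in> Y" "f \<longlonglongrightarrow> l"
  shows "(\<lambda>n. T (f n)) \<longlonglongrightarrow> T l"
proof -
  obtain C where C: "C > 0" "\<And>f. f \<in> Y \<Longrightarrow> norm (T f) \<le> C * norm f"
    using BL_bounded[OF assms(1)] by blast
  have "(\<lambda>n. C * norm (f n - l)) \<longlonglongrightarrow> C * norm (l - l)"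
    by (intro tendsto_intros assms)
  then have "(\<lambda>n. C * norm (f n - l)) \<longlonglongrightarrow> 0"
    by simp
  then have "(\<lambda>n. T (f n) - T l) \<longlonglongrightarrow> 0"
    by (rule Lim_null_comparison[rotated])
      (use C assms in \<open>simp add: BL_diff[OF assms(1), symmetric] diff_mem\<close>)
  then show ?thesis
    by (simp add: LIM_zero_iff)
qed

lemma BL_shift:
  assumes "T \<in> BL Y"
  shows "(\<lambda>f. T f - z *\<^sub>C f) \<in> BL Y"
proof -
  obtain C where C: "\<And>f. f \<in> Y \<Longrightarrow> norm (T f) \<le> C * norm f"
    using BL_bounded[OF assms] by blast
  have "norm (T f - z *\<^sub>C f) \<le> (C + cmod z) * norm f" if "f \<in> Y" for f
    using C[OF that] norm_triangle_ineq4[of "T f" "z *\<^sub>C f"]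
    by (simp add: norm_scaleC distrib_right)
  then show ?thesis
    unfolding BL_def using BL_D[OF assms] diff_mem scaleC_mem
    by (intro CollectI conjI ballI allI exI[of _ "C + cmod z"])
      (simp_all add: scaleC_algebra mult.commute[of z])
qed

lemma BL_minus:
  assumes S: "S \<in> BL Y" and T: "T \<in> BL Y"
  shows "(\<lambda>f. S f - T f) \<in> BL Y"
proof -
  obtain C D where CD: "\<And>f. f \<in> Y \<Longrightarrow> norm (S f) \<le> C * norm f" "\<And>f. f \<in> Y \<Longrightarrow> norm (T f) \<le> D * norm f"
    using BL_bounded[OF S] BL_bounded[OF T] by blast
  have "norm (S f - T f) \<le> (C + D) * norm f" if "f \<in> Y" for f
    using CD[OF that] norm_triangle_ineq4[of "S f" "T f"] by (simp add: distrib_right)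
  then show ?thesis
    unfolding BL_def using BL_D[OF S] BL_D[OF T] diff_mem
    by (intro CollectI conjI ballI allI exI[of _ "C + D"]) (simp_all add: scaleC_algebra)
qed

text \<open>For T in \<open>BL Y\<close> and c > 0 this says that T has an inverse on
  \<open>Y\<close> of norm at most 1 / c. Keeping the reciprocal of the resolvent bound makes a
  perturbation a mere subtraction from c.\<close>

definition boundedly_invertible :: "('a \<Rightarrow> 'a) \<Rightarrow> real \<Rightarrow> bool" where
  "boundedly_invertible T c \<longleftrightarrow> (\<forall>f\<in>Y. c * norm f \<le> norm (T f)) \<and> Y \<subseteq> T ` Y"

text \<open>The lower bound does double duty: it gives injectivity, and it bounds the inverse by 1 /
  c.\<close>

lemma resolvent_setI:
  assumes T: "T \<in> BL Y" and inv: "boundedly_invertible (\<lambda>f. T f - z *\<^sub>C f) c" and "c > 0"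
  shows "z \<in> resolvent_set Y T"
proof -
  let ?D = "\<lambda>f. T f - z *\<^sub>C f"
  have D: "?D \<in> BL Y" by (rule BL_shift[OF T])
  have lower: "c * norm f \<le> norm (?D f)" if "f \<in> Y" for f
    using inv that by (auto simp: boundedly_invertible_def)
  have inj: "inj_on ?D Y"
  proof (rule inj_onI)
    fix f g assume fg: "f \<in> Y" "g \<in> Y" "?D f = ?D g"
    then have "?D (f - g) = 0" using BL_diff[OF D, of f g] by simp
    then have "c * norm (f - g) \<le> 0"
      using lower[OF diff_mem[OF fg(1,2)]] by simp
    then show "f = g" using \<open>c > 0\<close> by (simp add: mult_le_0_iff)
  qed
  define S where "S = inv_into Y ?D"
  have SY: "S g \<in> Y" and DS: "?D (S g) = g" if "g \<in> Y" for g
    using inv that unfolding boundedly_invertible_def S_def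
    by (meson inv_into_into subsetD, meson f_inv_into_f subsetD)
  have SD: "S (?D f) = f" if "f \<in> Y" for f
    unfolding S_def using inv_into_f_f[OF inj that] .
  have "S \<in> BL Y"
    unfolding BL_def
  proof (intro CollectI conjI ballI allI)
    show "S f \<in> Y" if "f \<in> Y" for f by (rule SY[OF that])
    show "S (f + g) = S f + S g" if "f \<in> Y" "g \<in> Y" for f g
      using SD[OF add_mem[OF SY[OF that(1)] SY[OF that(2)]]]
        BL_add[OF D SY[OF that(1)] SY[OF that(2)]] DS that by simp
    show "S (c *\<^sub>C f) = c *\<^sub>C S f" if "f \<in> Y" for f c
      using SD[OF scaleC_mem[OF SY[OF that], of c]] BL_scaleC[OF D SY[OF that]] DS that by simp
    show "\<exists>C. \<forall>f\<in>Y. norm (S f) \<le> C * norm f"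
    proof (intro exI[of _ "1 / c"] ballI)
      fix f assume "f \<in> Y"
      then show "norm (S f) \<le> 1 / c * norm f"
        using lower[OF SY] DS \<open>c > 0\<close> by (simp add: field_simps)
    qed
  qed
  then show ?thesis
    unfolding resolvent_set_def using SD DS by blast
qed

lemma resolvent_set_boundedly_invertible:
  assumes "T \<in> BL Y" "z \<in> resolvent_set Y T"
  shows "\<exists>c>0. boundedly_invertible (\<lambda>f. T f - z *\<^sub>C f) c"
proof -
  obtain S where S: "S \<in> BL Y" "\<And>f. f \<in> Y \<Longrightarrow> S (T f - z *\<^sub>C f) = f"
      "\<And>f. f \<in> Y \<Longrightarrow> T (S f) - z *\<^sub>C S f = f"
    using assms(2) unfolding resolvent_set_def by blast
  obtain C where C: "C > 0" "\<And>f. f \<in> Y \<Longrightarrow> norm (S f) \<le> C * norm f"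
    using BL_bounded[OF S(1)] by blast
  show ?thesis
  proof (intro exI[of _ "1 / C"] conjI)
    show "boundedly_invertible (\<lambda>f. T f - z *\<^sub>C f) (1 / C)"
      unfolding boundedly_invertible_def
    proof (intro conjI ballI subsetI)
      fix f assume f: "f \<in> Y"
      show "1 / C * norm f \<le> norm (T f - z *\<^sub>C f)"
        using C(2)[OF BL_mem[OF BL_shift[OF assms(1)] f], of z] S(2)[OF f] C(1)
        by (simp add: field_simps)
      show "f \<in> (\<lambda>f. T f - z *\<^sub>C f) ` Y"
        by (rule image_eqI[of _ _ "S f"]) (simp_all add: S(3)[OF f] BL_mem[OF S(1) f])
    qed
  qed (use C in auto)
qed

text \<open>Solving \<open>T' f = g\<close> is the fixed point problem \<open>f = T\<^sup>-\<^sup>1 (g - (T' - T) f)\<close>.\<close>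

lemma boundedly_invertible_perturb:
  assumes T: "T \<in> BL Y" and T': "T' \<in> BL Y" and inv: "boundedly_invertible T c"
    and close: "\<And>f. f \<in> Y \<Longrightarrow> norm (T' f - T f) \<le> \<delta> * norm f" and \<delta>: "0 \<le> \<delta>" "\<delta> < c"
  shows "boundedly_invertible T' (c - \<delta>)"
  unfolding boundedly_invertible_def
proof (intro conjI ballI subsetI)
  have lower: "c * norm f \<le> norm (T f)" if "f \<in> Y" for f
    using inv that by (auto simp: boundedly_invertible_def)
  show "(c - \<delta>) * norm f \<le> norm (T' f)" if "f \<in> Y" for f
  proof -
    have "norm (T f) \<le> norm (T' f) + norm (T' f - T f)"
      by (metis add.commute diff_add_cancel norm_minus_commute norm_triangle_ineq)
    then show ?thesis
      using lower[OF that] close[OF that] by (simp add: algebra_simps)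
  qed
  fix g assume g: "g \<in> Y"
  define S where "S = inv_into Y T"
  have SY: "S h \<in> Y" and TS: "T (S h) = h" if "h \<in> Y" for h
    using inv that unfolding boundedly_invertible_def S_def
    by (meson inv_into_into subsetD, meson f_inv_into_f subsetD)
  define G where "G f = S (g - (T' f - T f))" for f
  have mem: "g - (T' f - T f) \<in> Y" if "f \<in> Y" for f
    by (intro diff_mem g BL_mem[OF T] BL_mem[OF T'] that)
  have GY: "G f \<in> Y" if "f \<in> Y" for f
    unfolding G_def by (rule SY[OF mem[OF that]])
  have TG: "T (G f) = g - (T' f - T f)" if "f \<in> Y" for f
    unfolding G_def by (rule TS[OF mem[OF that]])
  \<comment> \<open>The right-hand sides belonging to f1 and f2 differ, up to sign, by (T' - T)(f1 -
    f2), and inverting T costs the factor 1 / c. Since \<delta> < c, this is a contraction.\<close>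
  have contr: "dist (G f1) (G f2) \<le> \<delta> / c * dist f1 f2" if f: "f1 \<in> Y" "f2 \<in> Y" for f1 f2
  proof -
    have "T (G f1 - G f2) = - (T' (f1 - f2) - T (f1 - f2))"
      using f by (simp add: BL_diff[OF T] BL_diff[OF T'] GY TG)
    then have "c * norm (G f1 - G f2) \<le> \<delta> * norm (f1 - f2)"
      using lower[OF diff_mem[OF GY[OF f(1)] GY[OF f(2)]]] close[OF diff_mem[OF f]]
      by (metis norm_minus_cancel order_trans)
    then show ?thesis
      using \<delta> by (simp add: dist_norm field_simps)
  qed
  have "\<exists>!f. f \<in> Y \<and> G f = f"
    by (rule Banach_fix[OF complete_Y, of "\<delta> / c"]) (use \<delta> contr GY zero_mem in auto)
  then obtain f where f: "f \<in> Y" "G f = f" by blast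
  then have "T f = g - (T' f - T f)" using TG by metis
  then have "T' f = g" by simp
  then show "g \<in> T' ` Y" using f by blast
qed

text \<open>A change of operator and a change of spectral parameter form one perturbation whose
  sizes add. With T' = T it moves along the resolvent set, with w = z it passes between an operator
  and its approximation.\<close>

lemma shift_perturb:
  assumes T: "T \<in> BL Y" and T': "T' \<in> BL Y" and inv: "boundedly_invertible (\<lambda>f. T f - z *\<^sub>C f) c"
    and close: "\<And>f. f \<in> Y \<Longrightarrow> norm (T' f - T f) \<le> \<delta> * norm f" and "0 \<le> \<delta>" "\<delta> + cmod (w - z) < c"
  shows "boundedly_invertible (\<lambda>f. T' f - w *\<^sub>C f) (c - (\<delta> + cmod (w - z)))"
proof (rule boundedly_invertible_perturb[OF BL_shift[OF T] BL_shift[OF T'] inv])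
  fix f assume f: "f \<in> Y"
  have "T' f - w *\<^sub>C f - (T f - z *\<^sub>C f) = (T' f - T f) - (w - z) *\<^sub>C f"
    by (simp add: scaleC_algebra)
  then have "norm (T' f - w *\<^sub>C f - (T f - z *\<^sub>C f)) \<le> norm (T' f - T f) + norm ((w - z) *\<^sub>C f)"
    by (metis norm_triangle_ineq4)
  then show "norm (T' f - w *\<^sub>C f - (T f - z *\<^sub>C f)) \<le> (\<delta> + cmod (w - z)) * norm f"
    using close[OF f] by (simp add: norm_scaleC distrib_right)
qed (use assms in auto)

lemma boundedly_invertible_mono:
  "boundedly_invertible T c \<Longrightarrow> d \<le> c \<Longrightarrow> boundedly_invertible T d"
  unfolding boundedly_invertible_def by (meson mult_right_mono norm_ge_zero order_trans)

text \<open>Local bounds persist on small balls by \<open>shift_perturb\<close>, and finitely many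
  balls cover the compact set.\<close>

lemma uniform_resolvent_bound:
  assumes T: "T \<in> BL Y" and "compact C" "C \<subseteq> resolvent_set Y T"
  obtains c where "c > 0" "\<And>z. z \<in> C \<Longrightarrow> boundedly_invertible (\<lambda>f. T f - z *\<^sub>C f) c"
proof -
  have "\<forall>z\<in>C. \<exists>c>0. boundedly_invertible (\<lambda>f. T f - z *\<^sub>C f) c"
    using resolvent_set_boundedly_invertible[OF T] assms(3) by blast
  then obtain c where c: "\<And>z. z \<in> C \<Longrightarrow> c z > 0"
      "\<And>z. z \<in> C \<Longrightarrow> boundedly_invertible (\<lambda>f. T f - z *\<^sub>C f) (c z)"
    by metis
  \<comment> \<open>Radius c z / 2 leaves at least half of the constant c z everywhere in the
    ball.\<close>
  have "C \<subseteq> (\<Union>z\<in>C. ball z (c z / 2))" using c by fastforce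
  then obtain D where D: "D \<subseteq> C" "finite D" "C \<subseteq> (\<Union>z\<in>D. ball z (c z / 2))"
    using compactE_image[OF \<open>compact C\<close>, of C "\<lambda>z. ball z (c z / 2)"] by auto
  \<comment> \<open>The inserted 1 keeps the minimum meaningful when the finite subcover is
    empty.\<close>
  define m where "m = Min (insert 1 ((\<lambda>z. c z / 2) ` D))"
  have "m > 0"
    unfolding m_def using D c(1) subsetD[OF D(1)] by auto
  moreover have "m \<le> c z / 2" if "z \<in> D" for z
    unfolding m_def using D(2) that by (intro Min_le) auto
  ultimately have m: "m > 0" "\<And>z. z \<in> D \<Longrightarrow> m \<le> c z / 2" by blast+
  show thesis
  proof (rule that[OF m(1)])
    fix w assume "w \<in> C"
    then obtain z where z: "z \<in> D" "w \<in> ball z (c z / 2)" using D(3) by auto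
    then have "cmod (w - z) < c z / 2" by (simp add: dist_norm norm_minus_commute)
    moreover have "z \<in> C" using z D by auto
    ultimately have "boundedly_invertible (\<lambda>f. T f - w *\<^sub>C f) (c z - (0 + cmod (w - z)))"
      by (intro shift_perturb[OF T T]) (use c[of z] in auto)
    then show "boundedly_invertible (\<lambda>f. T f - w *\<^sub>C f) m"
      by (rule boundedly_invertible_mono)
        (use m(2)[OF z(1)] \<open>cmod (w - z) < c z / 2\<close> in simp)
  qed
qed

section \<open>Maximum principle for the resolvent\<close>

text \<open>Averaging the resolvent over four equidistant points cancels the first and second order
  terms of its expansion at the centre.\<close>

lemma resolvent_four_point_bound:
  assumes T: "T \<in> BL Y" and inv: "boundedly_invertible T c" and "c > 0" and "\<rho> > 0"
    and f: "f \<in> Y" and g: "g \<in> Y" "T g = f"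
    and G: "\<And>w. w \<in> {1, -1, \<i>, -\<i>} \<Longrightarrow> G w \<in> Y"
      "\<And>w. w \<in> {1, -1, \<i>, -\<i>} \<Longrightarrow> T (G w) - (of_real \<rho> * w) *\<^sub>C G w = f"
  shows "4 * norm g \<le> (1 + (\<rho> / c) ^ 3) *
    (norm (G 1) + norm (G (-1)) + norm (G \<i>) + norm (G (-\<i>)))"
proof -
  let ?W = "{1, -1, \<i>, -\<i>} :: complex set"
  have lower: "c * norm f \<le> norm (T f)" if "f \<in> Y" for f
    using inv that by (auto simp: boundedly_invertible_def)
  have surj: "\<exists>h'\<in>Y. T h' = h" if "h \<in> Y" for h
    using inv that unfolding boundedly_invertible_def by blast
  obtain g1 where g1: "g1 \<in> Y" "T g1 = g" using surj g by blast
  obtain g2 where g2: "g2 \<in> Y" "T g2 = g1" using surj g1 by blast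
  \<comment> \<open>With z = \<rho> * w, the sum g + z g1 + z^2 g2 is the second-order Taylor
    polynomial of (T - z)^-1 f at z = 0, and e w is the remainder.\<close>
  define e where "e w = G w - g - (of_real \<rho> * w) *\<^sub>C g1 - (of_real \<rho> * w)\<^sup>2 *\<^sub>C g2" for w
  have unit: "cmod w = 1" if "w \<in> ?W" for w
    using that by auto
  have step: "c * norm h \<le> \<rho> * norm h'" if "h \<in> Y" "T h = (of_real \<rho> * w) *\<^sub>C h'" "w \<in> ?W"
    for h h' w
    using lower[OF that(1)] that(2) unit[OF that(3)] \<open>\<rho> > 0\<close> by (simp add: norm_scaleC norm_mult)
  have e: "norm (e w) \<le> (\<rho> / c) ^ 3 * norm (G w)" if w: "w \<in> ?W" for w
  proof -
    let ?z = "of_real \<rho> * w"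
    let ?a = "G w - g" and ?b = "G w - g - ?z *\<^sub>C g1"
    note mem = G(1)[OF w] g g1 g2 diff_mem scaleC_mem
    note lin = BL_diff[OF T] BL_scaleC[OF T]
    \<comment> \<open>Subtracting one more Taylor term amounts to applying z T^-1 once more:
      \<open>?a\<close> = z T^-1 (G w), \<open>?b\<close> = z T^-1 \<open>?a\<close> and e w = z
      T^-1 \<open>?b\<close>. Three rounds produce the cube.\<close>
    have a: "?a \<in> Y" "T ?a = ?z *\<^sub>C G w"
      using G(2)[OF w] by (simp_all add: lin mem algebra_simps)
    have b: "?b \<in> Y" "T ?b = ?z *\<^sub>C ?a"
      using a by (simp_all add: lin mem scaleC_algebra)
    have "e w \<in> Y" "T (e w) = ?z *\<^sub>C ?b"
      using b unfolding e_def by (simp_all add: lin mem scaleC_algebra power2_eq_square)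
    with a b have "c * norm ?a \<le> \<rho> * norm (G w)" "c * norm ?b \<le> \<rho> * norm ?a"
        "c * norm (e w) \<le> \<rho> * norm ?b"
      using step[OF _ _ w] by blast+
    then have "norm (e w) \<le> \<rho> / c * norm ?b" "norm ?b \<le> \<rho> / c * norm ?a"
        "norm ?a \<le> \<rho> / c * norm (G w)"
      using \<open>c > 0\<close> by (simp_all add: field_simps)
    moreover have "\<rho> / c \<ge> 0" using \<open>\<rho> > 0\<close> \<open>c > 0\<close> by simp
    ultimately have "norm (e w) \<le> \<rho> / c * (\<rho> / c * (\<rho> / c * norm (G w)))"
      by (meson mult_left_mono order_trans)
    then show ?thesis by (simp add: power3_eq_cube mult.assoc)
  qed
  \<comment> \<open>The four points sum to zero and so do their squares, which removes g1 and g2.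
    The points 1 and -1 alone would leave the g2 term, of the same order \<rho>^2 as the gain that
    the maximum principle exploits.\<close>
  have "4 *\<^sub>C g = G 1 + G (-1) + G \<i> + G (-\<i>) - (e 1 + e (-1) + e \<i> + e (-\<i>))"
  proof -
    have "4 *\<^sub>C g = g + g + g + g"
      using scaleC_add_left[of 2 2 g] scaleC_add_left[of 1 1 g] by simp
    then show ?thesis
      unfolding e_def by (simp add: scaleC_algebra power_mult_distrib algebra_simps)
  qed
  then have "norm (4 *\<^sub>C g) \<le> norm (G 1 + G (-1) + G \<i> + G (-\<i>)) + norm (e 1 + e (-1) + e \<i> + e (-\<i>))"
    by (metis norm_triangle_ineq4)
  also have "\<dots> \<le> (norm (G 1) + norm (G (-1)) + norm (G \<i>) + norm (G (-\<i>)))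
      + (norm (e 1) + norm (e (-1)) + norm (e \<i>) + norm (e (-\<i>)))"
    by (intro add_mono norm_triangle_le order_refl)
  also have "norm (e 1) + norm (e (-1)) + norm (e \<i>) + norm (e (-\<i>))
      \<le> (\<rho> / c) ^ 3 * norm (G 1) + (\<rho> / c) ^ 3 * norm (G (-1))
        + (\<rho> / c) ^ 3 * norm (G \<i>) + (\<rho> / c) ^ 3 * norm (G (-\<i>))"
    by (intro add_mono e) auto
  finally show ?thesis
    by (simp add: norm_scaleC algebra_simps)
qed

text \<open>The term \<open>\<eta> |z - z0|\<^sup>2\<close> gains \<open>4 \<eta> \<rho>\<^sup>2\<close> in the
  four-point sum, which beats the error \<open>O(\<rho>\<^sup>3)\<close>, so no maximum lies in the interior.\<close>

lemma resolvent_maximum_principle: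
  assumes T: "T \<in> BL Y" and R: "R > 0" and ball: "cball z0 R \<subseteq> resolvent_set Y T"
    and circle: "\<And>z. cmod (z - z0) = R \<Longrightarrow> boundedly_invertible (\<lambda>f. T f - z *\<^sub>C f) c"
    and "c > 0"
  shows "boundedly_invertible (\<lambda>f. T f - z0 *\<^sub>C f) c"
proof -
  have "z0 \<in> resolvent_set Y T" using ball R by auto
  then obtain c0 where c0: "c0 > 0" "boundedly_invertible (\<lambda>f. T f - z0 *\<^sub>C f) c0"
    using resolvent_set_boundedly_invertible[OF T] by blast
  have "c * norm g \<le> norm (T g - z0 *\<^sub>C g)" if g: "g \<in> Y" for g
  proof -
    define f where "f = T g - z0 *\<^sub>C g"
    have f: "f \<in> Y" unfolding f_def by (intro diff_mem scaleC_mem g BL_mem[OF T])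
    have "\<exists>h. h \<in> Y \<and> T h - z *\<^sub>C h = f" if "z \<in> cball z0 R" for z
      using resolvent_set_boundedly_invertible[OF T, of z] ball that f
      unfolding boundedly_invertible_def by (metis (no_types, lifting) imageE subsetD)
    \<comment> \<open>For the fixed vector f, G z is the resolvent at z applied to f; the maximum
      argument concerns the scalar function norm (G z).\<close>
    then obtain G where GY: "\<And>z. z \<in> cball z0 R \<Longrightarrow> G z \<in> Y"
        and TG: "\<And>z. z \<in> cball z0 R \<Longrightarrow> T (G z) - z *\<^sub>C G z = f"
      by metis
    have cont: "continuous_on (cball z0 R) G"
      unfolding continuous_on_def
    proof
      fix z assume z: "z \<in> cball z0 R"
      then obtain d where d: "d > 0" "boundedly_invertible (\<lambda>f. T f - z *\<^sub>C f) d"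
        using resolvent_set_boundedly_invertible[OF T] ball by blast
      \<comment> \<open>Resolvent identity: (T - z)(G w - G z) = (w - z) G w.\<close>
      have bound: "norm (G w - G z) \<le> cmod (w - z) * norm (G w) / d" if w: "w \<in> cball z0 R" for w
      proof -
        have "T (G w - G z) - z *\<^sub>C (G w - G z) = (w - z) *\<^sub>C G w"
          using TG[OF z] TG[OF w]
          by (simp add: BL_diff[OF T GY[OF w] GY[OF z]] scaleC_algebra algebra_simps)
        then have "d * norm (G w - G z) \<le> norm ((w - z) *\<^sub>C G w)"
          using d(2) diff_mem[OF GY[OF w] GY[OF z]]
          unfolding boundedly_invertible_def by metis
        then show ?thesis using d(1) by (simp add: norm_scaleC field_simps)
      qed
      \<comment> \<open>\<open>bound\<close> still contains G w on its right side. Within d / 2 of z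
        its contribution is at most half of norm (G w) and can be absorbed.\<close>
      have bdd: "norm (G w) \<le> 2 * norm (G z)" if "w \<in> cball z0 R" "cmod (w - z) < d / 2" for w
      proof -
        have "norm (G w - G z) \<le> (d / 2) * norm (G w) / d"
          using bound[OF that(1)] that(2) d(1)
          by (meson divide_right_mono less_eq_real_def mult_right_mono norm_ge_zero order_trans)
        then have "norm (G w - G z) \<le> norm (G w) / 2" using d(1) by simp
        then show ?thesis using norm_triangle_ineq2[of "G w" "G z"] by simp
      qed
      have "((\<lambda>w. cmod (w - z) * (2 * norm (G z)) / d) \<longlongrightarrow> cmod (z - z) * (2 * norm (G z)) / d)
          (at z within cball z0 R)"
        by (intro tendsto_intros) (use d in auto)
      then have "((\<lambda>w. cmod (w - z) * (2 * norm (G z)) / d) \<longlongrightarrow> 0) (at z within cball z0 R)"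
        by simp
      moreover have "\<forall>\<^sub>F w in at z within cball z0 R.
          norm (G w - G z) \<le> cmod (w - z) * (2 * norm (G z)) / d"
        unfolding eventually_at
      proof (intro exI[of _ "d / 2"] conjI ballI impI)
        fix w assume w: "w \<in> cball z0 R" "w \<noteq> z \<and> dist w z < d / 2"
        then show "norm (G w - G z) \<le> cmod (w - z) * (2 * norm (G z)) / d"
          using bound[OF w(1)] bdd[OF w(1)] d(1)
          by (smt (verit) dist_norm divide_right_mono mult_left_mono norm_ge_zero)
      qed (use d in auto)
      ultimately have "((\<lambda>w. G w - G z) \<longlongrightarrow> 0) (at z within cball z0 R)"
        by (rule Lim_null_comparison[rotated])
      then show "(G \<longlongrightarrow> G z) (at z within cball z0 R)"
        by (simp add: LIM_zero_iff)
    qed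
    \<comment> \<open>\<eta> is free: the penalty adds exactly \<eta> R^2 on the circle and nothing
      at z0, and it is sent to zero at the end.\<close>
    have le: "norm (G z0) \<le> norm f / c + \<eta> * R\<^sup>2" if \<eta>: "\<eta> > 0" for \<eta> :: real
    proof -
      define v where "v z = norm (G z) + \<eta> * (cmod (z - z0))\<^sup>2" for z
      have "continuous_on (cball z0 R) v"
        unfolding v_def by (intro continuous_intros cont)
      then obtain z1 where z1: "z1 \<in> cball z0 R" "\<And>z. z \<in> cball z0 R \<Longrightarrow> v z \<le> v z1"
        using continuous_attains_sup[of "cball z0 R" v] R by auto
      have "cmod (z1 - z0) = R"
      proof (rule ccontr)
        assume "cmod (z1 - z0) \<noteq> R"
        with z1(1) have lt: "cmod (z1 - z0) < R" by (simp add: dist_norm norm_minus_commute)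
        obtain d where d: "d > 0" "boundedly_invertible (\<lambda>f. T f - z1 *\<^sub>C f) d"
          using resolvent_set_boundedly_invertible[OF T] ball z1(1) by blast
        \<comment> \<open>A maximum of v at an interior z1 would bound \<eta> by a fixed multiple of
          every small \<rho>; letting \<rho> tend to 0 then contradicts \<eta> > 0.\<close>
        have small: "\<eta> \<le> \<rho> * (norm (G z1) / d ^ 3)" if \<rho>: "0 < \<rho>" "\<rho> < R - cmod (z1 - z0)" for \<rho>
        proof -
          let ?W = "{1, -1, \<i>, -\<i>} :: complex set"
          let ?p = "\<lambda>w. z1 + of_real \<rho> * w"
          have p: "?p w \<in> cball z0 R" if "w \<in> ?W" for w
          proof -
            have "cmod w = 1" using that by auto
            then have "cmod (?p w - z0) \<le> cmod (z1 - z0) + \<rho>"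
              using norm_triangle_ineq[of "z1 - z0" "of_real \<rho> * w"] \<rho>
              by (simp add: norm_mult algebra_simps)
            then show ?thesis using \<rho> by (simp add: dist_norm norm_minus_commute)
          qed
          let ?N = "norm (G (?p 1)) + norm (G (?p (-1))) + norm (G (?p \<i>)) + norm (G (?p (-\<i>)))"
          have "4 * norm (G z1) \<le> (1 + (\<rho> / d) ^ 3) * ?N"
          proof (rule resolvent_four_point_bound[OF BL_shift[OF T] d(2) d(1) \<rho>(1) f
                GY[OF z1(1)] TG[OF z1(1)]])
            fix w :: complex assume w: "w \<in> ?W"
            show "G (?p w) \<in> Y" by (rule GY[OF p[OF w]])
            show "T (G (?p w)) - z1 *\<^sub>C G (?p w) - (of_real \<rho> * w) *\<^sub>C G (?p w) = f"
              using TG[OF p[OF w]] by (simp add: scaleC_algebra algebra_simps)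
          qed
          also have "?N \<le> 4 * norm (G z1) - 4 * \<eta> * \<rho>\<^sup>2"
          proof -
            have "v (?p 1) \<le> v z1" "v (?p (-1)) \<le> v z1" "v (?p \<i>) \<le> v z1" "v (?p (-\<i>)) \<le> v z1"
              by (intro z1(2) p; simp)+
            then have "?N + \<eta> * ((cmod (?p 1 - z0))\<^sup>2 + (cmod (?p (-1) - z0))\<^sup>2
                + (cmod (?p \<i> - z0))\<^sup>2 + (cmod (?p (-\<i>) - z0))\<^sup>2)
              \<le> 4 * norm (G z1) + 4 * \<eta> * (cmod (z1 - z0))\<^sup>2"
              by (simp add: v_def algebra_simps)
            \<comment> \<open>The cross terms cancel because the four directions sum to
              zero.\<close>
            also have "(cmod (?p 1 - z0))\<^sup>2 + (cmod (?p (-1) - z0))\<^sup>2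
                + (cmod (?p \<i> - z0))\<^sup>2 + (cmod (?p (-\<i>) - z0))\<^sup>2
              = 4 * (cmod (z1 - z0))\<^sup>2 + 4 * \<rho>\<^sup>2"
              by (simp add: cmod_power2) (simp add: power2_eq_square algebra_simps)
            finally show ?thesis by (simp add: algebra_simps)
          qed
          finally have "4 * norm (G z1) \<le> (1 + (\<rho> / d) ^ 3) * (4 * norm (G z1) - 4 * \<eta> * \<rho>\<^sup>2)"
            using d(1) \<rho>(1) by (simp add: mult_left_mono)
          then have "4 * \<eta> * \<rho>\<^sup>2 + (\<rho> / d) ^ 3 * (4 * \<eta> * \<rho>\<^sup>2) \<le> (\<rho> / d) ^ 3 * (4 * norm (G z1))"
            by (simp add: algebra_simps)
          moreover have "0 \<le> (\<rho> / d) ^ 3 * (4 * \<eta> * \<rho>\<^sup>2)" using \<eta> d(1) \<rho>(1) by simp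
          ultimately have "4 * \<eta> * \<rho>\<^sup>2 \<le> (\<rho> / d) ^ 3 * (4 * norm (G z1))"
            by linarith
          also have "\<dots> = 4 * (\<rho>\<^sup>2 * (\<rho> * (norm (G z1) / d ^ 3)))"
            by (simp add: power_divide power3_eq_cube power2_eq_square)
          finally have "4 * (\<rho>\<^sup>2 * \<eta>) \<le> 4 * (\<rho>\<^sup>2 * (\<rho> * (norm (G z1) / d ^ 3)))"
            by (simp only: mult_ac)
          then have "\<rho>\<^sup>2 * \<eta> \<le> \<rho>\<^sup>2 * (\<rho> * (norm (G z1) / d ^ 3))"
            by linarith
          then show ?thesis using \<rho>(1) by (simp only: mult_le_cancel_left_pos zero_less_power)
        qed
        have "((\<lambda>\<rho>. \<rho> * (norm (G z1) / d ^ 3)) \<longlongrightarrow> 0 * (norm (G z1) / d ^ 3)) (at_right 0)"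
          by (intro tendsto_intros)
        then have "((\<lambda>\<rho>. \<rho> * (norm (G z1) / d ^ 3)) \<longlongrightarrow> 0) (at_right 0)" by simp
        moreover have "\<forall>\<^sub>F \<rho> in at_right 0. \<eta> \<le> \<rho> * (norm (G z1) / d ^ 3)"
          unfolding eventually_at_right_field
          by (intro exI[of _ "R - cmod (z1 - z0)"]) (use lt small in auto)
        ultimately have "\<eta> \<le> 0" by (rule tendsto_lowerbound) simp
        then show False using \<eta> by simp
      qed
      then have "c * norm (G z1) \<le> norm f"
        using circle[of z1] GY[OF z1(1)] TG[OF z1(1)] unfolding boundedly_invertible_def by metis
      then have "norm (G z1) \<le> norm f / c" using \<open>c > 0\<close> by (simp add: field_simps)
      then have "v z1 \<le> norm f / c + \<eta> * R\<^sup>2"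
        using \<open>cmod (z1 - z0) = R\<close> by (simp add: v_def)
      moreover have "v z0 \<le> v z1" using z1(2)[of z0] R by simp
      ultimately show ?thesis by (simp add: v_def)
    qed
    have "G z0 = g"
    proof -
      have "z0 \<in> cball z0 R" using R by simp
      note G0 = GY[OF this] TG[OF this]
      have "T (G z0 - g) - z0 *\<^sub>C (G z0 - g) = 0"
        using G0(2) by (simp add: f_def BL_diff[OF T] g G0(1) scaleC_algebra algebra_simps)
      then have "c0 * norm (G z0 - g) \<le> 0"
        using c0(2) diff_mem[OF G0(1) g] unfolding boundedly_invertible_def
        by (metis norm_zero)
      then show ?thesis using c0(1) by (simp add: mult_le_0_iff)
    qed
    have "norm g \<le> norm f / c"
    proof (rule field_le_epsilon)
      fix e :: real assume "e > 0"
      then show "norm g \<le> norm f / c + e"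
        using le[of "e / R\<^sup>2"] R \<open>G z0 = g\<close> by simp
    qed
    then show ?thesis using \<open>c > 0\<close> unfolding f_def by (simp add: field_simps)
  qed
  \<comment> \<open>Surjectivity at z0 comes with c0; the argument has only replaced the constant by
    c.\<close>
  then show ?thesis using c0(2) unfolding boundedly_invertible_def by blast
qed

text \<open>On the compact ring between the radii \<eta> and \<epsilon> the resolvent of T is
  uniformly bounded, so a small enough perturbation creates no spectrum there.\<close>

lemma near_spectrum_subset_ball:
  assumes T: "T \<in> BL Y" and isolated: "cball z \<epsilon> - {z} \<subseteq> resolvent_set Y T" and "\<eta> > 0"
  shows "\<exists>d>0. \<forall>T'\<in>BL Y. (\<forall>f\<in>Y. norm (T' f - T f) \<le> d * norm f)
    \<longrightarrow> near_spectrum Y T' z \<epsilon> \<subseteq> ball z \<eta>"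
proof -
  let ?C = "cball z \<epsilon> - ball z \<eta>"
  have "compact ?C" by (intro compact_diff) auto
  moreover have "?C \<subseteq> resolvent_set Y T" using isolated \<open>\<eta> > 0\<close> by auto
  ultimately obtain c where c: "c > 0" "\<And>w. w \<in> ?C \<Longrightarrow> boundedly_invertible (\<lambda>f. T f - w *\<^sub>C f) c"
    using uniform_resolvent_bound[OF T] by metis
  have "near_spectrum Y T' z \<epsilon> \<subseteq> ball z \<eta>"
    if T': "T' \<in> BL Y" and close: "\<forall>f\<in>Y. norm (T' f - T f) \<le> c / 2 * norm f" for T'
  proof
    fix w assume w: "w \<in> near_spectrum Y T' z \<epsilon>"
    show "w \<in> ball z \<eta>"
    proof (rule ccontr)
      assume "w \<notin> ball z \<eta>"
      with w have "w \<in> ?C" by (auto simp: near_spectrum_def dist_norm norm_minus_commute)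
      then have "boundedly_invertible (\<lambda>f. T' f - w *\<^sub>C f) (c - (c / 2 + cmod (w - w)))"
        by (intro shift_perturb[OF T T' c(2)]) (use close c(1) in auto)
      then have "w \<in> resolvent_set Y T'"
        by (rule resolvent_setI[OF T']) (use c(1) in simp)
      then show False using w by (simp add: near_spectrum_def spectrum_def)
    qed
  qed
  then show ?thesis using c(1) by (intro exI[of _ "c / 2"]) auto
qed

lemma near_spectrum_nonempty:
  assumes T: "T \<in> BL Y" and z: "z \<in> spectrum Y T"
    and isolated: "cball z \<epsilon> - {z} \<subseteq> resolvent_set Y T" and "\<epsilon> > 0"
  shows "\<exists>d>0. \<forall>T'\<in>BL Y. (\<forall>f\<in>Y. norm (T' f - T f) \<le> d * norm f)
    \<longrightarrow> near_spectrum Y T' z \<epsilon> \<noteq> {}"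
proof -
  \<comment> \<open>Half the radius keeps the closed disc inside the open disc on which
    \<open>near_spectrum\<close> will be assumed empty.\<close>
  have "sphere z (\<epsilon> / 2) \<subseteq> resolvent_set Y T" using isolated \<open>\<epsilon> > 0\<close> by force
  then obtain c where c: "c > 0"
      "\<And>w. w \<in> sphere z (\<epsilon> / 2) \<Longrightarrow> boundedly_invertible (\<lambda>f. T f - w *\<^sub>C f) c"
    using uniform_resolvent_bound[OF T compact_sphere] by metis
  \<comment> \<open>The budget c / 3 is spent twice: going from T to T' on the circle leaves 2 c /
    3, and returning from T' to T at the centre leaves c / 3 > 0.\<close>
  have "near_spectrum Y T' z \<epsilon> \<noteq> {}"
    if T': "T' \<in> BL Y" and close: "\<forall>f\<in>Y. norm (T' f - T f) \<le> c / 3 * norm f" for T'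
  proof
    assume empty: "near_spectrum Y T' z \<epsilon> = {}"
    have "cball z (\<epsilon> / 2) \<subseteq> resolvent_set Y T'"
    proof
      fix w assume "w \<in> cball z (\<epsilon> / 2)"
      then have "cmod (w - z) < \<epsilon>" using \<open>\<epsilon> > 0\<close> by (simp add: dist_norm norm_minus_commute)
      then show "w \<in> resolvent_set Y T'"
        using empty by (auto simp: near_spectrum_def spectrum_def)
    qed
    moreover have "boundedly_invertible (\<lambda>f. T' f - w *\<^sub>C f) (2 * c / 3)"
      if "cmod (w - z) = \<epsilon> / 2" for w
    proof -
      have "w \<in> sphere z (\<epsilon> / 2)" using that by (simp add: dist_norm norm_minus_commute)
      then have "boundedly_invertible (\<lambda>f. T' f - w *\<^sub>C f) (c - (c / 3 + cmod (w - w)))"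
        by (intro shift_perturb[OF T T' c(2)]) (use close c(1) in auto)
      then show ?thesis by (rule boundedly_invertible_mono) simp
    qed
    ultimately have "boundedly_invertible (\<lambda>f. T' f - z *\<^sub>C f) (2 * c / 3)"
      using resolvent_maximum_principle[OF T', of "\<epsilon> / 2" z "2 * c / 3"] \<open>\<epsilon> > 0\<close> c(1) by simp
    then have "boundedly_invertible (\<lambda>f. T f - z *\<^sub>C f) (2 * c / 3 - (c / 3 + cmod (z - z)))"
      by (rule shift_perturb[OF T' T]) (use close c(1) in \<open>auto simp: norm_minus_commute\<close>)
    then have "z \<in> resolvent_set Y T"
      by (rule resolvent_setI[OF T]) (use c(1) in simp)
    then show False using z by (simp add: spectrum_def)
  qed
  then show ?thesis using c(1) by (intro exI[of _ "c / 3"]) auto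
qed

text \<open>The sequential form of upper semi-Fredholmness. It isolates what an invertible operator
  plus a compact one contributes to the closed range and simple pole arguments.\<close>

definition proper_on_bounded :: "('a \<Rightarrow> 'a) \<Rightarrow> bool" where
  "proper_on_bounded T \<longleftrightarrow> (\<forall>f. (\<forall>n. f n \<in> Y) \<and> bounded (range f) \<and> Cauchy (\<lambda>n. T (f n))
    \<longrightarrow> (\<exists>l\<in>Y. \<exists>s. strict_mono (s :: nat \<Rightarrow> nat) \<and> (\<lambda>n. f (s n)) \<longlonglongrightarrow> l))"

lemma proper_on_boundedE:
  assumes "proper_on_bounded T" "\<And>n. f n \<in> Y" "\<And>n. norm (f n) \<le> B" "(\<lambda>n. T (f n)) \<longlonglongrightarrow> g"
  obtains l s where "l \<in> Y" "strict_mono (s :: nat \<Rightarrow> nat)" "(\<lambda>n. f (s n)) \<longlonglongrightarrow> l"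
proof -
  have "bounded (range f)" using assms(3) by (auto intro!: boundedI)
  moreover have "Cauchy (\<lambda>n. T (f n))" using assms(4) by (rule LIMSEQ_imp_Cauchy)
  ultimately show thesis
    using assms(1,2) that unfolding proper_on_bounded_def by blast
qed

text \<open>Chooses in the coset of w modulo the kernel an element whose norm exceeds the quotient
  norm by at most 1. In general the infimum need not be attained; the slack 1 vanishes after
  division by norms tending to infinity.\<close>

lemma near_minimiser_modulo_kernel:
  assumes T: "T \<in> BL Y" and w: "w \<in> Y"
  shows "\<exists>v\<in>Y. T v = T w \<and> (\<forall>h\<in>Y. T h = 0 \<longrightarrow> norm v \<le> norm (v - h) + 1)"
proof -
  let ?K = "{h\<in>Y. T h = 0}"
  let ?S = "(\<lambda>h. norm (w - h)) ` ?K"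
  have ne: "?S \<noteq> {}" using zero_mem BL_zero[OF T] by auto
  have bdd: "bdd_below ?S" by (rule bdd_belowI[of _ 0]) auto
  have "\<exists>x\<in>?S. x < Inf ?S + 1"
    using cInf_lessD[OF ne, of "Inf ?S + 1"] by auto
  then obtain h0 where h0: "h0 \<in> Y" "T h0 = 0" "norm (w - h0) < Inf ?S + 1" by auto
  show ?thesis
  proof (intro bexI[of _ "w - h0"] conjI ballI impI)
    show "T (w - h0) = T w" using h0 w by (simp add: BL_diff[OF T])
    fix h assume h: "h \<in> Y" "T h = 0"
    then have "h0 + h \<in> ?K" using h0 by (simp add: add_mem BL_add[OF T])
    then have "norm (w - (h0 + h)) \<in> ?S" by (rule imageI)
    then have "Inf ?S \<le> norm (w - (h0 + h))"
      using bdd by (rule cInf_lower)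
    then show "norm (w - h0) \<le> norm (w - h0 - h) + 1"
      using h0(3) by (simp add: diff_diff_eq)
  qed (use w h0 diff_mem in auto)
qed

text \<open>With near-minimal preimages there are two cases. A bounded subsequence has a limit point
  by properness. If the norms tend to infinity, the normalised preimages accumulate at a kernel
  element l, and along a subsequence subtracting norm (v n) * l shortens v n to o(norm (v n)),
  against near-minimality.\<close>

lemma proper_closed_range:
  assumes T: "T \<in> BL Y" and proper: "proper_on_bounded T"
    and w: "\<And>n. w n \<in> Y" and lim: "(\<lambda>n. T (w n)) \<longlonglongrightarrow> g"
  shows "\<exists>h\<in>Y. T h = g"
proof -
  obtain v where vY: "\<And>n. v n \<in> Y" and Tv: "\<And>n. T (v n) = T (w n)"
      and vmin: "\<And>n h. h \<in> Y \<Longrightarrow> T h = 0 \<Longrightarrow> norm (v n) \<le> norm (v n - h) + 1"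
    using near_minimiser_modulo_kernel[OF T w] by metis
  have limv: "(\<lambda>n. T (v n)) \<longlonglongrightarrow> g" using lim by (simp add: Tv)
  show ?thesis
  proof (cases "\<exists>s B. strict_mono (s :: nat \<Rightarrow> nat) \<and> (\<forall>n. norm (v (s n)) \<le> B)")
    case True
    then obtain s B where s: "strict_mono (s :: nat \<Rightarrow> nat)" "\<And>n. norm (v (s n)) \<le> B" by blast
    have "(\<lambda>n. T (v (s n))) \<longlonglongrightarrow> g"
      using LIMSEQ_subseq_LIMSEQ[OF limv s(1)] by (simp add: o_def)
    then obtain l t where l: "l \<in> Y" "strict_mono (t :: nat \<Rightarrow> nat)" "(\<lambda>n. v (s (t n))) \<longlonglongrightarrow> l"
      by (rule proper_on_boundedE[where f = "\<lambda>n. v (s n)", OF proper vY s(2)])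
    have "(\<lambda>n. T (v (s (t n)))) \<longlonglongrightarrow> T l"
      by (rule BL_tendsto[OF T vY l(1,3)])
    moreover have "(\<lambda>n. T (v (s (t n)))) \<longlonglongrightarrow> g"
      using LIMSEQ_subseq_LIMSEQ[OF LIMSEQ_subseq_LIMSEQ[OF limv s(1)] l(2)] by (simp add: o_def)
    ultimately have "T l = g" by (rule LIMSEQ_unique)
    then show ?thesis using l(1) by blast
  next
    case False
    have unbdd: "filterlim (\<lambda>n. norm (v n)) at_top sequentially"
    proof (rule ccontr)
      assume "\<not> ?thesis"
      then obtain Z where Z: "\<not> (\<forall>\<^sub>F n in sequentially. Z \<le> norm (v n))"
        unfolding filterlim_at_top by blast
      then have "\<exists>\<^sub>F n in sequentially. norm (v n) < Z" by (simp add: frequently_def not_less)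
      then have "infinite {n. norm (v n) < Z}"
        by (simp add: frequently_cofinite[symmetric] cofinite_eq_sequentially)
      then show False
        using False enumerate_in_set[of "{n. norm (v n) < Z}"]
          strict_mono_enumerate[of "{n. norm (v n) < Z}"]
        by (metis (mono_tags, lifting) less_imp_le mem_Collect_eq)
    qed
    define y where "y n = of_real (1 / norm (v n)) *\<^sub>C v n" for n
    have inv0: "(\<lambda>n. 1 / norm (v n)) \<longlonglongrightarrow> 0"
      using tendsto_inverse_0_at_top[OF unbdd] by (simp add: inverse_eq_divide)
    have yY: "y n \<in> Y" for n unfolding y_def by (intro scaleC_mem vY)
    \<comment> \<open>Only an inequality: for v n = 0 the quotient 1 / 0 is 0, and y n = 0.\<close>
    have y1: "norm (y n) \<le> 1" for n by (simp add: y_def norm_scaleC norm_divide)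
    have Ty: "T (y n) = of_real (1 / norm (v n)) *\<^sub>C T (v n)" for n
      unfolding y_def by (rule BL_scaleC[OF T vY])
    have "(\<lambda>n. of_real (1 / norm (v n)) *\<^sub>C T (v n)) \<longlonglongrightarrow> of_real 0 *\<^sub>C g"
      by (intro tendsto_scaleC tendsto_of_real inv0 limv)
    then have Ty0: "(\<lambda>n. T (y n)) \<longlonglongrightarrow> 0" by (simp add: Ty)
    then obtain l s where l: "l \<in> Y" "strict_mono (s :: nat \<Rightarrow> nat)" "(\<lambda>n. y (s n)) \<longlonglongrightarrow> l"
      by (rule proper_on_boundedE[where f = y, OF proper yY y1])
    have "(\<lambda>n. T (y (s n))) \<longlonglongrightarrow> T l" by (rule BL_tendsto[OF T yY l(1,3)])
    moreover have "(\<lambda>n. T (y (s n))) \<longlonglongrightarrow> 0"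
      using LIMSEQ_subseq_LIMSEQ[OF Ty0 l(2)] by (simp add: o_def)
    ultimately have Tl: "T l = 0" by (rule LIMSEQ_unique)
    have min: "1 \<le> norm (y n - l) + 1 / norm (v n)" if pos: "norm (v n) > 0" for n
    proof -
      have "v n - of_real (norm (v n)) *\<^sub>C l = of_real (norm (v n)) *\<^sub>C (y n - l)"
        using pos by (simp add: y_def scaleC_algebra flip: of_real_mult)
      then have "norm (v n - of_real (norm (v n)) *\<^sub>C l) = norm (v n) * norm (y n - l)"
        by (simp add: norm_scaleC)
      moreover have "norm (v n) \<le> norm (v n - of_real (norm (v n)) *\<^sub>C l) + 1"
        by (intro vmin scaleC_mem l) (simp add: BL_scaleC[OF T l(1)] Tl)
      ultimately show ?thesis using pos by (simp add: field_simps)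
    qed
    have "\<forall>\<^sub>F n in sequentially. norm (v n) > 0"
      using unbdd unfolding filterlim_at_top_dense by (rule spec)
    then have "\<forall>\<^sub>F n in sequentially. norm (v (s n)) > 0"
      using l(2) by (rule eventually_subseq[rotated])
    then have ev: "\<forall>\<^sub>F n in sequentially. 1 \<le> norm (y (s n) - l) + 1 / norm (v (s n))"
      by eventually_elim (rule min)
    have "(\<lambda>n. norm (y (s n) - l) + 1 / norm (v (s n))) \<longlonglongrightarrow> norm (l - l) + 0"
      using LIMSEQ_subseq_LIMSEQ[OF inv0 l(2)] by (intro tendsto_intros l) (simp add: o_def)
    then have "1 \<le> norm (l - l) + (0::real)"
      by (rule tendsto_lowerbound[OF _ ev]) simp
    then show ?thesis by simp
  qed
qed

text \<open>Otherwise normalised \<open>f\<^sub>n\<close> with \<open>T f\<^sub>n - \<mu>\<^sub>n f\<^sub>n = o(\<mu>\<^sub>n)\<close> accumulate at some \<open>l \<noteq> 0\<close> in the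
  kernel, while \<open>T (f\<^sub>n / \<mu>\<^sub>n)\<close> tends to \<open>l\<close>; so \<open>l\<close> lies in the range, contradicting ascent one.\<close>

lemma resolvent_simple_pole:
  assumes T: "T \<in> BL Y" and proper: "proper_on_bounded T"
    and ascent1: "\<And>f. f \<in> Y \<Longrightarrow> T (T f) = 0 \<Longrightarrow> T f = 0"
  shows "\<exists>c>0. \<exists>\<eta>>0. \<forall>\<mu>. cmod \<mu> < \<eta> \<longrightarrow> (\<forall>f\<in>Y. c * cmod \<mu> * norm f \<le> norm (T f - \<mu> *\<^sub>C f))"
proof (rule ccontr)
  assume neg: "\<not> ?thesis"
  \<comment> \<open>The negated claim is used with c = \<eta> = 1 / (n + 1).\<close>
  have "\<exists>\<mu> f. cmod \<mu> < 1 / Suc n \<and> f \<in> Y \<and> norm (T f - \<mu> *\<^sub>C f) < 1 / Suc n * cmod \<mu> * norm f" for n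
    using neg by (meson not_le of_nat_0_less_iff zero_less_Suc zero_less_divide_1_iff)
  then obtain \<mu> f where \<mu>: "\<And>n. cmod (\<mu> n) < 1 / Suc n" and fY: "\<And>n. f n \<in> Y"
      and less: "\<And>n. norm (T (f n) - \<mu> n *\<^sub>C f n) < 1 / Suc n * cmod (\<mu> n) * norm (f n)"
    by metis
  have pos: "norm (f n) > 0" "\<mu> n \<noteq> 0" for n
  proof -
    have "0 < 1 / Suc n * cmod (\<mu> n) * norm (f n)"
      using less[of n] norm_ge_zero by (rule le_less_trans[rotated])
    then show "norm (f n) > 0" "\<mu> n \<noteq> 0" by (auto simp: zero_less_mult_iff)
  qed
  define y where "y n = of_real (1 / norm (f n)) *\<^sub>C f n" for n
  have yY: "y n \<in> Y" for n unfolding y_def by (intro scaleC_mem fY)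
  have y1: "norm (y n) = 1" for n using pos(1)[of n] by (simp add: y_def norm_scaleC norm_divide)
  define e where "e n = T (y n) - \<mu> n *\<^sub>C y n" for n
  have e: "norm (e n) \<le> 1 / Suc n * cmod (\<mu> n)" for n
  proof -
    have "e n = of_real (1 / norm (f n)) *\<^sub>C (T (f n) - \<mu> n *\<^sub>C f n)"
      unfolding e_def y_def by (simp add: BL_scaleC[OF T fY] scaleC_algebra mult.commute)
    then have "norm (e n) = norm (T (f n) - \<mu> n *\<^sub>C f n) / norm (f n)"
      by (simp add: norm_scaleC norm_divide)
    also have "\<dots> \<le> (1 / Suc n * cmod (\<mu> n) * norm (f n)) / norm (f n)"
      using less[of n] by (intro divide_right_mono) auto
    finally show ?thesis using pos(1)[of n] by simp
  qed
  have inv0: "(\<lambda>n. 1 / real (Suc n)) \<longlonglongrightarrow> 0"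
    using LIMSEQ_inverse_real_of_nat by (simp add: inverse_eq_divide)
  have "\<mu> \<longlonglongrightarrow> 0"
    by (rule Lim_null_comparison[OF _ inv0]) (use \<mu> in \<open>simp add: less_imp_le\<close>)
  have "e \<longlonglongrightarrow> 0"
  proof (rule Lim_null_comparison[OF _ inv0], rule always_eventually, rule allI)
    fix n
    have "cmod (\<mu> n) \<le> 1"
      using \<mu>[of n] by (rule order_trans[OF less_imp_le]) simp
    then show "norm (e n) \<le> 1 / real (Suc n)"
      using mult_left_mono[of "cmod (\<mu> n)" 1 "1 / real (Suc n)"] e[of n] by simp
  qed
  have "(\<lambda>n. e n + \<mu> n *\<^sub>C y n) \<longlonglongrightarrow> 0 + 0"
  proof (intro tendsto_add \<open>e \<longlonglongrightarrow> 0\<close>)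
    show "(\<lambda>n. \<mu> n *\<^sub>C y n) \<longlonglongrightarrow> 0"
      using tendsto_norm_zero[OF \<open>\<mu> \<longlonglongrightarrow> 0\<close>]
      by (rule Lim_null_comparison[rotated]) (simp add: norm_scaleC y1)
  qed
  then have Ty: "(\<lambda>n. T (y n)) \<longlonglongrightarrow> 0" by (simp add: e_def)
  have "norm (y n) \<le> 1" for n by (simp add: y1)
  then obtain l s where l: "l \<in> Y" "strict_mono (s :: nat \<Rightarrow> nat)" "(\<lambda>n. y (s n)) \<longlonglongrightarrow> l"
    by (rule proper_on_boundedE[where f = y, OF proper yY _ Ty])
  have "(\<lambda>n. T (y (s n))) \<longlonglongrightarrow> T l" by (rule BL_tendsto[OF T yY l(1,3)])
  moreover have "(\<lambda>n. T (y (s n))) \<longlonglongrightarrow> 0"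
    using LIMSEQ_subseq_LIMSEQ[OF Ty l(2)] by (simp add: o_def)
  ultimately have Tl: "T l = 0" by (rule LIMSEQ_unique)
  define w where "w n = (1 / \<mu> (s n)) *\<^sub>C y (s n)" for n
  have wY: "w n \<in> Y" for n unfolding w_def by (intro scaleC_mem yY)
  have Tw: "T (w n) = y (s n) + (1 / \<mu> (s n)) *\<^sub>C e (s n)" for n
    unfolding w_def e_def using pos(2)[of "s n"]
    by (simp add: BL_scaleC[OF T yY] scaleC_algebra)
  have "(\<lambda>n. (1 / \<mu> (s n)) *\<^sub>C e (s n)) \<longlonglongrightarrow> 0"
  proof (rule Lim_null_comparison)
    show "(\<lambda>n. 1 / real (Suc (s n))) \<longlonglongrightarrow> 0"
      using LIMSEQ_subseq_LIMSEQ[OF inv0 l(2)] by (simp add: o_def)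
    show "\<forall>\<^sub>F n in sequentially. norm ((1 / \<mu> (s n)) *\<^sub>C e (s n)) \<le> 1 / real (Suc (s n))"
      using e pos(2) by (intro always_eventually allI) (simp add: norm_scaleC norm_divide field_simps)
  qed
  then have "(\<lambda>n. T (w n)) \<longlonglongrightarrow> l + 0"
    unfolding Tw by (intro tendsto_add l)
  then have "\<exists>h\<in>Y. T h = l + 0"
    by (rule proper_closed_range[where w = w, OF T proper wY])
  then obtain h where h: "h \<in> Y" "T h = l" by auto
  \<comment> \<open>T (T h) = T l = 0, so ascent one gives l = T h = 0, although l is a limit of
    unit vectors.\<close>
  then have "l = 0" using ascent1[of h] Tl by simp
  moreover have "(\<lambda>n. 1 :: real) \<longlonglongrightarrow> norm l"
    using tendsto_norm[OF l(3)] by (simp add: y1)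
  ultimately show False by (simp add: LIMSEQ_const_iff)
qed

text \<open>The generalised eigenspace at the ascent is a line and contains an eigenvector, so every
  vector killed by the square is a multiple of that eigenvector.\<close>

lemma simple_eigenvalue_ascent_one:
  assumes T: "T \<in> BL Y" and simple: "simple_eigenvalue Y T z"
    and f: "f \<in> Y" and f2: "T (T f - z *\<^sub>C f) - z *\<^sub>C (T f - z *\<^sub>C f) = 0"
  shows "T f - z *\<^sub>C f = 0"
proof -
  interpret cvs: vector_space "scaleC :: complex \<Rightarrow> 'a \<Rightarrow> 'a" by (rule vector_space_scaleC)
  define D where "D = (\<lambda>g. T g - z *\<^sub>C g)"
  have D: "D \<in> BL Y" unfolding D_def by (rule BL_shift[OF T])
  define l where "l = ascent Y T z"
  have ker: "ker_pow Y T z m = {f\<in>Y. (D ^^ m) f = 0}" for m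
    by (simp add: ker_pow_def D_def)
  have mono: "ker_pow Y T z m \<subseteq> ker_pow Y T z (m + d)" for m d
  proof -
    have "(D ^^ d) 0 = 0" by (induction d) (simp_all add: BL_zero[OF D])
    then show ?thesis by (auto simp: ker add.commute[of m] funpow_add)
  qed
  have "l > 0 \<and> ker_pow Y T z l = ker_pow Y T z (l + 1)"
    unfolding l_def ascent_def
    by (rule LeastI_ex) (use simple in \<open>simp add: simple_eigenvalue_def finite_ascent_def\<close>)
  then have l: "l \<ge> 1" "ker_pow Y T z l = ker_pow Y T z (l + 1)" by auto
  have "\<not> inj_on D Y"
    using simple by (simp add: simple_eigenvalue_def eigenvalue_def D_def)
  then obtain g1 g2 where "g1 \<in> Y" "g2 \<in> Y" "D g1 = D g2" "g1 \<noteq> g2"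
    by (auto simp: inj_on_def)
  then obtain \<phi> where \<phi>: "\<phi> \<in> Y" "D \<phi> = 0" "\<phi> \<noteq> 0"
    using BL_diff[OF D, of g1 g2] diff_mem[of g1 g2] by (metis diff_self right_minus_eq)
  have "\<phi> \<in> ker_pow Y T z 1" using \<phi> by (simp add: ker)
  then have \<phi>_in: "\<phi> \<in> ker_pow Y T z l" using mono[of 1 "l - 1"] l(1) by auto
  have "f \<in> ker_pow Y T z 2"
    using f f2 by (simp add: ker D_def numeral_2_eq_2)
  \<comment> \<open>The ascent l may be 1, so the inclusion goes up to level l + 1 and returns by
    stabilisation.\<close>
  then have f_in: "f \<in> ker_pow Y T z l"
    using mono[of 2 "l - 1"] l by auto
  have dim: "cvs.dim (ker_pow Y T z l) = 1"
    using simple by (simp add: simple_eigenvalue_def algebraic_multiplicity_def l_def)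
  obtain B where B: "ker_pow Y T z l \<subseteq> cvs.span B" "card B = 1"
    using cvs.basis_exists[of "ker_pow Y T z l"] dim by metis
  then obtain b where b: "B = {b}" by (auto simp: card_1_singleton_iff)
  then have "\<phi> \<in> range (\<lambda>c. c *\<^sub>C b)" "f \<in> range (\<lambda>c. c *\<^sub>C b)"
    using B(1) \<phi>_in f_in by (auto simp only: cvs.span_singleton)
  then obtain c d where cd: "\<phi> = c *\<^sub>C b" "f = d *\<^sub>C b" by blast
  have "c \<noteq> 0" using \<phi>(3) cd(1) by auto
  then have "f = (d / c) *\<^sub>C \<phi>" using cd by (simp add: scaleC_scaleC)
  then have "D f = 0" using BL_scaleC[OF D \<phi>(1)] \<phi>(2) by simp
  then show ?thesis by (simp add: D_def)
qed

end

section \<open>Operators on \<open>L\<^sup>\<infinity>[a,b]\<close>\<close>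

lemma rep_linf_rel: "linf_rel (rep_linf F) (rep_linf F)"
  by (rule Quotient3_rep_reflp[OF Quotient3_linf])

lemma ess_bounded_rep_linf: "ess_bounded (rep_linf F)"
  using rep_linf_rel[of F] by (simp add: linf_rel_def)

lemma rep_linf_measurable [measurable]: "rep_linf F \<in> borel_measurable lebesgue"
  using ess_bounded_rep_linf[of F] by (simp add: ess_bounded_def)

lemma rep_abs_linf_AE:
  assumes "ess_bounded f"
  shows "AE x in lebesgue. rep_linf (abs_linf f) x = f x"
proof -
  have "linf_rel f f" using assms by (simp add: linf_rel_def)
  then have "linf_rel (rep_linf (abs_linf f)) f" by (rule Quotient3_rep_abs[OF Quotient3_linf])
  then show ?thesis by (simp add: linf_rel_def)
qed

lemma linf_eqI:
  assumes "AE x in lebesgue. rep_linf F x = rep_linf G x"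
  shows "F = G"
proof -
  have "linf_rel (rep_linf F) (rep_linf G)"
    using assms by (simp add: linf_rel_def ess_bounded_rep_linf)
  then show ?thesis using Quotient3_rel_rep[OF Quotient3_linf] by blast
qed

lemma rep_zero_linf_AE: "AE x in lebesgue. rep_linf 0 x = 0"
  unfolding zero_linf_def by (rule rep_abs_linf_AE[OF ess_bounded_zero])

lemma rep_add_linf_AE: "AE x in lebesgue. rep_linf (F + G) x = rep_linf F x + rep_linf G x"
  unfolding plus_linf_def map_fun_def o_def id_def
  by (rule rep_abs_linf_AE) (intro ess_bounded_add ess_bounded_rep_linf)

lemma rep_scaleC_linf_AE: "AE x in lebesgue. rep_linf (c *\<^sub>C F) x = c * rep_linf F x"
  unfolding scaleC_linf_def map_fun_def o_def id_def
  by (rule rep_abs_linf_AE) (intro ess_bounded_cmult ess_bounded_rep_linf)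

lemma rep_diff_linf_AE: "AE x in lebesgue. rep_linf (F - G) x = rep_linf F x - rep_linf G x"
proof -
  have diff: "F - G = F + (-1) *\<^sub>C G" by (simp add: scaleC_minus_one)
  show ?thesis
    unfolding diff using rep_add_linf_AE[of F "(-1) *\<^sub>C G"] rep_scaleC_linf_AE[of "-1" G]
    by eventually_elim simp
qed

lemma norm_linf_eq_ess_norm: "norm (F :: linf) = ess_norm (rep_linf F)"
  unfolding norm_linf_def by simp

lemma rep_linf_norm_AE: "AE x in lebesgue. cmod (rep_linf F x) \<le> norm F"
  unfolding norm_linf_eq_ess_norm by (rule ess_norm_AE[OF ess_bounded_rep_linf])

lemma norm_linf_le:
  assumes "0 \<le> C" "AE x in lebesgue. cmod (rep_linf F x) \<le> C"
  shows "norm F \<le> C"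
  using assms ess_norm_le_iff[OF ess_bounded_rep_linf] by (simp add: norm_linf_eq_ess_norm)

lemma Linf_AE: "F \<in> Linf a b \<Longrightarrow> AE x in lebesgue. x \<notin> {a..b} \<longrightarrow> rep_linf F x = 0"
  by (simp add: Linf_def)

lemma complete_Linf: "complete (Linf a b)"
  unfolding complete_def
proof (intro allI impI)
  fix F :: "nat \<Rightarrow> linf" assume "(\<forall>n. F n \<in> Linf a b) \<and> Cauchy F"
  then have F: "\<And>n. F n \<in> Linf a b" and "Cauchy F" by auto
  \<comment> \<open>\<open>lim\<close> is total: on the null set where the representatives diverge
    it is an unspecified constant, so g is measurable on the whole line.\<close>
  define g where "g x = lim (\<lambda>n. rep_linf (F n) x)" for x
  have [measurable]: "g \<in> borel_measurable lebesgue"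
    unfolding g_def by measurable
  \<comment> \<open>Countably many null sets, one for each pair m, n, are merged into one.\<close>
  have "AE x in lebesgue. \<forall>m n. rep_linf (F m - F n) x = rep_linf (F m) x - rep_linf (F n) x"
    by (intro AE_all_countable[THEN iffD2] allI rep_diff_linf_AE)
  moreover have "AE x in lebesgue. \<forall>m n. cmod (rep_linf (F m - F n) x) \<le> norm (F m - F n)"
    by (intro AE_all_countable[THEN iffD2] allI rep_linf_norm_AE)
  ultimately have diff: "AE x in lebesgue. \<forall>m n. cmod (rep_linf (F m) x - rep_linf (F n) x) \<le> norm (F m - F n)"
    by eventually_elim simp
  have lim: "AE x in lebesgue. (\<lambda>n. rep_linf (F n) x) \<longlonglongrightarrow> g x"
    using diff
  proof eventually_elim
    fix x assume x: "\<forall>m n. cmod (rep_linf (F m) x - rep_linf (F n) x) \<le> norm (F m - F n)"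
    have "Cauchy (\<lambda>n. rep_linf (F n) x)"
      using \<open>Cauchy F\<close> x unfolding Cauchy_iff by (meson le_less_trans)
    then show "(\<lambda>n. rep_linf (F n) x) \<longlonglongrightarrow> g x"
      unfolding g_def by (simp add: Cauchy_convergent_iff convergent_LIMSEQ_iff)
  qed
  have close: "AE x in lebesgue. cmod (rep_linf (F n) x - g x) \<le> e"
    if "\<And>m. m \<ge> n \<Longrightarrow> norm (F m - F n) \<le> e" for n e
    using diff lim
  proof eventually_elim
    fix x assume x: "\<forall>m n. cmod (rep_linf (F m) x - rep_linf (F n) x) \<le> norm (F m - F n)"
      and l: "(\<lambda>n. rep_linf (F n) x) \<longlonglongrightarrow> g x"
    have "(\<lambda>m. cmod (rep_linf (F n) x - rep_linf (F m) x)) \<longlonglongrightarrow> cmod (rep_linf (F n) x - g x)"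
      by (intro tendsto_intros l)
    moreover have "\<forall>\<^sub>F m in sequentially. cmod (rep_linf (F n) x - rep_linf (F m) x) \<le> e"
      using eventually_ge_at_top[of n]
      by eventually_elim (metis x that norm_minus_commute order_trans)
    ultimately show "cmod (rep_linf (F n) x - g x) \<le> e"
      by (rule tendsto_upperbound) simp
  qed
  have cauchy: "\<exists>N. \<forall>n\<ge>N. \<forall>m\<ge>n. norm (F m - F n) \<le> e" if "e > 0" for e
    using \<open>Cauchy F\<close> that unfolding Cauchy_iff by (meson less_imp_le order_trans)
  obtain N where "\<And>m. m \<ge> N \<Longrightarrow> norm (F m - F N) \<le> 1" using cauchy[of 1] by auto
  then have "AE x in lebesgue. cmod (rep_linf (F N) x - g x) \<le> 1" by (rule close)
  then have "AE x in lebesgue. cmod (g x) \<le> norm (F N) + 1"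
    using rep_linf_norm_AE[of "F N"]
    by eventually_elim (use norm_triangle_sub norm_minus_commute in \<open>smt (verit)\<close>)
  then have bdd: "ess_bounded g" by (auto simp: ess_bounded_def)
  define G where "G = abs_linf g"
  have G: "AE x in lebesgue. rep_linf G x = g x"
    unfolding G_def by (rule rep_abs_linf_AE[OF bdd])
  have "G \<in> Linf a b"
    unfolding Linf_def mem_Collect_eq
  proof -
    have "AE x in lebesgue. \<forall>n. x \<notin> {a..b} \<longrightarrow> rep_linf (F n) x = 0"
      using F by (intro AE_all_countable[THEN iffD2] allI Linf_AE)
    then show "AE x in lebesgue. x \<notin> {a..b} \<longrightarrow> rep_linf G x = 0"
      using lim G by eventually_elim (auto simp: LIMSEQ_const_iff)
  qed
  moreover have "F \<longlonglongrightarrow> G"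
  proof (rule LIMSEQ_I)
    fix e :: real assume "e > 0"
    then obtain N where N: "\<And>n m. n \<ge> N \<Longrightarrow> m \<ge> n \<Longrightarrow> norm (F m - F n) \<le> e / 2"
      using cauchy[of "e / 2"] by auto
    have "norm (F n - G) < e" if "n \<ge> N" for n
    proof -
      have "AE x in lebesgue. cmod (rep_linf (F n) x - g x) \<le> e / 2"
        by (rule close) (rule N[OF that])
      then have "AE x in lebesgue. cmod (rep_linf (F n - G) x) \<le> e / 2"
        using G rep_diff_linf_AE[of "F n" G] by eventually_elim simp
      then have "norm (F n - G) \<le> e / 2" using \<open>e > 0\<close> by (intro norm_linf_le) auto
      then show ?thesis using \<open>e > 0\<close> by simp
    qed
    then show "\<exists>N. \<forall>n\<ge>N. norm (F n - G) < e" by blast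
  qed
  ultimately show "\<exists>l\<in>Linf a b. F \<longlonglongrightarrow> l" by blast
qed

interpretation Linf: banach_subspace "Linf a b"
proof
  show "0 \<in> Linf a b"
    unfolding Linf_def mem_Collect_eq using rep_zero_linf_AE by eventually_elim simp
  show "F + G \<in> Linf a b" if "F \<in> Linf a b" "G \<in> Linf a b" for F G
    unfolding Linf_def mem_Collect_eq
    using Linf_AE[OF that(1)] Linf_AE[OF that(2)] rep_add_linf_AE[of F G] by eventually_elim simp
  show "c *\<^sub>C F \<in> Linf a b" if "F \<in> Linf a b" for F c
    unfolding Linf_def mem_Collect_eq
    using Linf_AE[OF that] rep_scaleC_linf_AE[of c F] by eventually_elim simp
qed (rule complete_Linf)

lemma
  assumes "ess_bounded (\<lambda>x. if x \<in> {a..b} then f x else 0)"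
  shows linf_class_mem: "linf_class a b f \<in> Linf a b"
    and rep_linf_class_AE:
      "AE x in lebesgue. rep_linf (linf_class a b f) x = (if x \<in> {a..b} then f x else 0)"
proof -
  show AE: "AE x in lebesgue. rep_linf (linf_class a b f) x = (if x \<in> {a..b} then f x else 0)"
    unfolding linf_class_def by (rule rep_abs_linf_AE[OF assms])
  show "linf_class a b f \<in> Linf a b"
    unfolding Linf_def mem_Collect_eq using AE by eventually_elim simp
qed

text \<open>Gives access to the measurability theorem for integrals depending on a parameter, with
  \<open>lebesgue\<close> as the integrating measure.\<close>

lemma sigma_finite_lebesgue: "sigma_finite_measure (lebesgue :: 'a::euclidean_space measure)"
proof -
  obtain A :: "nat \<Rightarrow> 'a set" where A: "range A \<subseteq> sets lborel" "(\<Union>i. A i) = space lborel"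
      "\<And>i. emeasure lborel (A i) \<noteq> \<infinity>"
    using lborel.sigma_finite by blast
  show ?thesis
    by standard (intro exI[of _ "range A"], use A in auto)
qed

text \<open>The short interval \<open>{c..d}\<close> serves test functions concentrated near a
  point. Without integrability the integral is 0 by convention and the bound is trivial.\<close>

lemma set_integral_norm_le_subinterval:
  fixes w :: "real \<Rightarrow> complex"
  assumes "c \<le> d" "0 \<le> C" "AE u in lebesgue. u \<in> {a..b} \<longrightarrow> cmod (w u) \<le> C * indicator {c..d} u"
  shows "cmod (LINT u:{a..b}|lebesgue. w u) \<le> C * (d - c)"
proof (cases "set_integrable lebesgue {a..b} w")
  case True
  have "cmod (LINT u:{a..b}|lebesgue. w u) \<le> (LINT u|lebesgue. norm (indicator {a..b} u *\<^sub>R w u))"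
    unfolding set_lebesgue_integral_def by (rule integral_norm_bound)
  also have "\<dots> \<le> (LINT u|lebesgue. indicator {c..d} u *\<^sub>R C)"
  proof (rule integral_mono_AE)
    show "integrable lebesgue (\<lambda>u. norm (indicator {a..b} u *\<^sub>R w u))"
      using True unfolding set_integrable_def by (rule integrable_norm)
    show "integrable lebesgue (\<lambda>u. indicator {c..d} u *\<^sub>R C)"
      by (intro integrable_scaleR_left integrable_real_indicator) (auto simp: emeasure_lborel_Icc_eq)
    show "AE u in lebesgue. norm (indicator {a..b} u *\<^sub>R w u) \<le> indicator {c..d} u *\<^sub>R C"
      using assms(3) by eventually_elim (use assms(2) in \<open>auto simp: indicator_def\<close>)
  qed
  also have "\<dots> = C * (d - c)" using assms(1) by simp
  finally show ?thesis .
next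
  case False
  then have "(LINT u:{a..b}|lebesgue. w u) = 0"
    unfolding set_lebesgue_integral_def set_integrable_def by (rule not_integrable_integral_eq)
  then show ?thesis using assms by simp
qed

lemma set_integral_norm_le:
  fixes w :: "real \<Rightarrow> complex"
  assumes "a \<le> b" "0 \<le> C" "AE u in lebesgue. u \<in> {a..b} \<longrightarrow> cmod (w u) \<le> C"
  shows "cmod (LINT u:{a..b}|lebesgue. w u) \<le> C * (b - a)"
  using assms by (intro set_integral_norm_le_subinterval) (auto elim!: eventually_mono)

text \<open>A common frame for k and its discontinuous degenerate approximation. Extension by zero
  turns measurability on the square into Borel measurability on the plane.\<close>

definition bounded_kernel :: "real \<Rightarrow> real \<Rightarrow> real \<Rightarrow> (real \<Rightarrow> real \<Rightarrow> complex) \<Rightarrow> bool" where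
  "bounded_kernel a b B k \<longleftrightarrow> 0 \<le> B
    \<and> (\<lambda>(x, u). if x \<in> {a..b} \<and> u \<in> {a..b} then k x u else 0) \<in> borel_measurable borel
    \<and> (\<forall>x\<in>{a..b}. \<forall>u\<in>{a..b}. cmod (k x u) \<le> B)"

lemma bounded_kernel_integrable:
  assumes k: "bounded_kernel a b B k" and w: "ess_bounded w" and x: "x \<in> {a..b}"
  shows "set_integrable lebesgue {a..b} (\<lambda>u. k x u * w u)"
proof -
  obtain D where D: "AE u in lebesgue. cmod (w u) \<le> D"
    using w by (auto simp: ess_bounded_def)
  have [measurable]: "w \<in> borel_measurable lebesgue" using w by (simp add: ess_bounded_def)
  have [measurable]: "(\<lambda>(x, u). if x \<in> {a..b} \<and> u \<in> {a..b} then k x u else 0)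
      \<in> borel_measurable (borel \<Otimes>\<^sub>M borel)"
    using k by (simp add: bounded_kernel_def borel_prod)
  have "(\<lambda>u. case (x, u) of (x, u) \<Rightarrow> if x \<in> {a..b} \<and> u \<in> {a..b} then k x u else 0)
      \<in> borel_measurable borel"
    by measurable
  then have kx: "(\<lambda>u. if u \<in> {a..b} then k x u else 0) \<in> borel_measurable lebesgue"
    using x by (intro measurable_completion) simp
  show ?thesis
    unfolding set_integrable_def
  proof (rule Bochner_Integration.integrable_bound)
    show "integrable lebesgue (\<lambda>u. indicator {a..b} u *\<^sub>R (B * D))"
      by (intro integrable_scaleR_left integrable_real_indicator) (auto simp: emeasure_lborel_Icc_eq)
    have "(\<lambda>u. indicator {a..b} u *\<^sub>R (k x u * w u)) =
        (\<lambda>u. (if u \<in> {a..b} then k x u else 0) * w u)"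
      by (auto simp: indicator_def)
    then show "(\<lambda>u. indicator {a..b} u *\<^sub>R (k x u * w u)) \<in> borel_measurable lebesgue"
      using kx by simp
    show "AE u in lebesgue. norm (indicator {a..b} u *\<^sub>R (k x u * w u))
        \<le> norm (indicator {a..b} u *\<^sub>R (B * D))"
      using D
    proof eventually_elim
      fix u assume u: "cmod (w u) \<le> D"
      show "norm (indicator {a..b} u *\<^sub>R (k x u * w u)) \<le> norm (indicator {a..b} u *\<^sub>R (B * D))"
      proof (cases "u \<in> {a..b}")
        case True
        then have "cmod (k x u) * cmod (w u) \<le> B * D"
          using k x u by (intro mult_mono) (auto simp: bounded_kernel_def)
        then show ?thesis using True by (simp add: norm_mult)
      qed simp
    qed
  qed
qed

lemma bounded_kernel_integral_le:
  assumes k: "bounded_kernel a b B k" and ab: "a \<le> b" and x: "x \<in> {a..b}"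
  shows "cmod (LINT u:{a..b}|lebesgue. k x u * rep_linf F u) \<le> B * norm F * (b - a)"
proof (rule set_integral_norm_le[OF ab])
  show "0 \<le> B * norm F" using k by (simp add: bounded_kernel_def)
  show "AE u in lebesgue. u \<in> {a..b} \<longrightarrow> cmod (k x u * rep_linf F u) \<le> B * norm F"
    using rep_linf_norm_AE[of F]
    by eventually_elim (use k x in \<open>auto simp: bounded_kernel_def norm_mult intro!: mult_mono\<close>)
qed

text \<open>The kernel is Borel in both variables but w is only Lebesgue measurable, so everything
  is first transported to the product of the completed measures.\<close>

lemma bounded_kernel_integral_measurable:
  assumes k: "bounded_kernel a b B k" and w: "w \<in> borel_measurable lebesgue"
  shows "(\<lambda>x. if x \<in> {a..b} then LINT u:{a..b}|lebesgue. k x u * w u else 0) \<in> borel_measurable lebesgue"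
proof -
  interpret sigma_finite_measure "lebesgue :: real measure" by (rule sigma_finite_lebesgue)
  let ?k = "\<lambda>(x, u). if x \<in> {a..b} \<and> u \<in> {a..b} then k x u else 0"
  have k_meas: "?k \<in> borel_measurable (borel \<Otimes>\<^sub>M borel)"
    using k by (simp add: bounded_kernel_def borel_prod)
  have [measurable]: "fst \<in> lebesgue \<Otimes>\<^sub>M lebesgue \<rightarrow>\<^sub>M (borel :: real measure)"
      "snd \<in> lebesgue \<Otimes>\<^sub>M lebesgue \<rightarrow>\<^sub>M (borel :: real measure)"
    using measurable_compose[OF measurable_fst, of id lebesgue borel lebesgue]
      measurable_compose[OF measurable_snd, of id lebesgue borel lebesgue]
    by (simp_all add: measurable_completion)
  have "(\<lambda>p. ?k (fst p, snd p)) \<in> borel_measurable (lebesgue \<Otimes>\<^sub>M lebesgue)"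
    by (rule measurable_compose[OF _ k_meas]) measurable
  moreover have "(\<lambda>p. w (snd p)) \<in> borel_measurable (lebesgue \<Otimes>\<^sub>M lebesgue)"
    using w by measurable
  ultimately have "(\<lambda>p. ?k (fst p, snd p) * w (snd p)) \<in> borel_measurable (lebesgue \<Otimes>\<^sub>M lebesgue)"
    by (rule borel_measurable_times)
  then have "case_prod (\<lambda>x u. ?k (x, u) * w u) \<in> borel_measurable (lebesgue \<Otimes>\<^sub>M lebesgue)"
    by (simp only: split_beta' fst_conv snd_conv)
  then have "(\<lambda>x. LINT u|lebesgue. ?k (x, u) * w u) \<in> borel_measurable lebesgue"
    by (rule borel_measurable_lebesgue_integral)
  moreover have "(\<lambda>x. LINT u|lebesgue. ?k (x, u) * w u) =
      (\<lambda>x. if x \<in> {a..b} then LINT u:{a..b}|lebesgue. k x u * w u else 0)"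
    by (auto simp: set_lebesgue_integral_def indicator_def fun_eq_iff intro!: Bochner_Integration.integral_cong)
  ultimately show ?thesis by simp
qed

lemma integral_op_ess_bounded:
  assumes k: "bounded_kernel a b B k" and ab: "a \<le> b"
  shows "ess_bounded (\<lambda>x. if x \<in> {a..b} then of_real \<alpha> * (LINT u:{a..b}|lebesgue. k x u * rep_linf F u) else 0)"
proof -
  let ?h = "\<lambda>x. if x \<in> {a..b} then (LINT u:{a..b}|lebesgue. k x u * rep_linf F u) else 0"
  have "ess_bounded ?h"
    unfolding ess_bounded_def
  proof
    show "?h \<in> borel_measurable lebesgue"
      by (rule bounded_kernel_integral_measurable[OF k rep_linf_measurable])
    have "0 \<le> B * norm F * (b - a)" using k ab by (simp add: bounded_kernel_def)
    then show "\<exists>C. AE x in lebesgue. cmod (?h x) \<le> C"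
      using bounded_kernel_integral_le[OF k ab, of _ F]
      by (intro exI[of _ "B * norm F * (b - a)"] AE_I2) simp
  qed
  then have "ess_bounded (\<lambda>x. of_real \<alpha> * ?h x)" by (rule ess_bounded_cmult)
  then show ?thesis by (rule back_subst[of ess_bounded]) auto
qed

lemma
  assumes "bounded_kernel a b B k" and "a \<le> b"
  shows integral_op_mem: "integral_op a b \<alpha> k F \<in> Linf a b"
    and rep_integral_op_AE: "AE x in lebesgue. rep_linf (integral_op a b \<alpha> k F) x =
      (if x \<in> {a..b} then of_real \<alpha> * (LINT u:{a..b}|lebesgue. k x u * rep_linf F u) else 0)"
  unfolding integral_op_def
  using linf_class_mem[OF integral_op_ess_bounded[OF assms]]
    rep_linf_class_AE[OF integral_op_ess_bounded[OF assms]] by auto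

text \<open>The representative of a sum or of a scalar multiple is determined only almost
  everywhere; this moves such identities under the integral at a fixed x.\<close>

lemma kernel_integral_cong_AE:
  assumes k: "bounded_kernel a b B k" and "ess_bounded w1" "ess_bounded w2" and x: "x \<in> {a..b}"
    and AE: "AE u in lebesgue. w1 u = w2 u"
  shows "(LINT u:{a..b}|lebesgue. k x u * w1 u) = (LINT u:{a..b}|lebesgue. k x u * w2 u)"
  unfolding set_lebesgue_integral_def
proof (rule integral_cong_AE)
  show "(\<lambda>u. indicator {a..b} u *\<^sub>R (k x u * w1 u)) \<in> borel_measurable lebesgue"
    "(\<lambda>u. indicator {a..b} u *\<^sub>R (k x u * w2 u)) \<in> borel_measurable lebesgue"
    using bounded_kernel_integrable[OF k _ x] assms(2,3)
    unfolding set_integrable_def by (auto intro: borel_measurable_integrable)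
  show "AE u in lebesgue. indicator {a..b} u *\<^sub>R (k x u * w1 u) = indicator {a..b} u *\<^sub>R (k x u * w2 u)"
    using AE by eventually_elim simp
qed

section \<open>Integral operators with bounded kernels\<close>

lemma integral_op_BL:
  assumes k: "bounded_kernel a b B k" and ab: "a \<le> b"
  shows "integral_op a b \<alpha> k \<in> BL (Linf a b)"
  unfolding BL_def
proof (intro CollectI conjI ballI allI exI)
  fix F G :: linf and c :: complex
  note eb = ess_bounded_rep_linf and AE_op = rep_integral_op_AE[OF k ab]
  note int = bounded_kernel_integrable[OF k]
  show "integral_op a b \<alpha> k F \<in> Linf a b" by (rule integral_op_mem[OF k ab])
  have add: "(LINT u:{a..b}|lebesgue. k x u * rep_linf (F + G) u) =
      (LINT u:{a..b}|lebesgue. k x u * rep_linf F u) + (LINT u:{a..b}|lebesgue. k x u * rep_linf G u)"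
    if "x \<in> {a..b}" for x
    using kernel_integral_cong_AE[OF k eb ess_bounded_add[OF eb eb] that rep_add_linf_AE[of F G]]
      set_integral_add(2)[OF int[OF eb that] int[OF eb that], of F G]
    by (simp add: distrib_left)
  show "integral_op a b \<alpha> k (F + G) = integral_op a b \<alpha> k F + integral_op a b \<alpha> k G"
    using AE_op[of \<alpha> "F + G"] AE_op[of \<alpha> F] AE_op[of \<alpha> G]
      rep_add_linf_AE[of "integral_op a b \<alpha> k F" "integral_op a b \<alpha> k G"]
    by (intro linf_eqI, eventually_elim) (simp add: add distrib_left)
  have scale: "(LINT u:{a..b}|lebesgue. k x u * rep_linf (c *\<^sub>C F) u) =
      c * (LINT u:{a..b}|lebesgue. k x u * rep_linf F u)" if "x \<in> {a..b}" for x
    using kernel_integral_cong_AE[OF k eb ess_bounded_cmult[OF eb] that rep_scaleC_linf_AE[of c F]]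
    by (simp add: mult.left_commute[of _ c])
  show "integral_op a b \<alpha> k (c *\<^sub>C F) = c *\<^sub>C integral_op a b \<alpha> k F"
    using AE_op[of \<alpha> "c *\<^sub>C F"] AE_op[of \<alpha> F] rep_scaleC_linf_AE[of c "integral_op a b \<alpha> k F"]
    by (intro linf_eqI, eventually_elim) (simp add: scale)
  have nn: "0 \<le> \<bar>\<alpha>\<bar> * (B * norm F * (b - a))" using k ab by (simp add: bounded_kernel_def)
  have "norm (integral_op a b \<alpha> k F) \<le> \<bar>\<alpha>\<bar> * (B * norm F * (b - a))"
  proof (rule norm_linf_le[OF nn])
    show "AE x in lebesgue. cmod (rep_linf (integral_op a b \<alpha> k F) x) \<le> \<bar>\<alpha>\<bar> * (B * norm F * (b - a))"
      using AE_op[of \<alpha> F]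
      by eventually_elim (use nn bounded_kernel_integral_le[OF k ab, of _ F] in
        \<open>auto simp: norm_mult intro!: mult_left_mono\<close>)
  qed
  then show "norm (integral_op a b \<alpha> k F) \<le> (\<bar>\<alpha>\<bar> * B * (b - a)) * norm F"
    by (simp add: mult_ac)
qed

text \<open>Closeness is an iterated almost everywhere condition because the closed cells in
  \<open>phi\<close> overlap at interior partition points, so that the kernel estimate is made only
  inside open cells.\<close>

lemma integral_op_diff_le:
  assumes k: "bounded_kernel a b B k" and k': "bounded_kernel a b B' k'" and ab: "a \<le> b" and e: "0 \<le> e"
    and close: "AE x in lebesgue. x \<in> {a..b} \<longrightarrow>
      (AE u in lebesgue. u \<in> {a..b} \<longrightarrow> cmod (k x u - k' x u) \<le> e)"
  shows "norm (integral_op a b \<alpha> k F - integral_op a b \<alpha> k' F) \<le> \<bar>\<alpha>\<bar> * (b - a) * e * norm F"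
proof (rule norm_linf_le)
  show "0 \<le> \<bar>\<alpha>\<bar> * (b - a) * e * norm F" using ab e by simp
  have diff: "cmod ((LINT u:{a..b}|lebesgue. k x u * rep_linf F u) - (LINT u:{a..b}|lebesgue. k' x u * rep_linf F u))
      \<le> e * norm F * (b - a)"
    if x: "x \<in> {a..b}" and close: "AE u in lebesgue. u \<in> {a..b} \<longrightarrow> cmod (k x u - k' x u) \<le> e" for x
  proof -
    have "(LINT u:{a..b}|lebesgue. k x u * rep_linf F u) - (LINT u:{a..b}|lebesgue. k' x u * rep_linf F u) =
        (LINT u:{a..b}|lebesgue. k x u * rep_linf F u - k' x u * rep_linf F u)"
      by (intro set_integral_diff(2)[symmetric] bounded_kernel_integrable[OF k]
          bounded_kernel_integrable[OF k'] ess_bounded_rep_linf x)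
    also have "cmod \<dots> \<le> e * norm F * (b - a)"
    proof (rule set_integral_norm_le[OF ab])
      show "AE u in lebesgue. u \<in> {a..b} \<longrightarrow>
          cmod (k x u * rep_linf F u - k' x u * rep_linf F u) \<le> e * norm F"
        using close rep_linf_norm_AE[of F]
        by eventually_elim (auto simp: norm_mult e intro!: mult_mono simp flip: left_diff_distrib)
    qed (use e in simp)
    finally show ?thesis .
  qed
  show "AE x in lebesgue. cmod (rep_linf (integral_op a b \<alpha> k F - integral_op a b \<alpha> k' F) x)
      \<le> \<bar>\<alpha>\<bar> * (b - a) * e * norm F"
    using rep_diff_linf_AE[of "integral_op a b \<alpha> k F" "integral_op a b \<alpha> k' F"]
      rep_integral_op_AE[OF k ab, of \<alpha> F] rep_integral_op_AE[OF k' ab, of \<alpha> F] close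
  proof eventually_elim
    case (elim x)
    show ?case
    proof (cases "x \<in> {a..b}")
      case True
      have "cmod (rep_linf (integral_op a b \<alpha> k F - integral_op a b \<alpha> k' F) x) =
        \<bar>\<alpha>\<bar> * cmod ((LINT u:{a..b}|lebesgue. k x u * rep_linf F u) -
          (LINT u:{a..b}|lebesgue. k' x u * rep_linf F u))"
        using elim True by (simp add: norm_mult flip: right_diff_distrib)
      also have "\<dots> \<le> \<bar>\<alpha>\<bar> * (e * norm F * (b - a))"
        using elim(4) True by (intro mult_left_mono diff) auto
      finally show ?thesis by (simp add: mult_ac)
    next
      case False
      then show ?thesis using elim ab e by (simp del: atLeastAtMost_iff)
    qed
  qed
qed

section \<open>Multiplication operators\<close>

definition bounded_multiplier :: "real \<Rightarrow> real \<Rightarrow> real \<Rightarrow> (real \<Rightarrow> real) \<Rightarrow> bool" where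
  "bounded_multiplier a b S s \<longleftrightarrow> 0 \<le> S \<and> s \<in> borel_measurable borel \<and> (\<forall>x\<in>{a..b}. \<bar>s x\<bar> \<le> S)"

lemma
  assumes s: "bounded_multiplier a b S s"
  shows mult_op_mem: "mult_op a b s F \<in> Linf a b"
    and rep_mult_op_AE: "AE x in lebesgue. rep_linf (mult_op a b s F) x =
      (if x \<in> {a..b} then of_real (s x) * rep_linf F x else 0)"
proof -
  let ?h = "\<lambda>x. if x \<in> {a..b} then of_real (s x) * rep_linf F x else 0"
  have [measurable]: "s \<in> borel_measurable lebesgue" "(\<lambda>x::real. x) \<in> borel_measurable lebesgue"
    using s by (simp_all add: bounded_multiplier_def measurable_completion)
  have "?h \<in> borel_measurable lebesgue" by measurable
  moreover have "AE x in lebesgue. cmod (?h x) \<le> S * norm F"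
    using rep_linf_norm_AE[of F]
    by eventually_elim (use s in \<open>auto simp: bounded_multiplier_def norm_mult intro!: mult_mono\<close>)
  ultimately have "ess_bounded ?h" unfolding ess_bounded_def by blast
  then show "mult_op a b s F \<in> Linf a b"
    "AE x in lebesgue. rep_linf (mult_op a b s F) x = ?h x"
    unfolding mult_op_def by (rule linf_class_mem, rule rep_linf_class_AE)
qed

lemma mult_op_BL:
  assumes s: "bounded_multiplier a b S s"
  shows "mult_op a b s \<in> BL (Linf a b)"
  unfolding BL_def
proof (intro CollectI conjI ballI allI exI)
  fix F G :: linf and c :: complex
  note AE_op = rep_mult_op_AE[OF s]
  show "mult_op a b s F \<in> Linf a b" by (rule mult_op_mem[OF s])
  show "mult_op a b s (F + G) = mult_op a b s F + mult_op a b s G"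
    using AE_op[of "F + G"] AE_op[of F] AE_op[of G] rep_add_linf_AE[of F G]
      rep_add_linf_AE[of "mult_op a b s F" "mult_op a b s G"]
    by (intro linf_eqI, eventually_elim) (simp add: distrib_left)
  show "mult_op a b s (c *\<^sub>C F) = c *\<^sub>C mult_op a b s F"
    using AE_op[of "c *\<^sub>C F"] AE_op[of F] rep_scaleC_linf_AE[of c F]
      rep_scaleC_linf_AE[of c "mult_op a b s F"]
    by (intro linf_eqI, eventually_elim) simp
  show "norm (mult_op a b s F) \<le> S * norm F"
  proof (rule norm_linf_le)
    show "0 \<le> S * norm F" using s by (simp add: bounded_multiplier_def)
    show "AE x in lebesgue. cmod (rep_linf (mult_op a b s F) x) \<le> S * norm F"
      using AE_op[of F] rep_linf_norm_AE[of F]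
      by eventually_elim (use s in \<open>auto simp: bounded_multiplier_def norm_mult intro!: mult_mono\<close>)
  qed
qed

lemma mult_op_diff_le:
  assumes s: "bounded_multiplier a b S s" and s': "bounded_multiplier a b S' s'" and e: "0 \<le> e"
    and close: "AE x in lebesgue. x \<in> {a..b} \<longrightarrow> \<bar>s x - s' x\<bar> \<le> e"
  shows "norm (mult_op a b s F - mult_op a b s' F) \<le> e * norm F"
proof (rule norm_linf_le)
  show "0 \<le> e * norm F" using e by simp
  show "AE x in lebesgue. cmod (rep_linf (mult_op a b s F - mult_op a b s' F) x) \<le> e * norm F"
    using rep_diff_linf_AE[of "mult_op a b s F" "mult_op a b s' F"] rep_mult_op_AE[OF s, of F]
      rep_mult_op_AE[OF s', of F] rep_linf_norm_AE[of F] close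
  proof eventually_elim
    case (elim x)
    show ?case
    proof (cases "x \<in> {a..b}")
      case True
      have "cmod (rep_linf (mult_op a b s F - mult_op a b s' F) x) = \<bar>s x - s' x\<bar> * cmod (rep_linf F x)"
        using elim True by (simp add: norm_mult flip: left_diff_distrib of_real_diff)
      also have "\<dots> \<le> e * norm F" using elim True e by (intro mult_mono) auto
      finally show ?thesis .
    next
      case False
      then show ?thesis using elim e by (simp del: atLeastAtMost_iff)
    qed
  qed
qed

section \<open>Error of the degenerate kernel approximation\<close>

lemma C_on_square_continuous:
  "C_on_square m a b g \<Longrightarrow> continuous_on ({a..b} \<times> {a..b}) (\<lambda>(x, u). g x u)"
  by (cases m) auto

lemma continuous_on_square_bounded:
  fixes g :: "real \<Rightarrow> real \<Rightarrow> complex"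
  assumes "continuous_on ({a..b} \<times> {a..b}) (\<lambda>(x, u). g x u)"
  obtains B where "B \<ge> 0" "\<And>x u. x \<in> {a..b} \<Longrightarrow> u \<in> {a..b} \<Longrightarrow> cmod (g x u) \<le> B"
proof -
  have "compact ((\<lambda>(x, u). g x u) ` ({a..b} \<times> {a..b}))"
    by (intro compact_continuous_image assms compact_Times compact_Icc)
  then obtain B where B: "\<forall>y\<in>(\<lambda>(x, u). g x u) ` ({a..b} \<times> {a..b}). cmod y \<le> B"
    using compact_imp_bounded bounded_iff by metis
  show thesis
    by (rule that[of "max B 0"]) (use B in force)+
qed

lemma continuous_bounded_kernel:
  assumes "continuous_on ({a..b} \<times> {a..b}) (\<lambda>(x, u). k x u)"
  shows "\<exists>B. bounded_kernel a b B k"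
proof -
  obtain B where B: "B \<ge> 0" "\<And>x u. x \<in> {a..b} \<Longrightarrow> u \<in> {a..b} \<Longrightarrow> cmod (k x u) \<le> B"
    using continuous_on_square_bounded[OF assms] by blast
  have "(\<lambda>p. indicator ({a..b} \<times> {a..b}) p *\<^sub>R (case p of (x, u) \<Rightarrow> k x u)) \<in> borel_measurable borel"
    by (rule borel_measurable_continuous_on_indicator[OF _ assms])
      (intro borel_closed closed_Times closed_atLeastAtMost)
  moreover have "(\<lambda>p. indicator ({a..b} \<times> {a..b}) p *\<^sub>R (case p of (x, u) \<Rightarrow> k x u)) =
      (\<lambda>(x, u). if x \<in> {a..b} \<and> u \<in> {a..b} then k x u else 0)"
    by (auto simp: fun_eq_iff indicator_def)
  ultimately show ?thesis using B by (auto simp: bounded_kernel_def)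
qed

text \<open>Move from (x, u) to (x', u) and then to (x', u'). Both legs stay in the square, and the
  mean value inequality applies because the partial derivatives are continuous, hence
  bounded.\<close>

lemma C1_on_square_lipschitz:
  assumes "C_on_square (Suc m) a b k"
  obtains L where "L \<ge> 0" "\<And>x u x' u'. \<lbrakk>x \<in> {a..b}; u \<in> {a..b}; x' \<in> {a..b}; u' \<in> {a..b}\<rbrakk>
    \<Longrightarrow> cmod (k x u - k x' u') \<le> L * (\<bar>x - x'\<bar> + \<bar>u - u'\<bar>)"
proof -
  obtain g1 g2 where g: "C_on_square m a b g1" "C_on_square m a b g2"
    and deriv1: "\<And>x u. x \<in> {a..b} \<Longrightarrow> u \<in> {a..b} \<Longrightarrow>
      ((\<lambda>s. k s u) has_vector_derivative g1 x u) (at x within {a..b})"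
    and deriv2: "\<And>x u. x \<in> {a..b} \<Longrightarrow> u \<in> {a..b} \<Longrightarrow>
      ((\<lambda>s. k x s) has_vector_derivative g2 x u) (at u within {a..b})"
    using assms by auto
  obtain L1 where L1: "L1 \<ge> 0" "\<And>x u. x \<in> {a..b} \<Longrightarrow> u \<in> {a..b} \<Longrightarrow> cmod (g1 x u) \<le> L1"
    using continuous_on_square_bounded[OF C_on_square_continuous[OF g(1)]] by blast
  obtain L2 where L2: "L2 \<ge> 0" "\<And>x u. x \<in> {a..b} \<Longrightarrow> u \<in> {a..b} \<Longrightarrow> cmod (g2 x u) \<le> L2"
    using continuous_on_square_bounded[OF C_on_square_continuous[OF g(2)]] by blast
  have mvt: "cmod (f y - f x) \<le> C * \<bar>y - x\<bar>"
    if "\<And>t. t \<in> {a..b} \<Longrightarrow> (f has_vector_derivative f' t) (at t within {a..b})"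
      "\<And>t. t \<in> {a..b} \<Longrightarrow> cmod (f' t) \<le> C" "x \<in> {a..b}" "y \<in> {a..b}" for f f' :: "real \<Rightarrow> complex" and C x y
  proof -
    have "norm (f y - f x) \<le> C * norm (y - x)"
    proof (rule differentiable_bound[of "{a..b}"])
      show "(f has_derivative (\<lambda>s. s *\<^sub>R f' t)) (at t within {a..b})" if "t \<in> {a..b}" for t
        using \<open>\<And>t. t \<in> {a..b} \<Longrightarrow> (f has_vector_derivative f' t) (at t within {a..b})\<close> that
        by (simp add: has_vector_derivative_def)
      show "onorm (\<lambda>s. s *\<^sub>R f' t) \<le> C" if "t \<in> {a..b}" for t
        by (rule onorm_le)
          (use \<open>\<And>t. t \<in> {a..b} \<Longrightarrow> cmod (f' t) \<le> C\<close>[OF that] in \<open>simp add: mult.commute[of C] mult_left_mono\<close>)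
    qed (use that in auto)
    then show ?thesis by simp
  qed
  show thesis
  proof (rule that[of "max L1 L2"])
    fix x u x' u' assume *: "x \<in> {a..b}" "u \<in> {a..b}" "x' \<in> {a..b}" "u' \<in> {a..b}"
    have "cmod (k x u - k x' u) \<le> L1 * \<bar>x - x'\<bar>"
      by (rule mvt[OF deriv1[OF _ *(2)] L1(2)[OF _ *(2)] *(3,1)])
    moreover have "cmod (k x' u - k x' u') \<le> L2 * \<bar>u - u'\<bar>"
      by (rule mvt[OF deriv2[OF *(3)] L2(2)[OF *(3)] *(4,2)])
    moreover have "cmod (k x u - k x' u') \<le> cmod (k x u - k x' u) + cmod (k x' u - k x' u')"
      using norm_triangle_ineq[of "k x u - k x' u" "k x' u - k x' u'"] by simp
    moreover have "L1 * \<bar>x - x'\<bar> \<le> max L1 L2 * \<bar>x - x'\<bar>" "L2 * \<bar>u - u'\<bar> \<le> max L1 L2 * \<bar>u - u'\<bar>"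
      by (intro mult_right_mono; simp)+
    ultimately show "cmod (k x u - k x' u') \<le> max L1 L2 * (\<bar>x - x'\<bar> + \<bar>u - u'\<bar>)"
      by (simp only: distrib_left)
  qed (use L1 in auto)
qed

text \<open>The sum is a polynomial of degree at most r - 1 that takes the value 1 at r distinct
  nodes.\<close>

lemma sum_lagrange:
  assumes "inj_on \<tau> {1..r}" "r \<ge> 1"
  shows "(\<Sum>i=1..r. lagrange r \<tau> i t) = 1"
proof -
  define P where "P = (\<Sum>i\<in>{1..r}. \<Prod>j\<in>{1..r} - {i}. [:- \<tau> j / (\<tau> i - \<tau> j), 1 / (\<tau> i - \<tau> j):])"
  have P: "poly P s = (\<Sum>i=1..r. lagrange r \<tau> i s)" for s
    unfolding P_def lagrange_def
    by (simp add: poly_sum poly_prod diff_divide_distrib)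
  have "degree (\<Prod>j\<in>{1..r} - {i}. [:- \<tau> j / (\<tau> i - \<tau> j), 1 / (\<tau> i - \<tau> j):]) \<le> r - 1"
    if "i \<in> {1..r}" for i
  proof -
    have "degree (\<Prod>j\<in>{1..r} - {i}. [:- \<tau> j / (\<tau> i - \<tau> j), 1 / (\<tau> i - \<tau> j):])
        \<le> (\<Sum>j\<in>{1..r} - {i}. degree [:- \<tau> j / (\<tau> i - \<tau> j), 1 / (\<tau> i - \<tau> j):])"
      by (rule degree_prod_sum_le[unfolded o_def]) simp
    also have "\<dots> \<le> (\<Sum>j\<in>{1..r} - {i}. 1)"
      by (rule sum_mono) simp
    also have "\<dots> = r - 1" using that by simp
    finally show ?thesis .
  qed
  then have deg: "degree P \<le> r - 1"
    unfolding P_def by (intro degree_sum_le) auto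
  have card: "card (\<tau> ` {1..r}) = r" using card_image[OF assms(1)] by simp
  have "P = 1"
  proof (rule poly_eqI_degree[of "\<tau> ` {1..r}"])
    fix y assume "y \<in> \<tau> ` {1..r}"
    then obtain m where m: "m \<in> {1..r}" "y = \<tau> m" by auto
    have "lagrange r \<tau> i (\<tau> m) = (if i = m then 1 else 0)" if "i \<in> {1..r}" for i
    proof (cases "i = m")
      case True
      have "\<tau> m - \<tau> j \<noteq> 0" if "j \<in> {1..r} - {m}" for j
        using inj_onD[OF assms(1), of m j] m(1) that by auto
      then show ?thesis using True by (simp add: lagrange_def)
    next
      case False
      then have "m \<in> {1..r} - {i}" using m by auto
      then show ?thesis using False
        unfolding lagrange_def by (subst prod.remove[of _ m]) auto
    qed
    then have "poly P y = (\<Sum>i=1..r. if i = m then 1 else 0)"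
      unfolding P m(2) by (intro sum.cong) auto
    then show "poly P y = poly 1 y" using m by simp
  qed (use card deg assms(2) in auto)
  then show ?thesis using P[of t] by simp
qed

text \<open>\<Lambda> bounds the Lebesgue function of the nodes on the reference interval. It does
  not see the partition, so the later error constants are uniform in n.\<close>

lemma lagrange_bounded:
  obtains \<Lambda> where "\<Lambda> \<ge> 0" "\<And>t. t \<in> {-1..1} \<Longrightarrow> (\<Sum>i=1..r. \<bar>lagrange r \<tau> i t\<bar>) \<le> \<Lambda>"
proof -
  have "continuous_on {-1..1} (\<lambda>t. \<Sum>i=1..r. \<bar>lagrange r \<tau> i t\<bar>)"
    unfolding lagrange_def divide_inverse by (intro continuous_intros)
  then have "compact ((\<lambda>t. \<Sum>i=1..r. \<bar>lagrange r \<tau> i t\<bar>) ` {-1..1})"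
    by (intro compact_continuous_image) auto
  then obtain B where B: "\<forall>y\<in>(\<lambda>t. \<Sum>i=1..r. \<bar>lagrange r \<tau> i t\<bar>) ` {-1..1}. norm y \<le> B"
    using compact_imp_bounded bounded_iff by metis
  show thesis
    by (rule that[of "max B 0"]) (use B in \<open>force simp: abs_le_iff\<close>)+
qed

section \<open>Partitions, cells and basis functions\<close>

lemma partition_less:
  assumes p: "is_partition a b n p" and "i < j" "j \<le> n"
  shows "p i < p j"
  using assms(2,3)
proof (induction j)
  case (Suc j)
  have "p j < p (Suc j)" using p Suc.prems unfolding is_partition_def by force
  then show ?case using Suc by (cases "i = j") auto
qed simp

lemma partition_le:
  assumes "is_partition a b n p" "i \<le> j" "j \<le> n"
  shows "p i \<le> p j"
  using partition_less[OF assms(1), of i j] assms by (cases "i = j") auto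

lemma partition_mem:
  assumes "is_partition a b n p" "i \<le> n"
  shows "p i \<in> {a..b}"
  using partition_le[OF assms(1), of 0 i] partition_le[OF assms(1), of i n] assms
  by (auto simp: is_partition_def)

lemma mesh_ge: "q \<in> {1..n} \<Longrightarrow> p q - p (q - 1) \<le> mesh n p"
  unfolding mesh_def by (intro Max_ge) auto

lemma mesh_nonneg:
  assumes "is_partition a b n p" "n \<ge> 1"
  shows "0 \<le> mesh n p"
  using mesh_ge[of 1 n p] partition_le[OF assms(1), of 0 1] assms(2) by simp

lemma partition_cell_AE:
  assumes p: "is_partition a b n p"
  shows "AE x in lebesgue. x \<in> {a..b} \<longrightarrow> (\<exists>q\<in>{1..n}. x \<in> {p (q - 1)<..<p q})"
proof -
  have "AE x in lebesgue. x \<notin> p ` {..n}"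
    by (intro AE_not_in null_sets_completionI finite_imp_null_set_lborel) simp
  then show ?thesis
  proof eventually_elim
    fix x assume x: "x \<notin> p ` {..n}"
    show "x \<in> {a..b} \<longrightarrow> (\<exists>q\<in>{1..n}. x \<in> {p (q - 1)<..<p q})"
    proof
      assume xab: "x \<in> {a..b}"
      have "p n = b" "p 0 = a" using p by (auto simp: is_partition_def)
      then have "x < p n" using x xab by force
      \<comment> \<open>The first partition point to the right of x closes the cell that contains
        x.\<close>
      define q where "q = (LEAST q. x < p q)"
      have q: "x < p q" "q \<le> n" unfolding q_def using \<open>x < p n\<close> by (auto intro: LeastI Least_le)
      have "q \<noteq> 0" using q(1) \<open>p 0 = a\<close> xab by (intro notI) simp
      then have "\<not> x < p (q - 1)" using not_less_Least[of "q - 1" "\<lambda>q. x < p q"] by (simp add: q_def)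
      moreover have "x \<noteq> p (q - 1)" using x q(2) by auto
      ultimately show "\<exists>q\<in>{1..n}. x \<in> {p (q - 1)<..<p q}"
        using q \<open>q \<noteq> 0\<close> by (intro bexI[of _ q]) auto
    qed
  qed
qed

lemma partition_cell_unique:
  assumes p: "is_partition a b n p" and q: "q \<in> {1..n}" "x \<in> {p (q - 1)<..<p q}"
    and j: "j \<in> {1..n}" "x \<in> {p (j - 1)..p j}"
  shows "j = q"
proof (rule ccontr)
  assume "j \<noteq> q"
  then consider "j \<le> q - 1" | "q \<le> j - 1" by linarith
  then show False
  proof cases
    case 1
    then have "p j \<le> p (q - 1)" using q by (intro partition_le[OF p]) auto
    then show False using q j by auto
  next
    case 2
    then have "p q \<le> p (j - 1)" using j by (intro partition_le[OF p]) auto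
    then show False using q j by auto
  qed
qed

text \<open>\<open>phi\<close> refers to the inverse of the affine cell map abstractly; the explicit
  form makes measurability and the range \<open>{-1..1}\<close> accessible.\<close>

lemma the_inv_cell_map:
  assumes "p (j - 1) < p j" "x \<in> {p (j - 1)..p j}"
  shows "the_inv_into {-1..1} (cell_map p j) x = (2 * x - p (j - 1) - p j) / (p j - p (j - 1))"
    and "(2 * x - p (j - 1) - p j) / (p j - p (j - 1)) \<in> {-1..1}"
proof -
  have map: "cell_map p j t = (p j + p (j - 1)) / 2 + t * ((p j - p (j - 1)) / 2)" for t
    by (simp add: cell_map_def field_simps)
  show mem: "(2 * x - p (j - 1) - p j) / (p j - p (j - 1)) \<in> {-1..1}"
    using assms by (auto simp: field_simps)
  have "inj_on (cell_map p j) {-1..1}"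
    using assms(1) by (auto simp: inj_on_def map)
  moreover have "cell_map p j ((2 * x - p (j - 1) - p j) / (p j - p (j - 1))) = x"
    using assms(1) by (simp add: map field_simps)
  ultimately show "the_inv_into {-1..1} (cell_map p j) x = (2 * x - p (j - 1) - p j) / (p j - p (j - 1))"
    using mem by (intro the_inv_into_f_eq)
qed

lemma cell_map_mem:
  assumes "p (j - 1) \<le> p j" "t \<in> {-1..1}"
  shows "cell_map p j t \<in> {p (j - 1)..p j}"
proof -
  have "cell_map p j t = p (j - 1) + (1 + t) / 2 * (p j - p (j - 1))"
    "cell_map p j t = p j - (1 - t) / 2 * (p j - p (j - 1))"
    by (simp_all add: cell_map_def field_simps)
  moreover have "0 \<le> (1 + t) / 2 * (p j - p (j - 1))" "0 \<le> (1 - t) / 2 * (p j - p (j - 1))"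
    using assms by (auto intro!: mult_nonneg_nonneg)
  ultimately show ?thesis by simp
qed

lemma index_decode:
  assumes "m \<in> {1..n * r}"
  shows "(m - 1) div r + 1 \<in> {1..n}" "(m - 1) mod r + 1 \<in> {1..(r::nat)}"
proof -
  have "r > 0" "m - 1 < n * r" using assms by (auto intro: Nat.gr0I)
  then show "(m - 1) div r + 1 \<in> {1..n}" "(m - 1) mod r + 1 \<in> {1..r}"
    using less_mult_imp_div_less[of "m - 1" n r] by (auto simp: Suc_le_eq)
qed

lemma phi_eq:
  assumes p: "is_partition a b n p" and j: "j \<in> {1..n}"
  shows "phi r \<tau> p i j x = (if x \<in> {p (j - 1)..p j}
    then lagrange r \<tau> i ((2 * x - p (j - 1) - p j) / (p j - p (j - 1))) else 0)"
proof -
  have "p (j - 1) < p j" using p j by (simp add: is_partition_def)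
  then show ?thesis by (simp only: phi_def the_inv_cell_map(1) cong: if_cong)
qed

lemma psi_measurable:
  assumes p: "is_partition a b n p" and m: "m \<in> {1..n * r}"
  shows "psi r \<tau> p m \<in> borel_measurable borel"
proof -
  define i j where "i = (m - 1) mod r + 1" and "j = (m - 1) div r + 1"
  have psi: "psi r \<tau> p m = (\<lambda>x. if x \<in> {p (j - 1)..p j}
      then lagrange r \<tau> i ((2 * x - p (j - 1) - p j) / (p j - p (j - 1))) else 0)"
    unfolding psi_def i_def j_def using phi_eq[OF p index_decode(1)[OF m]] by (intro ext)
  show ?thesis unfolding psi lagrange_def by measurable
qed

text \<open>Inside an open cell only the r basis functions of that cell can be nonzero, and g 0 = 0
  discards the others. The identity for g yields the partition of unity, the absolute value yields
  the Lebesgue function.\<close>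

lemma psi_sum_cell:
  fixes g :: "real \<Rightarrow> real"
  assumes p: "is_partition a b n p" and q: "q \<in> {1..n}" "x \<in> {p (q - 1)<..<p q}" and g: "g 0 = 0"
  shows "(\<Sum>m=1..n * r. g (psi r \<tau> p m x)) =
    (\<Sum>i=1..r. g (lagrange r \<tau> i ((2 * x - p (q - 1) - p q) / (p q - p (q - 1)))))"
proof (cases "r = 0")
  case False
  let ?S = "{m \<in> {1..n * r}. (m - 1) div r + 1 = q}"
  have "(\<Sum>m=1..n * r. g (psi r \<tau> p m x)) = (\<Sum>m\<in>?S. g (psi r \<tau> p m x))"
  proof (rule sum.mono_neutral_right)
    show "\<forall>m\<in>{1..n * r} - ?S. g (psi r \<tau> p m x) = 0"
    proof
      fix m assume m: "m \<in> {1..n * r} - ?S"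
      let ?j = "(m - 1) div r + 1"
      have "?j \<in> {1..n}" "?j \<noteq> q" using m index_decode(1)[of m n r] by auto
      then have "x \<notin> {p (?j - 1)..p ?j}" using partition_cell_unique[OF p q] by blast
      then show "g (psi r \<tau> p m x) = 0" by (simp only: psi_def phi_def if_False g)
    qed
  qed auto
  also have "\<dots> = (\<Sum>i=1..r. g (lagrange r \<tau> i ((2 * x - p (q - 1) - p q) / (p q - p (q - 1)))))"
  \<comment> \<open>Indices start at 1, so position i in cell q is m = (q - 1) * r + i, decoded from
    m - 1.\<close>
  proof (rule sum.reindex_bij_witness[where i = "\<lambda>i. (q - 1) * r + i" and j = "\<lambda>m. (m - 1) mod r + 1"])
    fix m assume m: "m \<in> ?S"
    then have "(m - 1) div r = q - 1" by auto
    then have "m - 1 = (q - 1) * r + (m - 1) mod r" using div_mult_mod_eq[of "m - 1" r] by simp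
    then show "(q - 1) * r + ((m - 1) mod r + 1) = m" using m by auto
    show "(m - 1) mod r + 1 \<in> {1..r}" using m index_decode(2)[of m n r] by auto
    have "(m - 1) div r + 1 = q" using m by auto
    moreover have "x \<in> {p (q - 1)..p q}" using q by auto
    ultimately show "g (lagrange r \<tau> ((m - 1) mod r + 1) ((2 * x - p (q - 1) - p q) / (p q - p (q - 1))))
        = g (psi r \<tau> p m x)"
      unfolding psi_def using phi_eq[OF p q(1)] by simp
  next
    fix i assume i: "i \<in> {1..r}"
    then have eq: "(q - 1) * r + i - 1 = (i - 1) + (q - 1) * r" by auto
    have "i - 1 < r" using i by auto
    then have "((q - 1) * r + i - 1) mod r = i - 1"
      unfolding eq by (simp only: mod_mult_self1 mod_less)
    then show "((q - 1) * r + i - 1) mod r + 1 = i" using i by simp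
    have "(q - 1) * r + i \<le> (q - 1) * r + r" using i by auto
    also have "\<dots> = q * r" using q(1) by (cases q) auto
    also have "\<dots> \<le> n * r" using q(1) by simp
    finally have "(q - 1) * r + i \<le> n * r" .
    moreover have "((q - 1) * r + i - 1) div r = q - 1"
      unfolding eq by (subst div_mult_self1) (use \<open>i - 1 < r\<close> in simp_all)
    then have "((q - 1) * r + i - 1) div r + 1 = q" using q(1) by simp
    ultimately show "(q - 1) * r + i \<in> ?S" using i by simp
  qed
  finally show ?thesis .
qed simp

lemma node_mem_cell:
  assumes p: "is_partition a b n p" and \<tau>: "gauss_points r \<tau>" and m: "m \<in> {1..n * r}"
  shows "node r \<tau> p m \<in> {p ((m - 1) div r)..p ((m - 1) div r + 1)}"
proof -
  have "\<tau> ((m - 1) mod r + 1) \<in> {-1..1}"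
    using \<tau> index_decode(2)[OF m] unfolding gauss_points_def bij_betw_def by blast
  moreover have "p ((m - 1) div r) \<le> p ((m - 1) div r + 1)"
    using partition_le[OF p, of "(m - 1) div r" "(m - 1) div r + 1"] index_decode(1)[OF m] by simp
  ultimately show ?thesis
    using cell_map_mem[of p "(m - 1) div r + 1"] unfolding node_def by simp
qed

text \<open>A basis function is supported on the closed cell of its own node.\<close>

lemma psi_nonzero_node:
  assumes p: "is_partition a b n p" and \<tau>: "gauss_points r \<tau>" and m: "m \<in> {1..n * r}"
    and nz: "psi r \<tau> p m x \<noteq> 0"
  shows "\<bar>x - node r \<tau> p m\<bar> \<le> mesh n p"
proof -
  let ?j = "(m - 1) div r + 1"
  have "x \<in> {p (?j - 1)..p ?j}" using nz by (auto simp: psi_def phi_def split: if_splits)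
  then show ?thesis
    using node_mem_cell[OF p \<tau> m] mesh_ge[OF index_decode(1)[OF m], of p] by auto
qed

lemma node_mem:
  assumes p: "is_partition a b n p" and \<tau>: "gauss_points r \<tau>" and m: "m \<in> {1..n * r}"
  shows "node r \<tau> p m \<in> {a..b}"
  using node_mem_cell[OF assms] partition_mem[OF p, of "(m - 1) div r"]
    partition_mem[OF p, of "(m - 1) div r + 1"] index_decode(1)[OF m] by auto

section \<open>Uniform error of the degenerate kernel and of the step function\<close>

text \<open>Since the Lagrange polynomials sum to one, the error at \<open>(x, u)\<close> is an average of
  differences \<open>k(x, u) - k(t\<^sub>i, t\<^sub>j)\<close> with weights of absolute sum at most \<open>\<Lambda>\<^sup>2\<close>.\<close>

lemma degenerate_kernel_error:
  assumes p: "is_partition a b n p" and \<tau>: "gauss_points r \<tau>" and r: "r \<ge> 1"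
    and \<Lambda>: "\<Lambda> \<ge> 0" "\<And>t. t \<in> {-1..1} \<Longrightarrow> (\<Sum>i=1..r. \<bar>lagrange r \<tau> i t\<bar>) \<le> \<Lambda>"
    and L: "L \<ge> 0" "\<And>x u x' u'. \<lbrakk>x \<in> {a..b}; u \<in> {a..b}; x' \<in> {a..b}; u' \<in> {a..b}\<rbrakk>
      \<Longrightarrow> cmod (k x u - k x' u') \<le> L * (\<bar>x - x'\<bar> + \<bar>u - u'\<bar>)"
    and x: "q \<in> {1..n}" "x \<in> {p (q - 1)<..<p q}" and u: "q' \<in> {1..n}" "u \<in> {p (q' - 1)<..<p q'}"
  shows "cmod (degenerate_kernel r \<tau> n p k x u - k x u) \<le> 2 * L * \<Lambda>\<^sup>2 * mesh n p"
proof -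
  let ?\<psi> = "psi r \<tau> p" and ?t = "node r \<tau> p" and ?I = "{1..n * r}"
  have inj: "inj_on \<tau> {1..r}" using \<tau> by (simp add: gauss_points_def bij_betw_def)
  have sum1: "(\<Sum>m\<in>?I. ?\<psi> m y) = 1" and sumabs: "(\<Sum>m\<in>?I. \<bar>?\<psi> m y\<bar>) \<le> \<Lambda>"
    and mem: "y \<in> {a..b}" if y: "s \<in> {1..n}" "y \<in> {p (s - 1)<..<p s}" for s y
  proof -
    show "(\<Sum>m\<in>?I. ?\<psi> m y) = 1"
      using psi_sum_cell[OF p y, of "\<lambda>w. w"] sum_lagrange[OF inj r] by simp
    have "(2 * y - p (s - 1) - p s) / (p s - p (s - 1)) \<in> {-1..1}"
      using y by (intro the_inv_cell_map(2)) auto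
    then show "(\<Sum>m\<in>?I. \<bar>?\<psi> m y\<bar>) \<le> \<Lambda>"
      using psi_sum_cell[OF p y, of abs] \<Lambda>(2) by simp
    show "y \<in> {a..b}"
      using y partition_mem[OF p, of s] partition_mem[OF p, of "s - 1"] by force
  qed
  have "n \<ge> 1" using x(1) by simp
  note h0 = mesh_nonneg[OF p this]
  \<comment> \<open>The partition of unity in both variables writes k(x, u) as a double sum with the
    weights of the degenerate kernel, so the difference can be taken term by term.\<close>
  have "(\<Sum>i\<in>?I. \<Sum>j\<in>?I. k x u * of_real (?\<psi> i x) * of_real (?\<psi> j u)) =
      k x u * (of_real (\<Sum>i\<in>?I. ?\<psi> i x) * of_real (\<Sum>j\<in>?I. ?\<psi> j u))"
    by (simp only: of_real_sum sum_product) (simp only: sum_distrib_left mult.assoc)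
  then have kxu: "k x u = (\<Sum>i\<in>?I. \<Sum>j\<in>?I. k x u * of_real (?\<psi> i x) * of_real (?\<psi> j u))"
    by (simp only: sum1[OF x] sum1[OF u] of_real_1 mult_1_right)
  have diff: "degenerate_kernel r \<tau> n p k x u - k x u =
      (\<Sum>i\<in>?I. \<Sum>j\<in>?I. (k (?t i) (?t j) - k x u) * of_real (?\<psi> i x) * of_real (?\<psi> j u))"
    by (subst kxu) (simp only: degenerate_kernel_def left_diff_distrib sum_subtractf)
  have le: "cmod (degenerate_kernel r \<tau> n p k x u - k x u)
      \<le> (\<Sum>i\<in>?I. \<Sum>j\<in>?I. 2 * L * mesh n p * (\<bar>?\<psi> i x\<bar> * \<bar>?\<psi> j u\<bar>))"
    unfolding diff
  proof (intro sum_norm_le)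
    fix i j assume ij: "i \<in> ?I" "j \<in> ?I"
    show "cmod ((k (?t i) (?t j) - k x u) * of_real (?\<psi> i x) * of_real (?\<psi> j u))
        \<le> 2 * L * mesh n p * (\<bar>?\<psi> i x\<bar> * \<bar>?\<psi> j u\<bar>)"
    \<comment> \<open>Terms of weight zero vanish. In the others each point shares a closed cell
      with its node, so both distances are at most the mesh, which gives the factor 2 L.\<close>
    proof (cases "?\<psi> i x = 0 \<or> ?\<psi> j u = 0")
      case False
      then have d: "\<bar>?t i - x\<bar> \<le> mesh n p" "\<bar>?t j - u\<bar> \<le> mesh n p"
        using psi_nonzero_node[OF p \<tau> ij(1), of x] psi_nonzero_node[OF p \<tau> ij(2), of u]
        by (auto simp: abs_minus_commute)
      have "cmod (k (?t i) (?t j) - k x u) \<le> L * (\<bar>?t i - x\<bar> + \<bar>?t j - u\<bar>)"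
        by (intro L(2) node_mem[OF p \<tau>] ij mem[OF x] mem[OF u])
      also have "\<dots> \<le> L * (mesh n p + mesh n p)"
        using d L(1) by (intro mult_left_mono) auto
      finally have "cmod (k (?t i) (?t j) - k x u) \<le> 2 * L * mesh n p" by simp
      then show ?thesis
        by (simp add: norm_mult mult.assoc[symmetric] mult_right_mono)
    qed auto
  qed
  have "(\<Sum>i\<in>?I. \<Sum>j\<in>?I. 2 * L * mesh n p * (\<bar>?\<psi> i x\<bar> * \<bar>?\<psi> j u\<bar>)) =
      2 * L * mesh n p * ((\<Sum>i\<in>?I. \<bar>?\<psi> i x\<bar>) * (\<Sum>j\<in>?I. \<bar>?\<psi> j u\<bar>))"
    unfolding sum_product unfolding sum_distrib_left ..
  also have "\<dots> \<le> 2 * L * mesh n p * (\<Lambda> * \<Lambda>)"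
  proof (rule mult_left_mono)
    show "(\<Sum>i\<in>?I. \<bar>?\<psi> i x\<bar>) * (\<Sum>j\<in>?I. \<bar>?\<psi> j u\<bar>) \<le> \<Lambda> * \<Lambda>"
      by (rule mult_mono[OF sumabs[OF x] sumabs[OF u] \<Lambda>(1)]) (rule sum_nonneg, simp)
    show "0 \<le> 2 * L * mesh n p" using L(1) h0 by simp
  qed
  finally have "cmod (degenerate_kernel r \<tau> n p k x u - k x u) \<le> 2 * L * mesh n p * (\<Lambda> * \<Lambda>)"
    by (rule order_trans[OF le])
  then show ?thesis by (simp only: power2_eq_square mult_ac)
qed

text \<open>B may depend on the partition: it serves to make the approximate operator well defined
  and bounded, while the uniform comparison with k is
  \<open>degenerate_kernel_error\<close>.\<close>

lemma degenerate_kernel_bounded: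
  assumes p: "is_partition a b n p"
    and \<Lambda>: "\<Lambda> \<ge> 0" "\<And>t. t \<in> {-1..1} \<Longrightarrow> (\<Sum>i=1..r. \<bar>lagrange r \<tau> i t\<bar>) \<le> \<Lambda>"
  shows "\<exists>B. bounded_kernel a b B (degenerate_kernel r \<tau> n p k)"
proof -
  let ?I = "{1..n * r}" and ?t = "node r \<tau> p"
  define B where "B = (\<Sum>i\<in>?I. \<Sum>j\<in>?I. cmod (k (?t i) (?t j)) * \<Lambda> * \<Lambda>)"
  \<comment> \<open>Valid at every x, partition points included, since on the closed cell of the
    basis function the local coordinate stays in \<open>{-1..1}\<close>.\<close>
  have psi_le: "\<bar>psi r \<tau> p m x\<bar> \<le> \<Lambda>" if m: "m \<in> ?I" for m x
  proof -
    let ?j = "(m - 1) div r + 1" and ?i = "(m - 1) mod r + 1"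
    show ?thesis
    proof (cases "x \<in> {p (?j - 1)..p ?j}")
      case True
      let ?s = "(2 * x - p (?j - 1) - p ?j) / (p ?j - p (?j - 1))"
      have "?s \<in> {-1..1}"
        using partition_less[OF p, of "(m - 1) div r" ?j] index_decode(1)[OF m] True
        by (intro the_inv_cell_map(2)) auto
      then have "(\<Sum>i=1..r. \<bar>lagrange r \<tau> i ?s\<bar>) \<le> \<Lambda>" by (rule \<Lambda>(2))
      moreover have "\<bar>lagrange r \<tau> ?i ?s\<bar> \<le> (\<Sum>i=1..r. \<bar>lagrange r \<tau> i ?s\<bar>)"
        using index_decode(2)[OF m] by (intro member_le_sum) auto
      ultimately show ?thesis
        by (simp only: psi_def phi_eq[OF p index_decode(1)[OF m]] True if_True)
    next
      case False
      then have "psi r \<tau> p m x = 0" by (simp only: psi_def phi_def if_False)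
      then show ?thesis using \<Lambda>(1) by simp
    qed
  qed
  have "bounded_kernel a b B (degenerate_kernel r \<tau> n p k)"
    unfolding bounded_kernel_def
  proof (intro conjI ballI)
    show "0 \<le> B" unfolding B_def using \<Lambda>(1) by (intro sum_nonneg) auto
    have [measurable]: "psi r \<tau> p m \<in> borel_measurable borel" if "m \<in> ?I" for m
      by (rule psi_measurable[OF p that])
    have "(\<lambda>(x, u). degenerate_kernel r \<tau> n p k x u) \<in> borel_measurable (borel \<Otimes>\<^sub>M borel)"
      unfolding degenerate_kernel_def by measurable
    then have "(\<lambda>(x, u). if x \<in> {a..b} \<and> u \<in> {a..b} then degenerate_kernel r \<tau> n p k x u else 0)
        \<in> borel_measurable (borel \<Otimes>\<^sub>M borel)"
      by measurable
    then show "(\<lambda>(x, u). if x \<in> {a..b} \<and> u \<in> {a..b} then degenerate_kernel r \<tau> n p k x u else 0)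
        \<in> borel_measurable borel"
      by (simp add: borel_prod)
    show "cmod (degenerate_kernel r \<tau> n p k x u) \<le> B" for x u
      unfolding degenerate_kernel_def B_def
      by (intro sum_norm_le)
        (auto simp: norm_mult psi_le \<Lambda>(1) intro!: mult_mono)
  qed
  then show ?thesis by blast
qed

lemma step_fun_cell:
  assumes p: "is_partition a b n p" and q: "q \<in> {1..n}" "x \<in> {p (q - 1)<..<p q}"
  shows "step_fun n p x = ((p (q - 1) + p q) / 2)\<^sup>2"
proof -
  have "indicator {p (i - 1)<..p i} x = (if i = q then 1 else 0 :: real)" if "i \<in> {1..n}" for i
  proof (cases "i = q")
    case False
    then have "x \<notin> {p (i - 1)..p i}" using partition_cell_unique[OF p q that] by blast
    then have "x \<notin> {p (i - 1)<..p i}" by auto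
    then show ?thesis using False by simp
  qed (use q in simp)
  then have "step_fun n p x = (\<Sum>i=1..n. if i = q then ((p (i - 1) + p i) / 2)\<^sup>2 else 0)"
    unfolding step_fun_def by (intro sum.cong) auto
  then show ?thesis using q(1) by simp
qed

text \<open>With c the midpoint, |c^2 - x^2| = |c + x| |c - x|: the first factor is bounded on
  [a, b] and the second is at most the mesh.\<close>

lemma step_fun_error:
  assumes p: "is_partition a b n p" and q: "q \<in> {1..n}" "x \<in> {p (q - 1)<..<p q}"
  shows "\<bar>step_fun n p x - x\<^sup>2\<bar> \<le> 2 * (\<bar>a\<bar> + \<bar>b\<bar>) * mesh n p"
proof -
  define c where "c = (p (q - 1) + p q) / 2"
  have h: "p q - p (q - 1) \<le> mesh n p" by (rule mesh_ge[OF q(1)])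
  have mem: "p (q - 1) \<in> {a..b}" "p q \<in> {a..b}"
    using partition_mem[OF p, of "q - 1"] partition_mem[OF p, of q] q(1) by force+
  have "\<bar>step_fun n p x - x\<^sup>2\<bar> = \<bar>c + x\<bar> * \<bar>c - x\<bar>"
    by (simp only: step_fun_cell[OF p q] c_def[symmetric]) (simp add: abs_mult[symmetric] power2_eq_square algebra_simps)
  also have "\<dots> \<le> (2 * (\<bar>a\<bar> + \<bar>b\<bar>)) * mesh n p"
  proof (rule mult_mono)
    have c: "c \<in> {p (q - 1)..p q}" using q(2) by (simp add: c_def)
    then have "c \<in> {a..b}" "x \<in> {a..b}" using q(2) mem by auto
    then have "\<bar>c\<bar> + \<bar>x\<bar> \<le> (\<bar>a\<bar> + \<bar>b\<bar>) + (\<bar>a\<bar> + \<bar>b\<bar>)" by (intro add_mono) auto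
    then show "\<bar>c + x\<bar> \<le> 2 * (\<bar>a\<bar> + \<bar>b\<bar>)" by (simp add: order_trans[OF abs_triangle_ineq])
    show "\<bar>c - x\<bar> \<le> mesh n p"
      using c q(2) h unfolding abs_le_iff by auto
  qed auto
  finally show ?thesis .
qed

lemma step_fun_bounded: "\<exists>S. bounded_multiplier a b S (step_fun n p)"
proof (intro exI)
  show "bounded_multiplier a b (\<Sum>i=1..n. ((p (i - 1) + p i) / 2)\<^sup>2) (step_fun n p)"
    unfolding bounded_multiplier_def
  proof (intro conjI ballI)
    show "0 \<le> (\<Sum>i=1..n. ((p (i - 1) + p i) / 2)\<^sup>2)" by (intro sum_nonneg) simp
    show "step_fun n p \<in> borel_measurable borel" unfolding step_fun_def[abs_def] by measurable
    show "\<bar>step_fun n p x\<bar> \<le> (\<Sum>i=1..n. ((p (i - 1) + p i) / 2)\<^sup>2)" for x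
      unfolding step_fun_def
      by (rule order_trans[OF sum_abs], rule sum_mono) (auto simp: indicator_def)
  qed
qed

section \<open>Operator norm error of the approximation\<close>

lemma square_bounded_multiplier: "bounded_multiplier a b ((\<bar>a\<bar> + \<bar>b\<bar>)\<^sup>2) (\<lambda>x. x\<^sup>2)"
  unfolding bounded_multiplier_def
proof (intro conjI ballI)
  show "\<bar>x\<^sup>2\<bar> \<le> (\<bar>a\<bar> + \<bar>b\<bar>)\<^sup>2" if "x \<in> {a..b}" for x
    using that abs_le_square_iff[of x "\<bar>a\<bar> + \<bar>b\<bar>"] by auto
qed auto

lemma A_op_BL:
  assumes "bounded_kernel a b B k" "a \<le> b"
  shows "A_op a b \<alpha> k \<in> BL (Linf a b)"
proof -
  have "(\<lambda>f. integral_op a b \<alpha> k f - mult_op a b (\<lambda>x. x\<^sup>2) f) \<in> BL (Linf a b)"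
    by (intro Linf.BL_minus integral_op_BL[OF assms] mult_op_BL[OF square_bounded_multiplier])
  then show ?thesis by (simp add: A_op_def[abs_def])
qed

lemma A_approx_BL:
  assumes p: "is_partition a b n p" and "a \<le> b"
  shows "A_approx a b \<alpha> r \<tau> n p k \<in> BL (Linf a b)"
proof -
  obtain \<Lambda> where "\<Lambda> \<ge> 0" "\<And>t. t \<in> {-1..1} \<Longrightarrow> (\<Sum>i=1..r. \<bar>lagrange r \<tau> i t\<bar>) \<le> \<Lambda>"
    using lagrange_bounded[of r \<tau>] by blast
  then obtain B where B: "bounded_kernel a b B (degenerate_kernel r \<tau> n p k)"
    using degenerate_kernel_bounded[OF p] by blast
  obtain S where S: "bounded_multiplier a b S (step_fun n p)"
    using step_fun_bounded by blast
  have "(\<lambda>f. integral_op a b \<alpha> (degenerate_kernel r \<tau> n p k) f - mult_op a b (step_fun n p) f) \<in> BL (Linf a b)"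
    by (intro Linf.BL_minus integral_op_BL[OF B \<open>a \<le> b\<close>] mult_op_BL[OF S])
  then show ?thesis by (simp add: A_approx_def[abs_def])
qed

text \<open>The constant is fixed before n and the partition: the kernel contributes 2 L \<Lambda>^2
  times the norm factor |\<alpha>| (b - a), the multiplier contributes 2 (|a| + |b|).\<close>

lemma A_approx_error:
  assumes ab: "a \<le> b" and r: "r \<ge> 1" and k: "C_on_square r a b k" and \<tau>: "gauss_points r \<tau>"
  obtains C where "C \<ge> 0" "\<And>n p F. is_partition a b n p \<Longrightarrow> n \<ge> 1 \<Longrightarrow>
    norm (A_approx a b \<alpha> r \<tau> n p k F - A_op a b \<alpha> k F) \<le> C * mesh n p * norm F"
proof -
  obtain \<Lambda> where \<Lambda>: "\<Lambda> \<ge> 0" "\<And>t. t \<in> {-1..1} \<Longrightarrow> (\<Sum>i=1..r. \<bar>lagrange r \<tau> i t\<bar>) \<le> \<Lambda>"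
    using lagrange_bounded[of r \<tau>] by blast
  have "C_on_square (Suc (r - 1)) a b k" using k r by simp
  then obtain L where L: "L \<ge> 0" "\<And>x u x' u'. \<lbrakk>x \<in> {a..b}; u \<in> {a..b}; x' \<in> {a..b}; u' \<in> {a..b}\<rbrakk>
      \<Longrightarrow> cmod (k x u - k x' u') \<le> L * (\<bar>x - x'\<bar> + \<bar>u - u'\<bar>)"
    using C1_on_square_lipschitz by blast
  obtain B where B: "bounded_kernel a b B k"
    using continuous_bounded_kernel[OF C_on_square_continuous[OF k]] by blast
  let ?C = "\<bar>\<alpha>\<bar> * (b - a) * (2 * L * \<Lambda>\<^sup>2) + 2 * (\<bar>a\<bar> + \<bar>b\<bar>)"
  show thesis
  proof (rule that[of ?C])
    show "?C \<ge> 0" using ab L(1) by simp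
    fix n p and F :: linf assume p: "is_partition a b n p" and n: "n \<ge> 1"
    note h0 = mesh_nonneg[OF p n]
    let ?k = "degenerate_kernel r \<tau> n p k"
    obtain B' where B': "bounded_kernel a b B' ?k"
      using degenerate_kernel_bounded[OF p \<Lambda>] by blast
    obtain S where S: "bounded_multiplier a b S (step_fun n p)"
      using step_fun_bounded by blast
    have "norm (integral_op a b \<alpha> ?k F - integral_op a b \<alpha> k F)
        \<le> \<bar>\<alpha>\<bar> * (b - a) * (2 * L * \<Lambda>\<^sup>2 * mesh n p) * norm F"
    proof (rule integral_op_diff_le[OF B' B ab])
      show "0 \<le> 2 * L * \<Lambda>\<^sup>2 * mesh n p" using L(1) h0 by simp
      note cells = partition_cell_AE[OF p]
      show "AE x in lebesgue. x \<in> {a..b} \<longrightarrow>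
          (AE u in lebesgue. u \<in> {a..b} \<longrightarrow> cmod (?k x u - k x u) \<le> 2 * L * \<Lambda>\<^sup>2 * mesh n p)"
        using cells
      proof eventually_elim
        fix x assume x: "x \<in> {a..b} \<longrightarrow> (\<exists>q\<in>{1..n}. x \<in> {p (q - 1)<..<p q})"
        show "x \<in> {a..b} \<longrightarrow>
          (AE u in lebesgue. u \<in> {a..b} \<longrightarrow> cmod (?k x u - k x u) \<le> 2 * L * \<Lambda>\<^sup>2 * mesh n p)"
        proof
          assume "x \<in> {a..b}"
          with x obtain q where q: "q \<in> {1..n}" "x \<in> {p (q - 1)<..<p q}" by blast
          show "AE u in lebesgue. u \<in> {a..b} \<longrightarrow> cmod (?k x u - k x u) \<le> 2 * L * \<Lambda>\<^sup>2 * mesh n p"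
            using cells
            by eventually_elim (use degenerate_kernel_error[OF p \<tau> r \<Lambda> L q] in blast)
        qed
      qed
    qed
    moreover have "norm (mult_op a b (step_fun n p) F - mult_op a b (\<lambda>x. x\<^sup>2) F)
        \<le> (2 * (\<bar>a\<bar> + \<bar>b\<bar>) * mesh n p) * norm F"
    proof (rule mult_op_diff_le[OF S square_bounded_multiplier])
      show "0 \<le> 2 * (\<bar>a\<bar> + \<bar>b\<bar>) * mesh n p" using h0 by simp
      show "AE x in lebesgue. x \<in> {a..b} \<longrightarrow> \<bar>step_fun n p x - x\<^sup>2\<bar> \<le> 2 * (\<bar>a\<bar> + \<bar>b\<bar>) * mesh n p"
        using partition_cell_AE[OF p] by eventually_elim (use step_fun_error[OF p] in blast)
    qed
    moreover have diff: "A_approx a b \<alpha> r \<tau> n p k F - A_op a b \<alpha> k F =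
        (integral_op a b \<alpha> ?k F - integral_op a b \<alpha> k F) -
        (mult_op a b (step_fun n p) F - mult_op a b (\<lambda>x. x\<^sup>2) F)"
      by (simp add: A_approx_def A_op_def)
    ultimately have "norm (A_approx a b \<alpha> r \<tau> n p k F - A_op a b \<alpha> k F)
        \<le> \<bar>\<alpha>\<bar> * (b - a) * (2 * L * \<Lambda>\<^sup>2 * mesh n p) * norm F + (2 * (\<bar>a\<bar> + \<bar>b\<bar>) * mesh n p) * norm F"
      unfolding diff using norm_triangle_ineq4[of "integral_op a b \<alpha> ?k F - integral_op a b \<alpha> k F"
          "mult_op a b (step_fun n p) F - mult_op a b (\<lambda>x. x\<^sup>2) F"] by linarith
    then show "norm (A_approx a b \<alpha> r \<tau> n p k F - A_op a b \<alpha> k F) \<le> ?C * mesh n p * norm F"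
      by (simp add: algebra_simps)
  qed
qed

section \<open>Isolated eigenvalues\<close>

text \<open>Almost everywhere on [a, b], dividing by s + z costs at most the factor 1 / d.\<close>

lemma mult_op_shift_lower_bound:
  assumes s: "bounded_multiplier a b S s" and F: "F \<in> Linf a b" and "d > 0"
    and d: "\<And>x. x \<in> {a..b} \<Longrightarrow> d \<le> cmod (of_real (s x) + z)"
  shows "d * norm F \<le> norm (mult_op a b s F + z *\<^sub>C F)"
proof -
  let ?G = "mult_op a b s F + z *\<^sub>C F"
  have "norm F \<le> norm ?G / d"
  proof (rule norm_linf_le)
    show "AE x in lebesgue. cmod (rep_linf F x) \<le> norm ?G / d"
      using rep_add_linf_AE[of "mult_op a b s F" "z *\<^sub>C F"] rep_mult_op_AE[OF s, of F]
        rep_scaleC_linf_AE[of z F] rep_linf_norm_AE[of ?G] Linf_AE[OF F]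
    proof eventually_elim
      case (elim x)
      show ?case
      proof (cases "x \<in> {a..b}")
        case True
        have "d * cmod (rep_linf F x) \<le> cmod (of_real (s x) + z) * cmod (rep_linf F x)"
          by (intro mult_right_mono d True) simp
        also have "\<dots> = cmod (rep_linf ?G x)"
          using elim True by (simp add: distrib_right flip: norm_mult)
        also have "\<dots> \<le> norm ?G" by (rule elim)
        finally show ?thesis using \<open>d > 0\<close> by (simp add: field_simps)
      next
        case False
        then have "rep_linf F x = 0" using elim by blast
        then show ?thesis using \<open>d > 0\<close> by simp
      qed
    qed
  qed (use \<open>d > 0\<close> in simp)
  then show ?thesis using \<open>d > 0\<close> by (simp add: field_simps)
qed

text \<open>Arzela-Ascoli for the continuous representatives \<Phi> n: they are uniformly bounded,
  and equicontinuous because k is uniformly continuous on the square. Uniform convergence of a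
  subsequence gives the Cauchy property in the essential supremum norm.\<close>

lemma integral_op_compact:
  assumes ab: "a \<le> b" and cont: "continuous_on ({a..b} \<times> {a..b}) (\<lambda>(x, u). k x u)"
    and F: "\<And>n. norm (F n) \<le> D"
  obtains s where "strict_mono (s :: nat \<Rightarrow> nat)" "Cauchy (\<lambda>n. integral_op a b \<alpha> k (F (s n)))"
proof -
  obtain B where B: "bounded_kernel a b B k" using continuous_bounded_kernel[OF cont] by blast
  have D: "D \<ge> 0" using F[of 0] norm_ge_zero order_trans by blast
  define \<Phi> where "\<Phi> n x = of_real \<alpha> * (LINT u:{a..b}|lebesgue. k x u * rep_linf (F n) u)" for n x
  have diff: "cmod (\<Phi> n x - \<Phi> n y) \<le> \<bar>\<alpha>\<bar> * (e * D * (b - a))"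
    if xy: "x \<in> {a..b}" "y \<in> {a..b}" and e: "0 \<le> e" "\<And>u. u \<in> {a..b} \<Longrightarrow> cmod (k x u - k y u) \<le> e" for n x y e
  proof -
    have "\<Phi> n x - \<Phi> n y =
        of_real \<alpha> * (LINT u:{a..b}|lebesgue. k x u * rep_linf (F n) u - k y u * rep_linf (F n) u)"
      unfolding \<Phi>_def
      by (subst set_integral_diff(2)) (intro bounded_kernel_integrable[OF B] ess_bounded_rep_linf xy
          | simp add: right_diff_distrib)+
    also have "cmod \<dots> = \<bar>\<alpha>\<bar> * cmod (LINT u:{a..b}|lebesgue. k x u * rep_linf (F n) u - k y u * rep_linf (F n) u)"
      by (simp add: norm_mult)
    also have "\<dots> \<le> \<bar>\<alpha>\<bar> * (e * D * (b - a))"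
    proof (intro mult_left_mono set_integral_norm_le ab)
      show "AE u in lebesgue. u \<in> {a..b} \<longrightarrow>
          cmod (k x u * rep_linf (F n) u - k y u * rep_linf (F n) u) \<le> e * D"
        using rep_linf_norm_AE[of "F n"]
      proof eventually_elim
        fix u assume "cmod (rep_linf (F n) u) \<le> norm (F n)"
        then have "cmod (rep_linf (F n) u) \<le> D" using F[of n] by (rule order_trans)
        then have "u \<in> {a..b} \<Longrightarrow> cmod (k x u - k y u) * cmod (rep_linf (F n) u) \<le> e * D"
          using e by (intro mult_mono) auto
        then show "u \<in> {a..b} \<longrightarrow>
            cmod (k x u * rep_linf (F n) u - k y u * rep_linf (F n) u) \<le> e * D"
          by (simp only: left_diff_distrib[symmetric] norm_mult) blast
      qed
    qed (use e D in auto)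
    finally show ?thesis .
  qed
  obtain g s where s: "strict_mono (s :: nat \<Rightarrow> nat)"
    and unif: "\<And>e. 0 < e \<Longrightarrow> \<exists>N. \<forall>n x. n \<ge> N \<and> x \<in> {a..b} \<longrightarrow> norm (\<Phi> (s n) x - g x) < e"
  proof (rule Arzela_Ascoli[of "{a..b}" \<Phi> "\<bar>\<alpha>\<bar> * (B * D * (b - a))"])
    show "norm (\<Phi> n x) \<le> \<bar>\<alpha>\<bar> * (B * D * (b - a))" if "x \<in> {a..b}" for n x
    proof -
      have "cmod (LINT u:{a..b}|lebesgue. k x u * rep_linf (F n) u) \<le> B * norm (F n) * (b - a)"
        by (rule bounded_kernel_integral_le[OF B ab that])
      also have "\<dots> \<le> B * D * (b - a)"
        using B F[of n] ab by (intro mult_right_mono mult_left_mono) (auto simp: bounded_kernel_def)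
      finally show ?thesis by (simp add: \<Phi>_def norm_mult mult_left_mono)
    qed
    show "\<exists>d>0. \<forall>n y. y \<in> {a..b} \<and> norm (x - y) < d \<longrightarrow> norm (\<Phi> n x - \<Phi> n y) < e"
      if x: "x \<in> {a..b}" and e: "0 < e" for x e
    proof -
      \<comment> \<open>The summand 1 avoids division by zero and makes the final inequality
        strict.\<close>
      define e' where "e' = e / (\<bar>\<alpha>\<bar> * D * (b - a) + 1)"
      have pos: "\<bar>\<alpha>\<bar> * D * (b - a) + 1 > 0" using D ab by (intro add_nonneg_pos mult_nonneg_nonneg) auto
      then have e': "e' > 0" using e by (simp add: e'_def)
      have "uniformly_continuous_on ({a..b} \<times> {a..b}) (\<lambda>(x, u). k x u)"
        by (intro compact_uniformly_continuous cont compact_Times compact_Icc)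
      then obtain d where d: "d > 0" "\<And>p q. p \<in> {a..b} \<times> {a..b} \<Longrightarrow> q \<in> {a..b} \<times> {a..b} \<Longrightarrow> dist q p < d
          \<Longrightarrow> dist (case q of (x, u) \<Rightarrow> k x u) (case p of (x, u) \<Rightarrow> k x u) < e'"
        using e' unfolding uniformly_continuous_on_def by meson
      have "norm (\<Phi> n x - \<Phi> n y) < e" if y: "y \<in> {a..b}" "norm (x - y) < d" for n y
      proof -
        have "cmod (k x u - k y u) \<le> e'" if "u \<in> {a..b}" for u
          using d(2)[of "(y, u)" "(x, u)"] x y that by (simp add: dist_Pair_Pair dist_norm)
        then have "cmod (\<Phi> n x - \<Phi> n y) \<le> \<bar>\<alpha>\<bar> * (e' * D * (b - a))"
          using diff[OF x y(1)] e' by simp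
        also have "\<dots> < e' * (\<bar>\<alpha>\<bar> * D * (b - a) + 1)"
          using e' by (simp add: algebra_simps)
        also have "\<dots> = e" using pos by (simp add: e'_def)
        finally show ?thesis .
      qed
      then show ?thesis using d(1) by blast
    qed
  qed auto
  have "Cauchy (\<lambda>n. integral_op a b \<alpha> k (F (s n)))"
    unfolding Cauchy_iff
  proof (intro allI impI)
    fix e :: real assume "e > 0"
    then obtain N where N: "\<And>n x. n \<ge> N \<Longrightarrow> x \<in> {a..b} \<Longrightarrow> norm (\<Phi> (s n) x - g x) < e / 4"
      using unif[of "e / 4"] by auto
    have "norm (integral_op a b \<alpha> k (F (s m)) - integral_op a b \<alpha> k (F (s n))) < e"
      if mn: "m \<ge> N" "n \<ge> N" for m n
    proof -
      have close: "cmod (\<Phi> (s m) x - \<Phi> (s n) x) \<le> e / 2" if "x \<in> {a..b}" for x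
        using norm_triangle_ineq4[of "\<Phi> (s m) x - g x" "\<Phi> (s n) x - g x"] N[OF mn(1) that] N[OF mn(2) that]
        by simp
      have "norm (integral_op a b \<alpha> k (F (s m)) - integral_op a b \<alpha> k (F (s n))) \<le> e / 2"
      proof (rule norm_linf_le)
        show "AE x in lebesgue. cmod (rep_linf (integral_op a b \<alpha> k (F (s m)) - integral_op a b \<alpha> k (F (s n))) x) \<le> e / 2"
          using rep_diff_linf_AE[of "integral_op a b \<alpha> k (F (s m))" "integral_op a b \<alpha> k (F (s n))"]
            rep_integral_op_AE[OF B ab, of \<alpha> "F (s m)"] rep_integral_op_AE[OF B ab, of \<alpha> "F (s n)"]
        proof eventually_elim
          case (elim x)
          show ?case
          proof (cases "x \<in> {a..b}")
            case True
            then show ?thesis using elim close[OF True] unfolding \<Phi>_def by simp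
          next
            case False
            then show ?thesis using elim \<open>e > 0\<close> by (simp del: atLeastAtMost_iff)
          qed
        qed
      qed (use \<open>e > 0\<close> in simp)
      then show ?thesis using \<open>e > 0\<close> by simp
    qed
    then show "\<exists>M. \<forall>m\<ge>M. \<forall>n\<ge>M. norm (integral_op a b \<alpha> k (F (s m)) - integral_op a b \<alpha> k (F (s n))) < e"
      by blast
  qed
  then show thesis using s that by blast
qed

text \<open>Multiplication by x^2 + z is the integral operator minus the shifted operator, and it is
  bounded below by d. So a sequence is Cauchy as soon as its images under both are.\<close>

lemma A_op_shift_proper:
  assumes ab: "a \<le> b" and cont: "continuous_on ({a..b} \<times> {a..b}) (\<lambda>(x, u). k x u)" and "d > 0"
    and d: "\<And>x. x \<in> {a..b} \<Longrightarrow> d \<le> cmod (of_real (x\<^sup>2) + z)"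
  shows "Linf.proper_on_bounded a b (\<lambda>f. A_op a b \<alpha> k f - z *\<^sub>C f)"
  unfolding Linf.proper_on_bounded_def
proof (intro allI impI, elim conjE)
  fix F :: "nat \<Rightarrow> linf"
  let ?K = "integral_op a b \<alpha> k" and ?M = "mult_op a b (\<lambda>x. x\<^sup>2)"
  let ?T = "\<lambda>f. A_op a b \<alpha> k f - z *\<^sub>C f"
  assume F: "\<forall>n. F n \<in> Linf a b" and bdd: "bounded (range F)" and cauchy: "Cauchy (\<lambda>n. ?T (F n))"
  obtain D where "\<And>n. norm (F n) \<le> D" using bdd by (auto simp: bounded_iff)
  then obtain s where s: "strict_mono (s :: nat \<Rightarrow> nat)" "Cauchy (\<lambda>n. ?K (F (s n)))"
    using integral_op_compact[OF ab cont, of F D \<alpha>] by blast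
  note M = mult_op_BL[OF square_bounded_multiplier[of a b]]
  have le: "d * norm (F i - F j) \<le> norm (?K (F i) - ?K (F j)) + norm (?T (F i) - ?T (F j))" for i j
  proof -
    have mem: "F i \<in> Linf a b" "F j \<in> Linf a b" using F by auto
    have "d * norm (F i - F j) \<le> norm (?M (F i - F j) + z *\<^sub>C (F i - F j))"
      by (rule mult_op_shift_lower_bound[OF square_bounded_multiplier Linf.diff_mem[OF mem] \<open>d > 0\<close> d])
    also have "?M (F i - F j) + z *\<^sub>C (F i - F j) = (?K (F i) - ?K (F j)) - (?T (F i) - ?T (F j))"
      by (simp add: A_op_def Linf.BL_diff[OF M mem] scaleC_algebra)
    finally show ?thesis using norm_triangle_ineq4 order_trans by blast
  qed
  have "Cauchy (\<lambda>n. F (s n))"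
    unfolding Cauchy_iff
  proof (intro allI impI)
    fix e :: real assume "e > 0"
    then have de: "d * e / 2 > 0" using \<open>d > 0\<close> by simp
    obtain N1 where N1: "\<And>m n. m \<ge> N1 \<Longrightarrow> n \<ge> N1 \<Longrightarrow> norm (?K (F (s m)) - ?K (F (s n))) < d * e / 2"
      using s(2) de unfolding Cauchy_iff by meson
    obtain N2 where N2: "\<And>m n. m \<ge> N2 \<Longrightarrow> n \<ge> N2 \<Longrightarrow> norm (?T (F m) - ?T (F n)) < d * e / 2"
      using cauchy de unfolding Cauchy_iff by meson
    show "\<exists>M. \<forall>m\<ge>M. \<forall>n\<ge>M. norm (F (s m) - F (s n)) < e"
    proof (intro exI[of _ "max N1 N2"] allI impI)
      fix m n assume mn: "m \<ge> max N1 N2" "n \<ge> max N1 N2"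
      \<comment> \<open>s m \<ge> m, so the Cauchy index of the full sequence of images also serves
        the subsequence.\<close>
      then have "s m \<ge> N2" "s n \<ge> N2"
        using strict_mono_imp_increasing[OF s(1), of m] strict_mono_imp_increasing[OF s(1), of n] by auto
      then have "d * norm (F (s m) - F (s n)) < d * e"
        using le[of "s m" "s n"] N1[of m n] N2[of "s m" "s n"] mn by simp
      then show "norm (F (s m) - F (s n)) < e" using \<open>d > 0\<close> by simp
    qed
  qed
  moreover have "\<forall>n. F (s n) \<in> Linf a b" using F by simp
  ultimately have "\<exists>l\<in>Linf a b. (\<lambda>n. F (s n)) \<longlonglongrightarrow> l"
    using complete_Linf[of a b, unfolded complete_def, THEN spec, of "\<lambda>n. F (s n)"] by simp
  then show "\<exists>l\<in>Linf a b. \<exists>s. strict_mono (s :: nat \<Rightarrow> nat) \<and> (\<lambda>n. F (s n)) \<longlonglongrightarrow> l"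
    using s(1) by (elim bexE) (intro bexI exI[of _ s] conjI)
qed

text \<open>Indicators of intervals shrinking to \<open>x0\<close> are approximate eigenvectors: the integral operator
  sends them to zero and multiplication by \<open>x\<^sup>2 - x0\<^sup>2\<close> is small on them.\<close>

lemma multiplier_range_in_spectrum:
  assumes B: "bounded_kernel a b B k" and x0: "x0 \<in> {a<..<b}"
  shows "of_real (- (x0\<^sup>2)) \<in> spectrum (Linf a b) (A_op a b \<alpha> k)"
proof (rule ccontr)
  let ?z = "complex_of_real (- (x0\<^sup>2))" and ?A = "A_op a b \<alpha> k"
  have ab: "a \<le> b" using x0 by simp
  assume "?z \<notin> spectrum (Linf a b) ?A"
  then have "?z \<in> resolvent_set (Linf a b) ?A" by (simp add: spectrum_def)
  then obtain c where c: "c > 0" "Linf.boundedly_invertible a b (\<lambda>f. ?A f - ?z *\<^sub>C f) c"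
    using Linf.resolvent_set_boundedly_invertible[OF A_op_BL[OF B ab]] by blast
  have lower: "c * norm f \<le> norm (?A f - ?z *\<^sub>C f)" if "f \<in> Linf a b" for f
    using c(2) that by (auto simp: Linf.boundedly_invertible_def)
  \<comment> \<open>|\<alpha>| B comes from integrating over an interval of length \<delta>, and 2
    (|a| + |b|) bounds |x + x0| in x^2 - x0^2 = (x - x0)(x + x0).\<close>
  let ?C = "\<bar>\<alpha>\<bar> * B + 2 * (\<bar>a\<bar> + \<bar>b\<bar>)"
  have B0: "B \<ge> 0" using B by (simp add: bounded_kernel_def)
  have small: "c \<le> \<delta> * ?C" if \<delta>: "0 < \<delta>" "\<delta> < b - x0" for \<delta>
  proof -
    let ?J = "{x0..x0 + \<delta>}"
    have J: "?J \<subseteq> {a..b}" using x0 \<delta> by auto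
    define f where "f = linf_class a b (indicator ?J)"
    have ind: "(if x \<in> {a..b} then indicator ?J x else 0) = (indicator ?J x :: complex)" for x
      using J by (auto simp: indicator_def)
    have "ess_bounded (indicator ?J)"
      unfolding ess_bounded_def
    proof
      show "indicator ?J \<in> borel_measurable lebesgue" by (intro borel_measurable_indicator) simp
    qed (intro exI[of _ 1] AE_I2, simp add: indicator_def)
    then have "ess_bounded (\<lambda>x. if x \<in> {a..b} then indicator ?J x else 0)"
      by (simp only: ind)
    note f_class = linf_class_mem[OF this, folded f_def] rep_linf_class_AE[OF this, folded f_def]
    have f: "f \<in> Linf a b" by (rule f_class)
    have rep: "AE x in lebesgue. rep_linf f x = indicator ?J x"
      using f_class(2) by (simp only: ind)
    \<comment> \<open>The interval has positive measure, so the essential supremum cannot miss the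
      value 1.\<close>
    have "norm f \<ge> 1"
    proof (rule ccontr)
      assume "\<not> norm f \<ge> 1"
      have "AE x in lebesgue. x \<notin> ?J"
        using rep rep_linf_norm_AE[of f]
        by eventually_elim (use \<open>\<not> norm f \<ge> 1\<close> in \<open>auto simp: indicator_def split: if_splits\<close>)
      then have "?J \<in> null_sets lebesgue" using AE_iff_null_sets[of ?J lebesgue] by simp
      then show False using \<delta>(1) by (auto dest!: null_setsD1)
    qed
    have "norm (?A f - ?z *\<^sub>C f) \<le> \<delta> * ?C"
    proof (rule norm_linf_le)
      show "0 \<le> \<delta> * ?C" using \<delta>(1) B0 by simp
      have int: "cmod (LINT u:{a..b}|lebesgue. k x u * rep_linf f u) \<le> B * (x0 + \<delta> - x0)"
        if x: "x \<in> {a..b}" for x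
      proof (rule set_integral_norm_le_subinterval)
        show "AE u in lebesgue. u \<in> {a..b} \<longrightarrow> cmod (k x u * rep_linf f u) \<le> B * indicator ?J u"
          using rep
          by eventually_elim (use B x in \<open>auto simp: norm_mult indicator_def bounded_kernel_def\<close>)
      qed (use \<delta> B0 in auto)
      show "AE x in lebesgue. cmod (rep_linf (?A f - ?z *\<^sub>C f) x) \<le> \<delta> * ?C"
        using rep rep_diff_linf_AE[of "?A f" "?z *\<^sub>C f"] rep_scaleC_linf_AE[of ?z f]
          rep_diff_linf_AE[of "integral_op a b \<alpha> k f" "mult_op a b (\<lambda>x. x\<^sup>2) f", folded A_op_def]
          rep_integral_op_AE[OF B ab, of \<alpha> f] rep_mult_op_AE[OF square_bounded_multiplier[of a b], of f]
      proof eventually_elim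
        case (elim x)
        show ?case
        proof (cases "x \<in> {a..b}")
          case True
          let ?I = "LINT u:{a..b}|lebesgue. k x u * rep_linf f u"
          have "rep_linf (?A f - ?z *\<^sub>C f) x = of_real \<alpha> * ?I - of_real ((x\<^sup>2 - x0\<^sup>2) * indicator ?J x)"
          proof -
            have "rep_linf (?A f - ?z *\<^sub>C f) x =
                of_real \<alpha> * ?I - of_real (x\<^sup>2) * indicator ?J x - ?z * indicator ?J x"
              by (simp only: elim True if_True)
            also have "\<dots> = of_real \<alpha> * ?I - of_real ((x\<^sup>2 - x0\<^sup>2) * indicator ?J x)"
              by (cases "x \<in> ?J") (simp_all only: indicator_simps, simp_all)
            finally show ?thesis .
          qed
          then have "cmod (rep_linf (?A f - ?z *\<^sub>C f) x) \<le> cmod (of_real \<alpha> * ?I) + \<bar>(x\<^sup>2 - x0\<^sup>2) * indicator ?J x\<bar>"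
            by (metis norm_of_real norm_triangle_ineq4)
          also have "cmod (of_real \<alpha> * ?I) \<le> \<bar>\<alpha>\<bar> * (B * \<delta>)"
            using int[OF True] by (simp add: norm_mult mult_left_mono)
          also have "\<bar>(x\<^sup>2 - x0\<^sup>2) * indicator ?J x\<bar> \<le> \<delta> * (2 * (\<bar>a\<bar> + \<bar>b\<bar>))"
          proof (cases "x \<in> ?J")
            case J: True
            have "\<bar>x\<^sup>2 - x0\<^sup>2\<bar> = \<bar>x - x0\<bar> * \<bar>x + x0\<bar>"
              by (simp add: power2_eq_square square_diff_square_factored abs_mult mult.commute)
            also have "\<dots> \<le> \<delta> * (2 * (\<bar>a\<bar> + \<bar>b\<bar>))"
            proof (rule mult_mono)
              show "\<bar>x - x0\<bar> \<le> \<delta>" using J by auto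
              have "\<bar>x\<bar> + \<bar>x0\<bar> \<le> (\<bar>a\<bar> + \<bar>b\<bar>) + (\<bar>a\<bar> + \<bar>b\<bar>)"
                using True x0 by (intro add_mono) auto
              then show "\<bar>x + x0\<bar> \<le> 2 * (\<bar>a\<bar> + \<bar>b\<bar>)"
                by (simp add: order_trans[OF abs_triangle_ineq])
            qed (use \<delta> in auto)
            finally show ?thesis using J by simp
          next
            case False
            show ?thesis unfolding indicator_simps(2)[OF False] using \<delta>(1) by simp
          qed
          finally show ?thesis by (simp add: algebra_simps)
        next
          case False
          then have "indicator ?J x = (0 :: complex)" using J by (auto simp: indicator_def)
          then have "rep_linf (?A f - ?z *\<^sub>C f) x = 0"
            using elim False by (simp del: atLeastAtMost_iff)
          then show ?thesis using \<delta>(1) B0 by simp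
        qed
      qed
    qed
    then have "c * norm f \<le> \<delta> * ?C" using lower[OF f] by simp
    moreover have "c \<le> c * norm f" using \<open>norm f \<ge> 1\<close> c(1) by simp
    ultimately show ?thesis by simp
  qed
  have "((\<lambda>\<delta>. \<delta> * ?C) \<longlongrightarrow> 0 * ?C) (at_right 0)" by (intro tendsto_intros)
  then have "((\<lambda>\<delta>. \<delta> * ?C) \<longlongrightarrow> 0) (at_right 0)" by simp
  moreover have "\<forall>\<^sub>F \<delta> in at_right 0. c \<le> \<delta> * ?C"
    unfolding eventually_at_right_field
    by (intro exI[of _ "b - x0"]) (use x0 small in auto)
  ultimately have "c \<le> 0" by (rule tendsto_lowerbound) simp
  then show False using c(1) by simp
qed

text \<open>If z were -x1^2, values -x0^2 with x0 near x1 would be further spectral points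
  arbitrarily close to z. Compactness of [a, b] turns nonvanishing into a positive minimum.\<close>

lemma isolated_away_from_multiplier_range:
  assumes ab: "a < b" and B: "bounded_kernel a b B k" and "\<epsilon> > 0"
    and isolated: "cball z \<epsilon> - {z} \<subseteq> resolvent_set (Linf a b) (A_op a b \<alpha> k)"
  obtains d where "d > 0" "\<And>x. x \<in> {a..b} \<Longrightarrow> d \<le> cmod (of_real (x\<^sup>2) + z)"
proof -
  have nz: "of_real (x1\<^sup>2) + z \<noteq> 0" if x1: "x1 \<in> {a..b}" for x1
  proof
    assume "of_real (x1\<^sup>2) + z = 0"
    then have z: "z = of_real (- (x1\<^sup>2))" by (simp add: add_eq_0_iff)
    have "(\<lambda>x. x\<^sup>2) \<midarrow>x1\<rightarrow> x1\<^sup>2" by (intro tendsto_intros)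
    from LIM_D[OF this \<open>\<epsilon> > 0\<close>]
    obtain \<delta> where \<delta>: "\<delta> > 0" "\<forall>x. x \<noteq> x1 \<and> norm (x - x1) < \<delta> \<longrightarrow> norm (x\<^sup>2 - x1\<^sup>2) < \<epsilon>"
      by (elim exE conjE)
    \<comment> \<open>x1 may be an endpoint, but x0 has to be interior for
      \<open>multiplier_range_in_spectrum\<close>.\<close>
    have "infinite {max a (x1 - \<delta>)<..<min b (x1 + \<delta>)}"
      using x1 ab \<delta>(1) by (intro infinite_Ioo) auto
    \<comment> \<open>Both x1 and -x1 are removed: they have the same square, and x0 must give a
      point different from z.\<close>
    then have "infinite ({max a (x1 - \<delta>)<..<min b (x1 + \<delta>)} - {x1, - x1})"
      by (rule Diff_infinite_finite[rotated]) simp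
    then obtain x0 where x0: "x0 \<in> {max a (x1 - \<delta>)<..<min b (x1 + \<delta>)}" "x0 \<notin> {x1, - x1}"
      using infinite_imp_nonempty by blast
    then have "x0 \<noteq> x1 \<and> norm (x0 - x1) < \<delta>" by auto
    then have "\<bar>x0\<^sup>2 - x1\<^sup>2\<bar> < \<epsilon>" using \<delta>(2) by (metis real_norm_def)
    moreover have "dist z (of_real (- (x0\<^sup>2))) = \<bar>x0\<^sup>2 - x1\<^sup>2\<bar>"
      unfolding z dist_of_real dist_real_def by simp
    moreover have "of_real (- (x0\<^sup>2)) \<noteq> z"
      using x0(2) unfolding z by (simp add: power2_eq_iff flip: of_real_power)
    ultimately have "of_real (- (x0\<^sup>2)) \<in> resolvent_set (Linf a b) (A_op a b \<alpha> k)"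
      using isolated by auto
    moreover have "of_real (- (x0\<^sup>2)) \<in> spectrum (Linf a b) (A_op a b \<alpha> k)"
      using x0(1) by (intro multiplier_range_in_spectrum[OF B]) auto
    ultimately show False by (simp add: spectrum_def)
  qed
  have "continuous_on {a..b} (\<lambda>x. cmod (of_real (x\<^sup>2) + z))" by (intro continuous_intros)
  then obtain x1 where "x1 \<in> {a..b}" "\<And>x. x \<in> {a..b} \<Longrightarrow> cmod (of_real (x1\<^sup>2) + z) \<le> cmod (of_real (x\<^sup>2) + z)"
    using continuous_attains_inf[of "{a..b}" "\<lambda>x. cmod (of_real (x\<^sup>2) + z)"] ab by auto
  then show thesis using that[of "cmod (of_real (x1\<^sup>2) + z)"] nz[of x1] by simp
qed

section \<open>Convergence and rate of the approximate spectral points\<close>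

theorem mainTheorem1:
  fixes a b \<alpha> \<epsilon> :: real and r :: nat and k :: "real \<Rightarrow> real \<Rightarrow> complex"
    and \<tau> :: "nat \<Rightarrow> real" and x :: "nat \<Rightarrow> nat \<Rightarrow> real" and ev :: complex
  assumes "a < b" and "r \<ge> 1"
    and "C_on_square r a b k"
    and "gauss_points r \<tau>"
    and "\<And>n. n > 1 \<Longrightarrow> is_partition a b n (x n)"
    and "(\<lambda>n. mesh n (x n)) \<longlonglongrightarrow> 0"
    and "eigenvalue (Linf a b) (A_op a b \<alpha> k) ev"
    and "ev isolated_in spectrum (Linf a b) (A_op a b \<alpha> k)"
    and "0 < \<epsilon>"
    and "ereal \<epsilon> < (INF \<mu>\<in>spectrum (Linf a b) (A_op a b \<alpha> k) - {ev}. ereal (dist ev \<mu>))"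
  shows "(\<forall>\<^sub>F n in sequentially.
            near_spectrum (Linf a b) (A_approx a b \<alpha> r \<tau> n (x n) k) ev \<epsilon> \<noteq> {})
       \<and> (\<forall>evs :: nat \<Rightarrow> complex.
            (\<forall>\<^sub>F n in sequentially.
               evs n \<in> near_spectrum (Linf a b) (A_approx a b \<alpha> r \<tau> n (x n) k) ev \<epsilon>)
            \<longrightarrow> evs \<longlonglongrightarrow> ev)
       \<and> (simple_eigenvalue (Linf a b) (A_op a b \<alpha> k) ev \<longrightarrow>
            (\<exists>C n0. \<forall>n\<ge>n0.
               \<forall>\<mu>\<in>near_spectrum (Linf a b) (A_approx a b \<alpha> r \<tau> n (x n) k) ev \<epsilon>.
                 cmod (\<mu> - ev) \<le> C * mesh n (x n)))"
proof -
  let ?Y = "Linf a b" and ?A = "A_op a b \<alpha> k" and ?An = "\<lambda>n. A_approx a b \<alpha> r \<tau> n (x n) k"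
  let ?h = "\<lambda>n. mesh n (x n)"
  have ab: "a \<le> b" using assms(1) by simp
  have cont: "continuous_on ({a..b} \<times> {a..b}) (\<lambda>(x, u). k x u)"
    by (rule C_on_square_continuous[OF assms(3)])
  obtain B where B: "bounded_kernel a b B k" using continuous_bounded_kernel[OF cont] by blast
  have A: "?A \<in> BL ?Y" by (rule A_op_BL[OF B ab])
  have An: "?An n \<in> BL ?Y" if "n > 1" for n by (rule A_approx_BL[OF assms(5)[OF that] ab])
  obtain C where C: "C \<ge> 0"
      "\<And>n p F. is_partition a b n p \<Longrightarrow> n \<ge> 1 \<Longrightarrow>
        norm (A_approx a b \<alpha> r \<tau> n p k F - ?A F) \<le> C * mesh n p * norm F"
    using A_approx_error[OF ab assms(2,3,4)] by metis
  have err: "norm (?An n F - ?A F) \<le> C * ?h n * norm F" if "n > 1" for n F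
    using C(2)[OF assms(5)[OF that]] that by simp
  have h0: "0 \<le> ?h n" if "n > 1" for n using mesh_nonneg[OF assms(5)[OF that]] that by simp
  \<comment> \<open>The strict inequality yields the closed ball. In \<open>ereal\<close> the
    infimum over the empty set is infinite, so the case of a spectrum reduced to \<open>ev\<close>
    is covered.\<close>
  have isolated: "cball ev \<epsilon> - {ev} \<subseteq> resolvent_set ?Y ?A"
  proof
    fix \<mu> assume \<mu>: "\<mu> \<in> cball ev \<epsilon> - {ev}"
    show "\<mu> \<in> resolvent_set ?Y ?A"
    proof (rule ccontr)
      assume "\<mu> \<notin> resolvent_set ?Y ?A"
      then have "\<mu> \<in> spectrum ?Y ?A - {ev}" using \<mu> by (simp add: spectrum_def)
      then have "(INF \<mu>\<in>spectrum ?Y ?A - {ev}. ereal (dist ev \<mu>)) \<le> ereal (dist ev \<mu>)"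
        by (rule INF_lower)
      with assms(10) have "ereal \<epsilon> < ereal (dist ev \<mu>)" by (rule less_le_trans)
      then show False using \<mu> by simp
    qed
  qed
  have ev: "ev \<in> spectrum ?Y ?A" using assms(7) by (simp add: eigenvalue_def)
  have lim: "(\<lambda>n. C * ?h n) \<longlonglongrightarrow> 0" using tendsto_mult_left[OF assms(6), of C] by simp
  have close: "\<forall>\<^sub>F n in sequentially. n > 1 \<and> (\<forall>f\<in>?Y. norm (?An n f - ?A f) \<le> d * norm f)"
    if "d > 0" for d
    using order_tendstoD(2)[OF lim that] eventually_gt_at_top[of 1]
  proof eventually_elim
    case (elim n)
    have "norm (?An n f - ?A f) \<le> d * norm f" for f
      using err[OF elim(2)] by (rule order_trans) (use elim(1) in \<open>simp add: mult_right_mono\<close>)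
    then show ?case using elim(2) by simp
  qed
  have inside: "\<forall>\<^sub>F n in sequentially. near_spectrum ?Y (?An n) ev \<epsilon> \<subseteq> ball ev \<eta>" if \<eta>: "\<eta> > 0" for \<eta>
  proof -
    obtain d where d: "d > 0" "\<And>T'. T' \<in> BL ?Y \<Longrightarrow> \<forall>f\<in>?Y. norm (T' f - ?A f) \<le> d * norm f
        \<Longrightarrow> near_spectrum ?Y T' ev \<epsilon> \<subseteq> ball ev \<eta>"
      using Linf.near_spectrum_subset_ball[OF A isolated \<eta>] by blast
    show ?thesis
      using close[OF d(1)] by eventually_elim (use An d(2) in blast)
  qed
  have "\<forall>\<^sub>F n in sequentially. near_spectrum ?Y (?An n) ev \<epsilon> \<noteq> {}"
  proof -
    obtain d where d: "d > 0" "\<And>T'. T' \<in> BL ?Y \<Longrightarrow> \<forall>f\<in>?Y. norm (T' f - ?A f) \<le> d * norm f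
        \<Longrightarrow> near_spectrum ?Y T' ev \<epsilon> \<noteq> {}"
      using Linf.near_spectrum_nonempty[OF A ev isolated assms(9)] by blast
    show ?thesis
      using close[OF d(1)] by eventually_elim (use An d(2) in blast)
  qed
  moreover have "evs \<longlonglongrightarrow> ev"
    if evs: "\<forall>\<^sub>F n in sequentially. evs n \<in> near_spectrum ?Y (?An n) ev \<epsilon>" for evs
  proof (rule tendstoI)
    fix \<eta> :: real assume "\<eta> > 0"
    show "\<forall>\<^sub>F n in sequentially. dist (evs n) ev < \<eta>"
      using evs inside[OF \<open>\<eta> > 0\<close>] by eventually_elim (auto simp: dist_commute)
  qed
  moreover have "\<exists>C n0. \<forall>n\<ge>n0. \<forall>\<mu>\<in>near_spectrum ?Y (?An n) ev \<epsilon>. cmod (\<mu> - ev) \<le> C * ?h n"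
    if simple: "simple_eigenvalue ?Y ?A ev"
  proof -
    let ?T = "\<lambda>f. ?A f - ev *\<^sub>C f"
    obtain d where d: "d > 0" "\<And>x. x \<in> {a..b} \<Longrightarrow> d \<le> cmod (of_real (x\<^sup>2) + ev)"
      using isolated_away_from_multiplier_range[OF assms(1) B assms(9) isolated] by blast
    have "Linf.proper_on_bounded a b ?T" by (rule A_op_shift_proper[OF ab cont d])
    then have "\<exists>c>0. \<exists>\<eta>>0. \<forall>\<mu>. cmod \<mu> < \<eta> \<longrightarrow>
        (\<forall>f\<in>?Y. c * cmod \<mu> * norm f \<le> norm (?T f - \<mu> *\<^sub>C f))"
      by (rule Linf.resolvent_simple_pole[OF Linf.BL_shift[OF A]])
        (rule Linf.simple_eigenvalue_ascent_one[OF A simple])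
    then obtain c \<eta> where c: "c > 0" "\<eta> > 0"
      and lower: "\<And>\<mu> f. cmod \<mu> < \<eta> \<Longrightarrow> f \<in> ?Y \<Longrightarrow> c * cmod \<mu> * norm f \<le> norm (?T f - \<mu> *\<^sub>C f)"
      by blast
    obtain n0 where n0: "\<And>n. n \<ge> n0 \<Longrightarrow> near_spectrum ?Y (?An n) ev \<epsilon> \<subseteq> ball ev \<eta>"
      using inside[OF c(2)] unfolding eventually_sequentially by blast
    \<comment> \<open>\<open>max n0 2\<close> also secures n > 1, where the partition hypothesis
      applies. Beyond C / c times the mesh, the lower bound c |\<mu> - \<open>ev\<close>| of
      \<open>?A\<close> - \<mu> exceeds the size C h of the perturbation, so \<mu> cannot be
      spectral for the approximation.\<close>
    have "cmod (\<mu> - ev) \<le> C / c * ?h n"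
      if n: "n \<ge> max n0 2" and \<mu>: "\<mu> \<in> near_spectrum ?Y (?An n) ev \<epsilon>" for n \<mu>
    proof (rule ccontr)
      assume neg: "\<not> cmod (\<mu> - ev) \<le> C / c * ?h n"
      have n1: "n > 1" using n by simp
      have less: "C * ?h n < c * cmod (\<mu> - ev)" using neg c(1) by (simp add: field_simps)
      have "0 \<le> C * ?h n" using C(1) h0[OF n1] by simp
      then have "\<mu> \<noteq> ev" using less by auto
      have "\<mu> \<in> ball ev \<eta>" using n0[of n] n \<mu> by auto
      then have small: "cmod (\<mu> - ev) < \<eta>" by (simp add: dist_norm norm_minus_commute)
      have "\<mu> \<in> cball ev \<epsilon> - {ev}"
        using \<mu> \<open>\<mu> \<noteq> ev\<close> by (simp add: near_spectrum_def dist_norm norm_minus_commute)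
      then have "\<mu> \<in> resolvent_set ?Y ?A" using isolated by blast
      \<comment> \<open>The unspecified c' is kept only for its surjectivity; the constant is
        replaced by c |\<mu> - \<open>ev\<close>|.\<close>
      then obtain c' where "Linf.boundedly_invertible a b (\<lambda>f. ?A f - \<mu> *\<^sub>C f) c'"
        using Linf.resolvent_set_boundedly_invertible[OF A] by blast
      moreover have "c * cmod (\<mu> - ev) * norm f \<le> norm (?A f - \<mu> *\<^sub>C f)" if "f \<in> ?Y" for f
        using lower[OF small that] by (simp add: scaleC_diff_left)
      ultimately have "Linf.boundedly_invertible a b (\<lambda>f. ?A f - \<mu> *\<^sub>C f) (c * cmod (\<mu> - ev))"
        by (simp add: Linf.boundedly_invertible_def)
      then have "Linf.boundedly_invertible a b (\<lambda>f. ?An n f - \<mu> *\<^sub>C f)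
          (c * cmod (\<mu> - ev) - (C * ?h n + cmod (\<mu> - \<mu>)))"
        by (rule Linf.shift_perturb[OF A An[OF n1]])
          (use err[OF n1] less \<open>0 \<le> C * ?h n\<close> in auto)
      then have "\<mu> \<in> resolvent_set ?Y (?An n)"
        by (rule Linf.resolvent_setI[OF An[OF n1]]) (use less in simp)
      then show False using \<mu> by (simp add: near_spectrum_def spectrum_def)
    qed
    then show ?thesis by blast
  qed
  ultimately show ?thesis by blast
qed

end
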